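(* Let $\{\mathbf H_\omega\}$ be a bounded self-adjoint ergodic Hankel operator with IDS measure $\nu$. Then $\int_{\mathbb R}\lambda^2\,d\nu(\lambda)<\infty$. If moreover $\mathbf H_\omega$ is positive semi-definite almost surely, then $\int_{\mathbb R}|\lambda|\,d\nu(\lambda)<\infty$.
   Context: Let $(\Omega,\mathcal F,\mathbf P)$ be a probability space with expectation $\mathbf E$, and let $\{T_a\}$ be an ergodic group of measure-preserving automorphisms of $\Omega$, indexed either by $a\in\mathbb R$ (continuous case) or by $a\in\mathbb Z$ (discrete case, $T_a=T^a$). Fix $\tau>0$; $U_a$ is the shift $(U_af)(\xi)=f(\xi+a)$ on $L^2(\mathbb R)$. A Hankel operator on $L^2(\mathbb R_+)$ with kernel function $h$ is $(Hf)(t)=\int_0^\infty h(t+s)f(s)\,ds$; with $(\mathcal Ef)(\xi)=e^{\xi/2}f(e^\xi)$ set $\mathbf H=\mathcal EH\mathcal E^*$, the integral operator on $L^2(\mathbb R)$ with kernel $e^{(x+y)/2}h(e^x+e^y)$. A bounded self-adjoint ergodic Hankel operator is a weakly measurable family $\{\mathbf H_\omega\}$ of such operators with real-valued kernel functions $h_\omega$, satisfying $\mathbf H_{T_a\omega}U_{\tau a}=U_{\tau a}\mathbf H_\omega$ for all admissible $a$, and almost surely $|h_\omega(t)|\le C_h/t$ for all $t>0$ with $C_h$ independent of $\omega$. IDS measure: for Borel $\Delta\subset\mathbb R$ separated from $0$, $\chi_\Delta(\mathbf H_\omega)$ has a continuous integral kernel and $\nu(\Delta)=\mathbf E\{\chi_\Delta(\mathbf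 H_\omega)(0,0)\}$ (continuous case), $\nu(\Delta)=\mathbf E\{\frac1\tau\int_0^\tau\chi_\Delta(\mathbf H_\omega)(x,x)\,dx\}$ (discrete case); $\nu(\{0\})=0$. *)

theory Defs
  imports "HOL-Probability.Probability"
begin

text \<open>Integral kernel of E H E* on L2(R): exp((x+y)/2) h(exp x + exp y).\<close>
definition hkern :: "(real \<Rightarrow> real) \<Rightarrow> real \<Rightarrow> real \<Rightarrow> real" where
  "hkern h x y = exp ((x + y) / 2) * h (exp x + exp y)"

definition hop :: "(real \<Rightarrow> real) \<Rightarrow> (real \<Rightarrow> real) \<Rightarrow> real \<Rightarrow> real" where
  "hop h f = (\<lambda>x. \<integral>y. hkern h x y * f y \<partial>lborel)"

definition sqint :: "(real \<Rightarrow> real) \<Rightarrow> bool" where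
  "sqint u \<longleftrightarrow> u \<in> borel_measurable lborel \<and> integrable lborel (\<lambda>x. (u x)\<^sup>2)"

definition l2inner :: "(real \<Rightarrow> real) \<Rightarrow> (real \<Rightarrow> real) \<Rightarrow> real" where
  "l2inner u v = (\<integral>x. u x * v x \<partial>lborel)"

definition shiftU :: "real \<Rightarrow> (real \<Rightarrow> real) \<Rightarrow> real \<Rightarrow> real" where
  "shiftU a f = (\<lambda>\<xi>. f (\<xi> + a))"

text \<open>mu is the spectral measure of the vector u for the operator hop h:
  a finite Borel measure whose moments are the numbers <H^k u, u>.
  (For a bounded self-adjoint operator this determines mu uniquely, and
  mu(Delta) = <chi_Delta(H) u, u>.)\<close>
definition is_spec_meas :: "(real \<Rightarrow> real) \<Rightarrow> (real \<Rightarrow> real) \<Rightarrow> real measure \<Rightarrow> bool" where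
  "is_spec_meas h u \<mu> \<longleftrightarrow> finite_measure \<mu> \<and> sets \<mu> = sets borel \<and>
     (\<forall>k::nat. integrable \<mu> (\<lambda>l. l ^ k) \<and>
        (\<integral>l. l ^ k \<partial>\<mu>) = l2inner ((hop h ^^ k) u) u)"

definition compact_supp_cont :: "(real \<Rightarrow> real) \<Rightarrow> bool" where
  "compact_supp_cont u \<longleftrightarrow> continuous_on UNIV u \<and> bounded {x. u x \<noteq> 0}"

text \<open>k is a continuous integral kernel of the spectral projection chi_Delta(hop h)
  (tested through the quadratic form on continuous compactly supported functions).\<close>
definition spec_kernel :: "(real \<Rightarrow> real) \<Rightarrow> real set \<Rightarrow> (real \<Rightarrow> real \<Rightarrow> real) \<Rightarrow> bool" where
  "spec_kernel h \<Delta> k \<longleftrightarrow> continuous_on UNIV (\<lambda>(x, y). k x y) \<and>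
     (\<forall>u. compact_supp_cont u \<longrightarrow>
        (\<exists>\<mu>. is_spec_meas h u \<mu> \<and>
           measure \<mu> \<Delta> = (\<integral>x. (\<integral>y. k x y * u x * u y \<partial>lborel) \<partial>lborel)))"

definition separated_from_0 :: "real set \<Rightarrow> bool" where
  "separated_from_0 \<Delta> \<longleftrightarrow> (\<exists>\<epsilon>>0. \<forall>l\<in>\<Delta>. \<epsilon> \<le> \<bar>l\<bar>)"

text \<open>The quantity whose expectation is nu(Delta): chi_Delta(H)(0,0) in the
  continuous case, (1/tau) int_0^tau chi_Delta(H)(x,x) dx in the discrete case.\<close>
definition ids_density :: "bool \<Rightarrow> real \<Rightarrow> (real \<Rightarrow> real) \<Rightarrow> real set \<Rightarrow> real" where
  "ids_density disc \<tau> h \<Delta> =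
     (if disc then (THE c. \<exists>k. spec_kernel h \<Delta> k \<and> c = (1 / \<tau>) * integral {0..\<tau>} (\<lambda>x. k x x))
      else (THE c. \<exists>k. spec_kernel h \<Delta> k \<and> c = k 0 0))"

definition idx :: "bool \<Rightarrow> real set" where
  "idx disc = (if disc then \<int> else UNIV)"

definition ergodic_group :: "'a measure \<Rightarrow> bool \<Rightarrow> (real \<Rightarrow> 'a \<Rightarrow> 'a) \<Rightarrow> bool" where
  "ergodic_group M disc T \<longleftrightarrow>
     (\<forall>a\<in>idx disc. T a \<in> M \<rightarrow>\<^sub>M M \<and> distr M M (T a) = M) \<and>
     (\<forall>\<omega>\<in>space M. T 0 \<omega> = \<omega>) \<and>
     (\<forall>a\<in>idx disc. \<forall>b\<in>idx disc. \<forall>\<omega>\<in>space M. T (a + b) \<omega> = T a (T b \<omega>)) \<and>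
     (\<forall>S\<in>sets M. (\<forall>a\<in>idx disc. T a -` S \<inter> space M = S) \<longrightarrow>
        measure M S = 0 \<or> measure M S = 1)"

definition ergodic_hankel ::
  "'a measure \<Rightarrow> bool \<Rightarrow> (real \<Rightarrow> 'a \<Rightarrow> 'a) \<Rightarrow> real \<Rightarrow> ('a \<Rightarrow> real \<Rightarrow> real) \<Rightarrow> bool" where
  "ergodic_hankel M disc T \<tau> h \<longleftrightarrow>
     prob_space M \<and> ergodic_group M disc T \<and> \<tau> > 0 \<and>
     (\<forall>\<omega>\<in>space M. h \<omega> \<in> borel_measurable borel) \<and>
     (\<forall>u v. sqint u \<longrightarrow> sqint v \<longrightarrow>
        (\<lambda>\<omega>. l2inner (hop (h \<omega>) u) v) \<in> borel_measurable M) \<and>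
     (\<forall>a\<in>idx disc. \<forall>\<omega>\<in>space M. \<forall>u. sqint u \<longrightarrow>
        (AE \<xi> in lborel. hop (h (T a \<omega>)) (shiftU (\<tau> * a) u) \<xi> = shiftU (\<tau> * a) (hop (h \<omega>) u) \<xi>)) \<and>
     (\<exists>C. AE \<omega> in M. \<forall>t>0. \<bar>h \<omega> t\<bar> \<le> C / t)"

definition is_IDS_measure ::
  "'a measure \<Rightarrow> bool \<Rightarrow> real \<Rightarrow> ('a \<Rightarrow> real \<Rightarrow> real) \<Rightarrow> real measure \<Rightarrow> bool" where
  "is_IDS_measure M disc \<tau> h \<nu> \<longleftrightarrow>
     sets \<nu> = sets borel \<and> emeasure \<nu> {0} = 0 \<and>
     (\<forall>\<Delta>\<in>sets borel. separated_from_0 \<Delta> \<longrightarrow>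
        emeasure \<nu> \<Delta> = (\<integral>\<^sup>+\<omega>. ennreal (ids_density disc \<tau> (h \<omega>) \<Delta>) \<partial>M))"

definition psd_hankel :: "(real \<Rightarrow> real) \<Rightarrow> bool" where
  "psd_hankel h \<longleftrightarrow> (\<forall>u. sqint u \<longrightarrow> l2inner (hop h u) u \<ge> 0)"

end

theory Submission
  imports Defs
begin

text \<open>Write \<open>K x\<close> for the section \<open>K x y\<close> of the integral kernel of \<open>H\<close>. The bound \<open>C / t\<close> on \<open>h\<close>
  gives \<open>\<bar>K x y\<bar> \<le> C exp (- \<bar>x - y\<bar> / 2)\<close>, so \<open>H\<close> is bounded, and \<open>x \<mapsto> K x\<close> is bounded and continuous
  in mean square. Factoring \<open>\<chi>(H) = H g(H) H\<close> with \<open>g = \<chi> / \<lambda>\<^sup>2\<close> shows that \<open>\<langle>g(H) (K x), K y\<rangle>\<close> is the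
  continuous kernel of the spectral projection; by linearity, a simple function \<open>s \<le> \<lambda>\<^sup>2\<close> has
  density of states at most \<open>sup \<parallel>K x\<parallel>\<^sup>2\<close>. If \<open>H \<ge> 0\<close> and \<open>s \<le> \<bar>\<lambda>\<bar>\<close>, the quadratic form of \<open>s(H)\<close> is at most that
  of \<open>H\<close>, and test functions concentrating at a point bound the diagonal of the kernel of \<open>s(H)\<close> by \<open>sup \<bar>K\<bar> \<le> C\<close>.
  Spectral measures come from the Hausdorff moment problem, and identities between them are extended from
  polynomials to bounded Borel functions by a monotone class argument.\<close>

subsection \<open>The Hausdorff moment problem\<close>

text \<open>A spectral measure is given only through its moments, so the functional calculus is
  carried as a quadratic form <g(H) u, u>, and statements about two vectors pass through
  polarisation. Separation of the set from 0 is what makes g bounded, and each outer factor of H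
  g(H) H regularises one variable, since (H v)(x) = <K x, v>. The obstacle is that \<open>h\<close>
  is merely measurable: the kernel of H itself may be discontinuous, and only its sections, as
  elements of L2, depend continuously on the point. For the first moment the quotient s /
  \<lambda>^2 has no bound independent of s near 0, so sections of finite norm no longer suffice;
  positivity allows a comparison of forms instead, because |\<lambda>| = \<lambda> on the spectrum.
  The density is a definite description, so uniqueness matters as much as existence; the quadratic
  form determines the diagonal of a continuous kernel, though not the kernel. The constants come
  from the total mass 4 of exp (- |s| / 2): sections have squared norm at most 4 C^2, and H has norm
  at most 4 C.\<close>

lemma completely_monotone_binomial_sum:
  fixes q :: "nat \<Rightarrow> nat \<Rightarrow> real"
  assumes rec: "\<And>a b. q a b = q (Suc a) b + q a (Suc b)"
  shows "(\<Sum>k\<le>n. real (n choose k) * q (a + k) (b + (n - k))) = q a b"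
proof (induction n arbitrary: a b)
  case 0
  then show ?case by simp
next
  case (Suc n)
  \<comment> \<open>\<open>q a b\<close> stands for the integral of t^a (1 - t)^b against the
    measure sought. The recurrence is t + (1 - t) = 1, the claim expands (t + (1 - t))^n, and
    Pascal's rule drives the induction.\<close>
  have "(\<Sum>k\<le>Suc n. real (Suc n choose k) * q (a + k) (b + (Suc n - k)))
      = q a (b + Suc n) + (\<Sum>k\<le>n. real (Suc n choose Suc k) * q (a + Suc k) (b + (n - k)))"
    by (subst sum.atMost_Suc_shift) simp
  also have "\<dots> = q a (b + Suc n) + (\<Sum>k\<le>n. real (n choose Suc k) * q (a + Suc k) (b + (n - k)))
       + (\<Sum>k\<le>n. real (n choose k) * q (Suc a + k) (b + (n - k)))"
    by (simp add: algebra_simps sum.distrib)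
  also have "q a (b + Suc n) + (\<Sum>k\<le>n. real (n choose Suc k) * q (a + Suc k) (b + (n - k)))
     = (\<Sum>k\<le>Suc n. real (n choose k) * q (a + k) (b + (Suc n - k)))"
    by (subst sum.atMost_Suc_shift) simp
  also have "\<dots> = (\<Sum>k\<le>n. real (n choose k) * q (a + k) (Suc b + (n - k)))"
    by (simp add: Suc_diff_le)
  also have "\<dots> = q a (Suc b)" by (rule Suc)
  also have "(\<Sum>k\<le>n. real (n choose k) * q (Suc a + k) (b + (n - k))) = q (Suc a) b" by (rule Suc)
  finally show ?case using rec[of a b] by simp
qed

text \<open>As a function of k, the ratio \<open>(k choose j) / (n choose j)\<close> has t^j as its
  exact Bernstein polynomial of degree n. The discrete measures thus reproduce the j-th moment
  without error, except that this ratio stands in place of (k/n)^j.\<close>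

lemma binomial_quotient_moment:
  fixes q :: "nat \<Rightarrow> nat \<Rightarrow> real"
  assumes rec: "\<And>a b. q a b = q (Suc a) b + q a (Suc b)" and jn: "j \<le> n"
  shows "(\<Sum>k\<le>n. real (n choose k) * q k (n - k) * (real (k choose j) / real (n choose j))) = q j 0"
proof -
  have pos: "real (n choose j) > 0" using jn by simp
  have "(\<Sum>k\<le>n. real (n choose k) * q k (n - k) * (real (k choose j) / real (n choose j)))
     = (\<Sum>k\<in>{j..n}. real (n choose k) * q k (n - k) * (real (k choose j) / real (n choose j)))"
    by (rule sum.mono_neutral_right) (auto simp: not_le)
  also have "\<dots> = (\<Sum>k\<in>{j..n}. real ((n - j) choose (k - j)) * q k (n - k))"
  proof (rule sum.cong[OF refl])
    fix k assume k: "k \<in> {j..n}"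
    have "real (n choose k) * real (k choose j) = real (n choose j) * real ((n - j) choose (k - j))"
      using choose_mult[of j k n] k by (metis atLeastAtMost_iff of_nat_mult)
    then have "real (n choose k) * real (k choose j) / real (n choose j) = real ((n - j) choose (k - j))"
      using pos by (simp add: field_simps)
    moreover have "real (n choose k) * q k (n - k) * (real (k choose j) / real (n choose j))
       = (real (n choose k) * real (k choose j) / real (n choose j)) * q k (n - k)" by simp
    ultimately show "real (n choose k) * q k (n - k) * (real (k choose j) / real (n choose j))
       = real ((n - j) choose (k - j)) * q k (n - k)"
      by simp
  qed
  also have "\<dots> = (\<Sum>i\<le>n - j. real ((n - j) choose i) * q (j + i) (0 + ((n - j) - i)))"
    by (rule sum.reindex_bij_witness[of _ "\<lambda>i. j + i" "\<lambda>k. k - j"]) (use jn in auto)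
  also have "\<dots> = q j 0" by (rule completely_monotone_binomial_sum[of q, OF rec])
  finally show ?thesis .
qed

text \<open>Both quantities are products of j factors of modulus at most 1, and corresponding
  factors differ by at most j / (n - j).\<close>

lemma binomial_quotient_approx:
  assumes kn: "k \<le> n" and n: "2 * j < n"
  shows "\<bar>(real k / real n) ^ j - real (k choose j) / real (n choose j)\<bar> \<le> real j * real j / real (n - j)"
proof -
  let ?z = "\<lambda>i::nat. real k / real n" and ?w = "\<lambda>i. (real k - real i) / (real n - real i)"
  have e1: "(real k / real n) ^ j = (\<Prod>i\<in>{0..<j}. ?z i)" by simp
  have e2: "real (k choose j) / real (n choose j) = (\<Prod>i\<in>{0..<j}. ?w i)"
    by (simp add: binomial_gbinomial gbinomial_prod_rev prod_dividef)
  have "norm ((\<Prod>i\<in>{0..<j}. ?z i) - (\<Prod>i\<in>{0..<j}. ?w i)) \<le> (\<Sum>i\<in>{0..<j}. norm (?z i - ?w i))"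
  proof (rule norm_prod_diff)
    fix i assume "i \<in> {0..<j}"
    show "norm (?z i) \<le> 1" using kn n by (simp add: divide_le_eq)
    \<comment> \<open>For k < i the numerator is negative, and i - k \<le> n - i follows from 2 i
      \<le> n; this is what \<open>2 * j < n\<close> guarantees.\<close>
    have "\<bar>real k - real i\<bar> \<le> real n - real i" using \<open>i \<in> {0..<j}\<close> kn n by auto
    then show "norm (?w i) \<le> 1" by (auto simp: abs_divide divide_le_eq)
  qed
  also have "\<dots> \<le> (\<Sum>i\<in>{0..<j}. real j / real (n - j))"
  proof (rule sum_mono)
    fix i assume i: "i \<in> {0..<j}"
    have d: "?z i - ?w i = real i * (real n - real k) / (real n * (real n - real i))"
      using i n by (simp add: field_simps)
    have nonneg: "?z i - ?w i \<ge> 0" unfolding d using i n kn by (intro divide_nonneg_nonneg mult_nonneg_nonneg) auto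
    have "?z i - ?w i \<le> real i * real n / (real n * (real n - real i))"
      unfolding d using i n kn by (intro divide_right_mono mult_left_mono mult_nonneg_nonneg) auto
    also have "\<dots> = real i / (real n - real i)" using n by simp
    also have "\<dots> \<le> real j / real (n - j)" using i n by (intro frac_le) auto
    finally show "norm (?z i - ?w i) \<le> real j / real (n - j)" using nonneg by simp
  qed
  also have "\<dots> = real j * real j / real (n - j)" by simp
  finally show ?thesis unfolding e1 e2 by simp
qed

text \<open>The approximating measures put the Bernstein weight \<open>(n choose k) q k (n - k)\<close> at \<open>k / n\<close>;
  Helly's theorem supplies the limit.\<close>
lemma hausdorff_moment_prob:
  fixes q :: "nat \<Rightarrow> nat \<Rightarrow> real"
  assumes nonneg: "\<And>a b. 0 \<le> q a b" and rec: "\<And>a b. q a b = q (Suc a) b + q a (Suc b)"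
    and one: "q 0 0 = 1"
  shows "\<exists>\<mu>. real_distribution \<mu> \<and> (AE t in \<mu>. t \<in> {0..1}) \<and> (\<forall>k. (\<integral>t. t ^ k \<partial>\<mu>) = q k 0)"
proof -
  define w where "w n k = real (n choose k) * q k (n - k)" for n k
  have w0: "0 \<le> w n k" for n k unfolding w_def using nonneg by simp
  have w1: "(\<Sum>k\<le>n. w n k) = 1" for n
    using completely_monotone_binomial_sum[of q, OF rec, of n 0 0] one by (simp add: w_def)
  define P where "P n = point_measure {..n} (\<lambda>k. ennreal (w n k))" for n
  define \<mu> where "\<mu> n = distr (P n) borel (\<lambda>k. real k / real n)" for n
  have P: "prob_space (P n)" for n unfolding P_def using w0 w1[of n]
    by (intro prob_space_point_measure) (auto simp: sum_nonneg)
  have mP: "(\<lambda>k. f k) \<in> measurable (P n) borel" for f :: "nat \<Rightarrow> real" and n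
    unfolding P_def by (simp add: measurable_point_measure_eq1)
  have rd: "real_distribution (\<mu> n)" for n
    unfolding \<mu>_def by (intro prob_space.real_distribution_distr P mP)
  have int\<mu>: "(\<integral>t. f t \<partial>\<mu> n) = (\<Sum>k\<le>n. w n k * f (real k / real n))"
    if "f \<in> borel_measurable borel" for f :: "real \<Rightarrow> real" and n
    unfolding \<mu>_def using that w0
    by (subst integral_distr[OF mP]) (auto simp: P_def lebesgue_integral_point_measure_finite)
  \<comment> \<open>Tightness is phrased with intervals open on the left, so the left end is -1 in
    order to contain an atom at 0.\<close>
  have supp: "measure (\<mu> n) {-1<..1} = 1" for n
  proof -
    have "measure (\<mu> n) {-1<..1} = (\<integral>t. indicat_real {-1<..1} t \<partial>\<mu> n)"
      using rd[of n] by (simp add: real_distribution_def real_distribution_axioms_def)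
    also have "\<dots> = (\<Sum>k\<le>n. w n k * indicat_real {-1<..1} (real k / real n))"
      by (rule int\<mu>) simp
    also have "\<dots> = (\<Sum>k\<le>n. w n k)"
    proof (rule sum.cong[OF refl])
      fix k assume "k \<in> {..n}"
      then have "real k / real n \<le> 1" by (simp add: divide_le_eq)
      moreover have "-1 < real k / real n" by (rule less_le_trans[of _ 0]) auto
      ultimately show "w n k * indicat_real {-1<..1} (real k / real n) = w n k" by simp
    qed
    finally show ?thesis using w1 by simp
  qed
  have "tight \<mu>" unfolding tight_def
  proof (intro conjI allI impI rd)
    fix \<epsilon> :: real assume "0 < \<epsilon>"
    then show "\<exists>a b. a < b \<and> (\<forall>n. 1 - \<epsilon> < measure (\<mu> n) {a<..b})"
      by (intro exI[of _ "-1"] exI[of _ 1]) (simp add: supp)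
  qed
  then obtain r M where r: "strict_mono (r :: nat \<Rightarrow> nat)" and M: "real_distribution M"
    and wc: "weak_conv_m (\<mu> \<circ> id \<circ> r) M"
    using tight_imp_convergent_subsubsequence[of \<mu> id] by (auto simp: strict_mono_def)
  interpret M: real_distribution M by (rule M)
  have lim: "(\<lambda>n. \<Sum>k\<le>r n. w (r n) k * f (real k / real (r n))) \<longlonglongrightarrow> (\<integral>t. f t \<partial>M)"
    if c: "continuous_on UNIV f" and b: "\<And>x. \<bar>f x\<bar> \<le> B" for f :: "real \<Rightarrow> real" and B
  proof -
    have "(\<lambda>n. integral\<^sup>L ((\<mu> \<circ> id \<circ> r) n) f) \<longlonglongrightarrow> integral\<^sup>L M f"
      by (rule weak_conv_imp_integral_bdd_continuous_conv[OF _ M wc, of f B])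
        (use c b rd in \<open>auto simp: continuous_on_eq_continuous_at\<close>)
    moreover have "f \<in> borel_measurable borel" using c by (rule borel_measurable_continuous_onI)
    ultimately show ?thesis by (simp add: int\<mu>)
  qed
  \<comment> \<open>Clamping to [0, 1] fixes every atom k/n and turns t^j into a bounded continuous
    test function, as weak convergence demands.\<close>
  define cl where "cl t = max 0 (min 1 t)" for t :: real
  have clc: "continuous_on UNIV cl" unfolding cl_def by (intro continuous_intros)
  have cl01: "0 \<le> cl t" "cl t \<le> 1" for t unfolding cl_def by auto
  have clid: "cl (real k / real n) = real k / real n" if "k \<le> n" for k n
  proof -
    have "real k / real n \<le> 1" using that by (simp add: divide_le_eq)
    then show ?thesis unfolding cl_def by simp
  qed
  have AE01: "AE t in M. t \<in> {0..1}"
  proof -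
    \<comment> \<open>A bounded continuous function with zero set exactly [0, 1]. Its integrals
      against the discrete measures vanish, hence so does the integral against the limit.\<close>
    let ?f = "\<lambda>t. min 1 \<bar>t - cl t\<bar>"
    have cf: "continuous_on UNIV ?f" by (intro continuous_intros clc)
    have bf: "\<bar>?f x\<bar> \<le> 1" for x by simp
    have "(\<lambda>n. \<Sum>k\<le>r n. w (r n) k * ?f (real k / real (r n))) = (\<lambda>n. 0)"
      by (intro ext sum.neutral) (auto simp: clid)
    with lim[OF cf bf] have "(\<lambda>n. 0) \<longlonglongrightarrow> (\<integral>t. ?f t \<partial>M)" by simp
    then have z: "(\<integral>t. ?f t \<partial>M) = 0" by (simp add: LIMSEQ_const_iff)
    have mf: "?f \<in> borel_measurable M"
      using borel_measurable_continuous_onI[OF cf] by simp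
    have "integrable M ?f" using mf by (intro M.integrable_const_bound[of _ 1]) auto
    then have "AE t in M. ?f t = 0"
      using z by (subst (asm) integral_nonneg_eq_0_iff_AE) auto
    then show ?thesis by eventually_elim (auto simp: cl_def max_def min_def split: if_splits)
  qed
  have mom: "(\<integral>t. t ^ j \<partial>M) = q j 0" for j
  proof -
    let ?f = "\<lambda>t. cl t ^ j"
    have cf: "continuous_on UNIV ?f" by (intro continuous_intros clc)
    have bf: "\<bar>?f x\<bar> \<le> 1" for x using cl01[of x] by (simp add: power_le_one)
    have L1: "(\<lambda>n. \<Sum>k\<le>r n. w (r n) k * ?f (real k / real (r n))) \<longlonglongrightarrow> (\<integral>t. ?f t \<partial>M)"
      by (rule lim[OF cf bf])
    let ?s = "\<lambda>n. \<Sum>k\<le>n. w n k * (real k / real n) ^ j"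
    \<comment> \<open>The weights sum to 1, so the error in the j-th moment is at most the uniform
      distance between the power and the binomial ratio.\<close>
    have ev: "eventually (\<lambda>n. \<bar>?s n - q j 0\<bar> \<le> real j * real j / real (n - j)) sequentially"
      using eventually_gt_at_top[of "2 * j"]
    proof eventually_elim
      case (elim n)
      have "?s n - q j 0 = (\<Sum>k\<le>n. w n k * ((real k / real n) ^ j - real (k choose j) / real (n choose j)))"
        using binomial_quotient_moment[of q, OF rec, of j n] elim
        by (simp add: w_def algebra_simps sum_subtractf)
      also have "\<bar>\<dots>\<bar> \<le> (\<Sum>k\<le>n. w n k * (real j * real j / real (n - j)))"
        by (rule order_trans[OF sum_abs])
          (use binomial_quotient_approx[OF _ elim] w0 in
            \<open>auto simp: abs_mult intro!: sum_mono mult_left_mono simp del: times_divide_eq_right\<close>)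
      also have "\<dots> = real j * real j / real (n - j)" by (simp add: w1 flip: sum_distrib_right sum_divide_distrib)
      finally show ?case .
    qed
    have "(\<lambda>n. real j * real j / real (n - j)) \<longlonglongrightarrow> 0"
    proof (rule LIMSEQ_offset[of _ j])
      show "(\<lambda>n. real j * real j / real (n + j - j)) \<longlonglongrightarrow> 0"
        using tendsto_divide_0[OF tendsto_const filterlim_real_sequentially[THEN filterlim_at_top_imp_at_infinity]] by simp
    qed
    then have "(\<lambda>n. ?s n - q j 0) \<longlonglongrightarrow> 0"
      by (rule Lim_null_comparison[rotated]) (use ev in simp)
    then have "?s \<longlonglongrightarrow> q j 0" by (simp add: LIM_zero_iff)
    then have "(\<lambda>n. ?s (r n)) \<longlonglongrightarrow> q j 0" using LIMSEQ_subseq_LIMSEQ[OF _ r, of ?s] by (simp add: o_def)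
    moreover have "?s (r n) = (\<Sum>k\<le>r n. w (r n) k * ?f (real k / real (r n)))" for n
      by (rule sum.cong) (auto simp: clid)
    ultimately have "(\<integral>t. ?f t \<partial>M) = q j 0" using L1 LIMSEQ_unique by auto
    moreover have "(\<integral>t. ?f t \<partial>M) = (\<integral>t. t ^ j \<partial>M)"
      by (rule integral_cong_AE)
        (use AE01 borel_measurable_continuous_onI[OF cf] in \<open>auto simp: cl_def\<close>)
    ultimately show ?thesis by simp
  qed
  show ?thesis using M AE01 mom by blast
qed

lemma hausdorff_moment:
  fixes q :: "nat \<Rightarrow> nat \<Rightarrow> real"
  assumes nonneg: "\<And>a b. 0 \<le> q a b" and rec: "\<And>a b. q a b = q (Suc a) b + q a (Suc b)"
  shows "\<exists>\<mu>. finite_measure \<mu> \<and> sets \<mu> = sets borel \<and> (AE t in \<mu>. t \<in> {0..1}) \<and>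
    (\<forall>k. (\<integral>t. t ^ k \<partial>\<mu>) = q k 0)"
proof (cases "q 0 0 = 0")
  case True
  \<comment> \<open>Recurrence and nonnegativity make \<open>q k 0\<close> decreasing in k, so zero
    total mass forces all moments to vanish.\<close>
  have "q k 0 \<le> q 0 0" for k
  proof (induction k)
    case (Suc k)
    then show ?case using rec[of k 0] nonneg[of k "Suc 0"] by linarith
  qed simp
  then have "q k 0 = 0" for k using nonneg[of k 0] True by (metis order_antisym)
  then show ?thesis
    by (intro exI[of _ "null_measure borel"])
      (auto simp: AE_I[of _ _ UNIV] finite_measure.intro intro!: finite_measureI)
next
  case False
  then have pos: "q 0 0 > 0" using nonneg[of 0 0] by simp
  have "\<exists>\<mu>. real_distribution \<mu> \<and> (AE t in \<mu>. t \<in> {0..1}) \<and> (\<forall>k. (\<integral>t. t ^ k \<partial>\<mu>) = q k 0 / q 0 0)"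
  proof (rule hausdorff_moment_prob[of "\<lambda>a b. q a b / q 0 0"])
    show "q a b / q 0 0 = q (Suc a) b / q 0 0 + q a (Suc b) / q 0 0" for a b
      by (subst rec) (rule add_divide_distrib)
  qed (use nonneg pos in auto)
  then obtain \<mu> where \<mu>: "real_distribution \<mu>" "AE t in \<mu>. t \<in> {0..1}"
    "\<And>k. (\<integral>t. t ^ k \<partial>\<mu>) = q k 0 / q 0 0" by blast
  interpret real_distribution \<mu> by (rule \<mu>)
  let ?N = "density \<mu> (\<lambda>_. ennreal (q 0 0))"
  have "finite_measure ?N"
    by (rule finite_measureI) (simp add: emeasure_density nn_integral_cmult emeasure_space_1 ennreal_mult_eq_top_iff)
  moreover have "AE t in ?N. t \<in> {0..1}" using \<mu>(2) by (subst AE_density) auto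
  moreover have "(\<integral>t. t ^ k \<partial>?N) = q k 0" for k
    using pos by (subst integral_density) (auto simp: \<mu>(3))
  ultimately show ?thesis by (intro exI[of _ ?N]) auto
qed

subsection \<open>A functional monotone class theorem on an interval\<close>

text \<open>Boundedness is asked only on the interval that will carry the spectral measures, so that
  polynomials belong to the class.\<close>

definition bounded_borel_on :: "real \<Rightarrow> (real \<Rightarrow> real) \<Rightarrow> bool" where
  "bounded_borel_on R f \<longleftrightarrow> f \<in> borel_measurable borel \<and> (\<exists>c. \<forall>x\<in>{-R..R}. \<bar>f x\<bar> \<le> c)"

lemma bounded_borel_onI: "f \<in> borel_measurable borel \<Longrightarrow> (\<And>x. x \<in> {-R..R} \<Longrightarrow> \<bar>f x\<bar> \<le> c) \<Longrightarrow> bounded_borel_on R f"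
  unfolding bounded_borel_on_def by blast

lemma bounded_borel_on_continuous: "continuous_on UNIV f \<Longrightarrow> bounded_borel_on R f"
proof -
  assume c: "continuous_on UNIV f"
  then have "compact (f ` {-R..R})"
    by (intro compact_continuous_image) (auto intro: continuous_on_subset)
  then have "bounded (f ` {-R..R})" by (rule compact_imp_bounded)
  then show ?thesis using c by (auto simp: bounded_borel_on_def bounded_iff intro: borel_measurable_continuous_onI)
qed

lemma bounded_borel_on_lin: "bounded_borel_on R f \<Longrightarrow> bounded_borel_on R g \<Longrightarrow> bounded_borel_on R (\<lambda>x. a * f x + b * g x)"
proof -
  assume f: "bounded_borel_on R f" and g: "bounded_borel_on R g"
  obtain c d where c: "\<forall>x\<in>{-R..R}. \<bar>f x\<bar> \<le> c" and d: "\<forall>x\<in>{-R..R}. \<bar>g x\<bar> \<le> d"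
    using f g by (auto simp: bounded_borel_on_def)
  have "\<bar>a * f x + b * g x\<bar> \<le> \<bar>a\<bar> * c + \<bar>b\<bar> * d" if "x \<in> {-R..R}" for x
    using c d that by (intro order_trans[OF abs_triangle_ineq]) (auto simp: abs_mult intro!: add_mono mult_left_mono)
  moreover have "(\<lambda>x. a * f x + b * g x) \<in> borel_measurable borel" using f g by (auto simp: bounded_borel_on_def)
  ultimately show ?thesis by (rule bounded_borel_onI[rotated])
qed

text \<open>\<open>P\<close> will be an identity between expressions depending linearly on a
  function. The closure condition \<open>lim\<close> has the shape in which dominated convergence
  supplies it: pointwise convergence on [-R, R] under a common bound.\<close>

locale monotone_class_on =
  fixes R :: real and P :: "(real \<Rightarrow> real) \<Rightarrow> bool"
  assumes power: "\<And>k. P (\<lambda>x. x ^ k)"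
    and lin: "\<And>f g a b. bounded_borel_on R f \<Longrightarrow> bounded_borel_on R g \<Longrightarrow> P f \<Longrightarrow> P g \<Longrightarrow> P (\<lambda>x. a * f x + b * g x)"
    and lim: "\<And>F f c. (\<And>n. bounded_borel_on R (F n)) \<Longrightarrow> bounded_borel_on R f \<Longrightarrow> (\<And>n x. x \<in> {-R..R} \<Longrightarrow> \<bar>F n x\<bar> \<le> c) \<Longrightarrow>
       (\<And>x. x \<in> {-R..R} \<Longrightarrow> (\<lambda>n. F n x) \<longlonglongrightarrow> f x) \<Longrightarrow> (\<And>n. P (F n)) \<Longrightarrow> P f"
begin

lemma zero: "P (\<lambda>x. 0)"
proof -
  have "P (\<lambda>x. 0 * x ^ 0 + 0 * x ^ 0)" by (intro lin power bounded_borel_on_continuous continuous_intros)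
  then show ?thesis by simp
qed

lemma sum:
  assumes "finite S" "\<And>i. i \<in> S \<Longrightarrow> bounded_borel_on R (f i)" "\<And>i. i \<in> S \<Longrightarrow> P (f i)"
  shows "bounded_borel_on R (\<lambda>x. \<Sum>i\<in>S. a i * f i x) \<and> P (\<lambda>x. \<Sum>i\<in>S. a i * f i x)"
  using assms
proof (induction S)
  case empty
  then show ?case using zero by (auto intro: bounded_borel_on_continuous)
next
  case (insert i S)
  have "bounded_borel_on R (\<lambda>x. a i * f i x + 1 * (\<Sum>i\<in>S. a i * f i x))"
       "P (\<lambda>x. a i * f i x + 1 * (\<Sum>i\<in>S. a i * f i x))"
    using insert by (intro bounded_borel_on_lin lin; simp)+
  then show ?case using insert(1,2) by simp
qed

lemma continuous:
  assumes c: "continuous_on UNIV f"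
  shows "P f"
proof -
  have "\<exists>g. real_polynomial_function g \<and> (\<forall>x\<in>{-R..R}. \<bar>f x - g x\<bar> < 1 / Suc n)" for n :: nat
    using Stone_Weierstrass_real_polynomial_function[of "{-R..R}" f "1 / Suc n"] continuous_on_subset[OF c]
    by (metis compact_Icc of_nat_0_less_iff subset_UNIV zero_less_Suc zero_less_divide_1_iff)
  then obtain F where F: "\<And>n. real_polynomial_function (F n)"
      "\<And>n x. x \<in> {-R..R} \<Longrightarrow> \<bar>f x - F n x\<bar> < 1 / Suc n" by metis
  have Fb: "bounded_borel_on R (F n) \<and> P (F n)" for n
  proof -
    obtain a m where "F n = (\<lambda>x. \<Sum>i\<le>m. a i * x ^ i)"
      using F(1)[of n] unfolding real_polynomial_function_iff_sum by blast
    moreover have "bounded_borel_on R (\<lambda>x. x ^ i)" for i by (intro bounded_borel_on_continuous continuous_intros)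
    ultimately show ?thesis using sum[of "{..m}" "\<lambda>i x. x ^ i" a] power by simp
  qed
  obtain c where c': "\<And>x. x \<in> {-R..R} \<Longrightarrow> \<bar>f x\<bar> \<le> c" using bounded_borel_on_continuous[OF c, of R] unfolding bounded_borel_on_def by blast
  show ?thesis
  proof (rule lim[where F = F and c = "c + 1"])
    fix x assume x: "x \<in> {-R..R}"
    show "\<bar>F n x\<bar> \<le> c + 1" for n
    proof -
      have "1 / real (Suc n) \<le> 1" by simp
      then show ?thesis using F(2)[OF x, of n] c'[OF x] by linarith
    qed
    have "(\<lambda>n. f x - F n x) \<longlonglongrightarrow> 0"
      by (rule Lim_null_comparison[where g="\<lambda>n. 1 / real (Suc n)"])
        (use F(2)[OF x] LIMSEQ_inverse_real_of_nat in
          \<open>auto intro!: always_eventually less_imp_le simp: inverse_eq_divide\<close>)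
    then show "(\<lambda>n. F n x) \<longlonglongrightarrow> f x" using tendsto_diff[OF tendsto_const[of "f x"], of "\<lambda>n. f x - F n x" 0] by auto
  qed (use Fb bounded_borel_on_continuous[OF c] in auto)
qed

lemma indicator:
  assumes "A \<in> sets borel"
  shows "P (indicat_real A)"
proof -
  have bi: "bounded_borel_on R (indicat_real A)" if "A \<in> sets borel" for A
    by (rule bounded_borel_onI[where c = 1]) (use that in \<open>auto simp: indicator_def\<close>)
  have A: "A \<in> sigma_sets UNIV (range (\<lambda>a. {..a::real}))"
    using assms by (simp add: borel_eq_atMost)
  have S: "B \<in> sets borel" if "B \<in> sigma_sets UNIV (range (\<lambda>a. {..a::real}))" for B
    using that by (simp add: borel_eq_atMost)
  have ist: "Int_stable (range (\<lambda>a. {..a::real}))" by (auto simp: Int_stable_def)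
  have sub: "range (\<lambda>a. {..a::real}) \<subseteq> Pow UNIV" by simp
  show ?thesis
    using ist sub A
  proof (induction rule: sigma_sets_induct_disjoint)
    case (basic A)
    then obtain a where a: "A = {..a}" by auto
    \<comment> \<open>Continuous ramps: equal to 1 up to \<open>a\<close>, then falling with slope
      -n to the value 0. They decrease to the indicator of the closed half-line.\<close>
    let ?F = "\<lambda>n x. max 0 (min 1 (1 - real n * (x - a)))"
    show ?case
    proof (rule lim[where F = ?F and c = 1])
      fix x
      show "(\<lambda>n. ?F n x) \<longlonglongrightarrow> indicat_real A x"
      proof (cases "x \<le> a")
        case True
        then have "?F n x = 1" for n by (auto simp: max_def min_def mult_nonneg_nonpos)
        then show ?thesis using True a by simp
      next
        case False
        then obtain N where N: "1 < real N * (x - a)" using reals_Archimedean3[of "x - a"] by auto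
        have "eventually (\<lambda>n. ?F n x = 0) sequentially"
          using eventually_ge_at_top[of N]
        proof eventually_elim
          case (elim n)
          then have "real N * (x - a) \<le> real n * (x - a)" using False by (intro mult_right_mono) auto
          then show ?case using N by (auto simp: max_def min_def)
        qed
        then show ?thesis using False a by (simp add: tendsto_eventually)
      qed
    qed (use basic in \<open>auto intro!: continuous bounded_borel_on_continuous continuous_intros bi\<close>)
  next
    case empty
    then show ?case using zero by (simp add: indicator_def)
  next
    case (compl A)
    have "P (\<lambda>x. 1 * x ^ 0 + (-1) * indicat_real A x)"
      by (rule lin) (use compl bi[OF S] power[of 0] bounded_borel_on_continuous[of "\<lambda>x. x ^ 0"] in auto)
    moreover have "(\<lambda>x. 1 * x ^ 0 + (-1) * indicat_real A x) = indicat_real (UNIV - A)"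
      by (auto simp: indicator_def)
    ultimately show ?case by simp
  next
    case (union A)
    have b: "bounded_borel_on R (indicat_real (A i))" for i using union(2) bi S by blast
    let ?F = "\<lambda>n x. \<Sum>i<n. 1 * indicat_real (A i) x"
    have F: "bounded_borel_on R (?F n) \<and> P (?F n)" for n
      by (rule sum[of "{..<n}" "\<lambda>i. indicat_real (A i)" "\<lambda>_. 1"]) (use b union(3) in auto)
    have eq: "?F n x = indicat_real (\<Union>i<n. A i) x" for n x
    proof -
      have "disjoint_family_on A {..<n}" using union(1) by (simp add: disjoint_family_on_def)
      then show ?thesis
        by (simp add: indicator_UN_disjoint)
    qed
    have UN: "(\<Union>i. A i) \<in> sets borel" using union(2) S by blast
    show ?case
    proof (rule lim[where F = ?F and c = 1])
      fix x show "(\<lambda>n. ?F n x) \<longlonglongrightarrow> indicat_real (\<Union>i. A i) x"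
        unfolding eq by (rule LIMSEQ_indicator_UN)
    next
      fix n x show "\<bar>?F n x\<bar> \<le> 1" unfolding eq by simp
    qed (use F bi[OF UN] in blast)+
  qed
qed

lemma bounded_borel:
  assumes f: "bounded_borel_on R f"
  shows "P f"
proof -
  obtain c where c: "\<And>x. x \<in> {-R..R} \<Longrightarrow> \<bar>f x\<bar> \<le> c" using f unfolding bounded_borel_on_def by blast
  have fm: "f \<in> borel_measurable borel" using f by (simp add: bounded_borel_on_def)
  \<comment> \<open>The base point 0 in the metric approximation gives |F i x| \<le> 2 |f x|, hence
    a common bound on [-R, R].\<close>
  obtain F where F: "\<And>i. simple_function borel (F i)"
     "\<And>x. (\<lambda>i. F i x) \<longlonglongrightarrow> f x" "\<And>i x. dist (F i x) 0 \<le> 2 * dist (f x) 0"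
    using borel_measurable_implies_sequence_metric[OF fm, of 0] by auto
  have Fb: "bounded_borel_on R (F n) \<and> P (F n)" for n
  proof -
    have fin: "finite (range (F n))" using F(1)[of n] by (simp add: simple_function_def)
    have b: "F n -` {y} \<in> sets borel" for y using F(1)[of n]
      by (metis borel_measurable_simple_function measurable_sets_borel borel_singleton sets.empty_sets)
    have "bounded_borel_on R (\<lambda>x. \<Sum>y\<in>range (F n). y * indicat_real (F n -` {y}) x) \<and>
       P (\<lambda>x. \<Sum>y\<in>range (F n). y * indicat_real (F n -` {y}) x)"
      by (intro sum fin indicator b bounded_borel_onI[where c=1] borel_measurable_indicator) (auto simp: indicator_def)
    moreover have "F n = (\<lambda>x. \<Sum>y\<in>range (F n). y * indicat_real (F n -` {y}) x)"
    proof
      fix x show "F n x = (\<Sum>y\<in>range (F n). y * indicat_real (F n -` {y}) x)"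
        by (subst simple_function_indicator_representation_banach[OF F(1)[of n]]) (auto intro!: sum.cong)
    qed
    ultimately show ?thesis by metis
  qed
  show ?thesis
  proof (rule lim[where F = F and c = "2 * c"])
    fix n x assume "x \<in> {-R..R}"
    then show "\<bar>F n x\<bar> \<le> 2 * c" using F(3)[of n x] c[of x] by (simp add: dist_real_def)
  qed (use F(2) Fb f in auto)
qed

end

lemma bounded_borel_on_integrable:
  assumes "finite_measure \<mu>" "sets \<mu> = sets borel" "AE l in \<mu>. l \<in> {-R..R}" "bounded_borel_on R f"
  shows "integrable \<mu> f"
proof -
  interpret finite_measure \<mu> by fact
  obtain c where c: "\<forall>x\<in>{-R..R}. \<bar>f x\<bar> \<le> c" and f: "f \<in> borel_measurable borel"
    using assms(4) unfolding bounded_borel_on_def by blast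
  have "AE x in \<mu>. norm (f x) \<le> c" using assms(3) by eventually_elim (use c in auto)
  moreover have "f \<in> borel_measurable \<mu>"
    using f measurable_cong_sets[OF assms(2) refl] by blast
  ultimately show ?thesis by (rule integrable_const_bound)
qed

subsection \<open>Square integrable functions\<close>

lemma sqint_measurable: "sqint u \<Longrightarrow> u \<in> borel_measurable borel"
  by (simp add: sqint_def)

lemma sqint_integrable_mult:
  assumes u: "sqint u" and v: "sqint v"
  shows "integrable lborel (\<lambda>x. u x * v x)"
proof (rule Bochner_Integration.integrable_bound)
  show "integrable lborel (\<lambda>x. (u x)\<^sup>2 + (v x)\<^sup>2)" using u v by (simp add: sqint_def)
  show "(\<lambda>x. u x * v x) \<in> borel_measurable lborel" using u v by (auto simp: sqint_def)
  have "\<bar>a * b\<bar> \<le> a\<^sup>2 + b\<^sup>2" for a b :: real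
  proof -
    have "2 * (\<bar>a\<bar> * \<bar>b\<bar>) \<le> \<bar>a\<bar>\<^sup>2 + \<bar>b\<bar>\<^sup>2"
      using sum_squares_bound[of "\<bar>a\<bar>" "\<bar>b\<bar>"] by (simp add: mult.assoc)
    moreover have "0 \<le> \<bar>a\<bar> * \<bar>b\<bar>" by simp
    ultimately show ?thesis unfolding abs_mult power2_abs by linarith
  qed
  then show "AE x in lborel. norm (u x * v x) \<le> norm ((u x)\<^sup>2 + (v x)\<^sup>2)" by simp
qed

lemma sqint_lin:
  assumes u: "sqint u" and v: "sqint v"
  shows "sqint (\<lambda>x. a * u x + b * v x)"
proof -
  have "(\<lambda>x. (a * u x + b * v x)\<^sup>2) = (\<lambda>x. a\<^sup>2 * (u x)\<^sup>2 + 2 * a * b * (u x * v x) + b\<^sup>2 * (v x)\<^sup>2)"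
    by (auto simp: power2_eq_square algebra_simps)
  moreover have "integrable lborel (\<lambda>x. a\<^sup>2 * (u x)\<^sup>2 + 2 * a * b * (u x * v x) + b\<^sup>2 * (v x)\<^sup>2)"
    using sqint_integrable_mult[OF u v] u v unfolding sqint_def
    by (intro Bochner_Integration.integrable_add integrable_mult_right) auto
  ultimately show ?thesis using u v by (auto simp: sqint_def)
qed

lemma l2inner_commute: "l2inner u v = l2inner v u"
  by (simp add: l2inner_def mult.commute)

lemma l2inner_nonneg: "0 \<le> l2inner u u"
  unfolding l2inner_def by (rule integral_nonneg_AE) auto

lemma l2inner_lin:
  assumes "sqint u" "sqint v" "sqint w"
  shows "l2inner (\<lambda>x. a * u x + b * v x) w = a * l2inner u w + b * l2inner v w"
proof -
  have "l2inner (\<lambda>x. a * u x + b * v x) w = (\<integral>x. a * (u x * w x) + b * (v x * w x) \<partial>lborel)"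
    by (simp add: l2inner_def algebra_simps)
  also have "\<dots> = a * l2inner u w + b * l2inner v w"
    using assms by (subst Bochner_Integration.integral_add) (auto simp: l2inner_def intro!: sqint_integrable_mult)
  finally show ?thesis .
qed

lemma l2inner_lin2:
  assumes "sqint u" "sqint v" "sqint w"
  shows "l2inner w (\<lambda>x. a * u x + b * v x) = a * l2inner w u + b * l2inner w v"
  using l2inner_lin[OF assms] by (simp add: l2inner_commute)

lemma l2inner_quadratic:
  assumes "sqint u" "sqint v"
  shows "l2inner (\<lambda>x. a * u x + b * v x) (\<lambda>x. a * u x + b * v x)
    = a\<^sup>2 * l2inner u u + 2 * a * b * l2inner u v + b\<^sup>2 * l2inner v v"
  using assms l2inner_commute[of u v]
  by (simp add: l2inner_lin l2inner_lin2 sqint_lin power2_eq_square algebra_simps)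

subsection \<open>Symmetric operators\<close>

text \<open>Linearity is an equality at every point, not merely almost everywhere, so that iterates
  can be rewritten as functions. \<open>hop h\<close> will satisfy it because each of its values is
  an inner product with a square integrable section.\<close>

locale l2_sym =
  fixes A :: "(real \<Rightarrow> real) \<Rightarrow> real \<Rightarrow> real"
  assumes sq: "\<And>u. sqint u \<Longrightarrow> sqint (A u)"
    and lin: "\<And>u v a b. sqint u \<Longrightarrow> sqint v \<Longrightarrow> A (\<lambda>x. a * u x + b * v x) = (\<lambda>x. a * A u x + b * A v x)"
    and sym: "\<And>u v. sqint u \<Longrightarrow> sqint v \<Longrightarrow> l2inner (A u) v = l2inner u (A v)"
begin

lemma pow_sq: "sqint u \<Longrightarrow> sqint ((A ^^ k) u)"
  by (induction k) (auto intro: sq)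

lemma pow_lin: "sqint u \<Longrightarrow> sqint v \<Longrightarrow>
    (A ^^ k) (\<lambda>x. a * u x + b * v x) = (\<lambda>x. a * (A ^^ k) u x + b * (A ^^ k) v x)"
  by (induction k) (auto simp: lin pow_sq)

lemma pow_sym: "sqint u \<Longrightarrow> sqint v \<Longrightarrow> l2inner ((A ^^ k) u) v = l2inner u ((A ^^ k) v)"
proof (induction k arbitrary: v)
  case (Suc k)
  then have "l2inner ((A ^^ Suc k) u) v = l2inner ((A ^^ k) u) (A v)" by (simp add: sym pow_sq)
  also have "\<dots> = l2inner u ((A ^^ Suc k) v)" using Suc sq by (simp add: funpow_swap1)
  finally show ?case .
qed simp

lemma affine: "l2_sym (\<lambda>u x. c * A u x + d * u x)"
proof
  fix u v :: "real \<Rightarrow> real" and a b :: real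
  assume u: "sqint u"
  show "sqint (\<lambda>x. c * A u x + d * u x)" by (intro sqint_lin sq u)
  assume v: "sqint v"
  show "(\<lambda>x. c * A (\<lambda>x. a * u x + b * v x) x + d * (a * u x + b * v x)) =
       (\<lambda>x. a * (c * A u x + d * u x) + b * (c * A v x + d * v x))"
    by (simp add: lin u v algebra_simps)
  show "l2inner (\<lambda>x. c * A u x + d * u x) v = l2inner u (\<lambda>x. c * A v x + d * v x)"
    using u v by (simp add: l2inner_lin l2inner_lin2 sq sym)
qed

end

text \<open>\<open>B\<close> and \<open>D\<close> play the parts of t and 1 - t. The numbers
  \<open>l2inner ((B ^^ a) ((D ^^ b) u)) u\<close> are then the double sequence to which the
  Hausdorff moment theorem applies.\<close>

locale commuting_pair = B: l2_sym B + D: l2_sym D for B D +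
  assumes comm: "\<And>u. sqint u \<Longrightarrow> B (D u) = D (B u)"
    and partition: "\<And>u. sqint u \<Longrightarrow> (\<lambda>x. B u x + D u x) = u"
    and B_nonneg: "\<And>u. sqint u \<Longrightarrow> 0 \<le> l2inner (B u) u"
    and D_nonneg: "\<And>u. sqint u \<Longrightarrow> 0 \<le> l2inner (D u) u"
begin

lemma comm1: "sqint u \<Longrightarrow> (D ^^ b) (B u) = B ((D ^^ b) u)"
  by (induction b) (simp_all add: comm D.pow_sq)

lemma comm2: "sqint u \<Longrightarrow> (B ^^ a) (D u) = D ((B ^^ a) u)"
  by (induction a) (simp_all add: comm B.pow_sq)

text \<open>Pairs of equal factors are moved to the other side of the inner product; in the remaining case
  of the product \<open>BD\<close> one uses \<open>BD = B D (B + D) = B D B + D B D\<close>.\<close>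
lemma product_nonneg: "sqint u \<Longrightarrow> 0 \<le> l2inner ((B ^^ a) ((D ^^ b) u)) u"
proof (induction "a + b" arbitrary: a b u rule: less_induct)
  case less
  note u = \<open>sqint u\<close>
  consider a' where "a = Suc (Suc a')" | b' where "b = Suc (Suc b')"
    | "a = 0" "b = 0" | "a = 1" "b = 0" | "a = 0" "b = 1" | "a = 1" "b = 1"
    by (cases a; cases "a - 1"; cases b; cases "b - 1") auto
  then show ?case
  proof cases
    case 1
    have "(B ^^ a) ((D ^^ b) u) = B ((B ^^ a') ((D ^^ b) (B u)))"
      using u by (simp add: 1 comm1 funpow_swap1)
    then have "l2inner ((B ^^ a) ((D ^^ b) u)) u = l2inner ((B ^^ a') ((D ^^ b) (B u))) (B u)"
      using u by (simp add: B.sym B.sq B.pow_sq D.pow_sq)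
    then show ?thesis using less(1)[of a' b "B u"] 1 u B.sq by simp
  next
    case 2
    have "(D ^^ b) u = D ((D ^^ b') (D u))" by (simp add: 2 funpow_swap1)
    then have "(B ^^ a) ((D ^^ b) u) = D ((B ^^ a) ((D ^^ b') (D u)))"
      using u by (simp add: comm2 D.sq D.pow_sq)
    then have "l2inner ((B ^^ a) ((D ^^ b) u)) u = l2inner ((B ^^ a) ((D ^^ b') (D u))) (D u)"
      using u by (simp add: D.sym D.sq B.pow_sq D.pow_sq)
    then show ?thesis using less(1)[of a b' "D u"] 2 u D.sq by simp
  next
    case 3
    then show ?thesis by (simp add: l2inner_nonneg)
  next
    case 4
    then show ?thesis using B_nonneg[OF u] by simp
  next
    case 5
    then show ?thesis using D_nonneg[OF u] by simp
  next
    case 6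
    have "l2inner (B (D u)) u = l2inner (B (D u)) (\<lambda>x. 1 * B u x + 1 * D u x)"
      using partition[OF u] by simp
    also have "\<dots> = l2inner (D (B u)) (B u) + l2inner (B (D u)) (D u)"
      using u by (subst l2inner_lin2) (auto simp: B.sq D.sq comm)
    also have "\<dots> \<ge> 0" using B_nonneg[of "D u"] D_nonneg[of "B u"] u B.sq D.sq by simp
    finally show ?thesis using 6 by simp
  qed
qed

lemma product_rec:
  assumes u: "sqint u"
  shows "l2inner ((B ^^ a) ((D ^^ b) u)) u =
    l2inner ((B ^^ Suc a) ((D ^^ b) u)) u + l2inner ((B ^^ a) ((D ^^ Suc b) u)) u"
proof -
  let ?w = "(D ^^ b) u"
  have w: "sqint ?w" using u by (rule D.pow_sq)
  have "?w = (\<lambda>x. 1 * B ?w x + 1 * D ?w x)" using partition[OF w] by simp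
  then have "(B ^^ a) ?w = (B ^^ a) (\<lambda>x. 1 * B ?w x + 1 * D ?w x)" by metis
  also have "\<dots> = (\<lambda>x. 1 * (B ^^ a) (B ?w) x + 1 * (B ^^ a) (D ?w) x)"
    by (rule B.pow_lin) (auto intro: B.sq D.sq w)
  finally have "l2inner ((B ^^ a) ?w) u = l2inner (\<lambda>x. 1 * (B ^^ a) (B ?w) x + 1 * (B ^^ a) (D ?w) x) u"
    by metis
  also have "\<dots> = l2inner ((B ^^ a) (B ?w)) u + l2inner ((B ^^ a) (D ?w)) u"
    using u w by (subst l2inner_lin) (auto intro: B.sq D.sq B.pow_sq)
  finally show ?thesis by (simp add: funpow_swap1)
qed

end

subsection \<open>Spectral measures\<close>

text \<open>The notion \<open>is_spec_meas\<close> for an arbitrary operator. Nothing in it confines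
  the support; that has to be recovered from the growth of the moments.\<close>

definition op_spec :: "((real \<Rightarrow> real) \<Rightarrow> real \<Rightarrow> real) \<Rightarrow> (real \<Rightarrow> real) \<Rightarrow> real measure \<Rightarrow> bool" where
  "op_spec A u \<mu> \<longleftrightarrow> finite_measure \<mu> \<and> sets \<mu> = sets borel \<and>
     (\<forall>k::nat. integrable \<mu> (\<lambda>l. l ^ k) \<and> (\<integral>l. l ^ k \<partial>\<mu>) = l2inner ((A ^^ k) u) u)"

text \<open>With L = hi - lo, the operators (A - lo) / L and (hi - A) / L form a commuting pair. The
  measure obtained on [0, 1] for the first one is pushed forward by t \<mapsto> lo + L t.
  Independent lower and upper bounds are kept so that a positive operator receives a measure on the
  positive half-line.\<close>

lemma (in l2_sym) op_spec_exists:
  assumes lohi: "lo < hi" and u: "sqint u"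
    and lo: "\<And>u. sqint u \<Longrightarrow> lo * l2inner u u \<le> l2inner (A u) u"
    and hi: "\<And>u. sqint u \<Longrightarrow> l2inner (A u) u \<le> hi * l2inner u u"
  shows "\<exists>\<mu>. op_spec A u \<mu> \<and> (AE l in \<mu>. l \<in> {lo..hi})"
proof -
  define L where "L = hi - lo"
  have L: "L > 0" using lohi by (simp add: L_def)
  define B where "B = (\<lambda>v x. (1 / L) * A v x + (- lo / L) * v x)"
  define D where "D = (\<lambda>v x. (- 1 / L) * A v x + (hi / L) * v x)"
  interpret B: l2_sym B unfolding B_def by (rule affine)
  interpret D: l2_sym D unfolding D_def by (rule affine)
  have AB: "A v = (\<lambda>x. lo * v x + L * B v x)" for v
    using L by (auto simp: B_def field_simps)
  interpret commuting_pair B D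
  proof
    fix v assume v: "sqint v"
    show "B (D v) = D (B v)"
    proof -
      have AD: "A (D v) = (\<lambda>x. (- 1 / L) * A (A v) x + (hi / L) * A v x)"
        unfolding D_def by (rule lin[OF sq[OF v] v])
      have AB': "A (B v) = (\<lambda>x. (1 / L) * A (A v) x + (- lo / L) * A v x)"
        unfolding B_def by (rule lin[OF sq[OF v] v])
      have "B (D v) = (\<lambda>x. (1 / L) * A (D v) x + (- lo / L) * ((- 1 / L) * A v x + (hi / L) * v x))"
        unfolding B_def D_def ..
      moreover have "D (B v) = (\<lambda>x. (- 1 / L) * A (B v) x + (hi / L) * ((1 / L) * A v x + (- lo / L) * v x))"
        unfolding B_def D_def ..
      ultimately show ?thesis unfolding AD AB' by (simp add: algebra_simps)
    qed
    show "(\<lambda>x. B v x + D v x) = v"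
    proof
      fix x
      have "B v x + D v x = (hi - lo) / L * v x"
        unfolding B_def D_def by (simp add: algebra_simps add_divide_distrib diff_divide_distrib)
      then show "B v x + D v x = v x" using L by (simp add: L_def)
    qed
    show "0 \<le> l2inner (B v) v"
      using lo[OF v] L v unfolding B_def by (subst l2inner_lin) (auto simp: sq field_simps)
    show "0 \<le> l2inner (D v) v"
      using hi[OF v] L v unfolding D_def by (subst l2inner_lin) (auto simp: sq field_simps)
  qed
  obtain M where M: "finite_measure M" "sets M = sets borel" "AE t in M. t \<in> {0..1}"
    "\<And>k. (\<integral>t. t ^ k \<partial>M) = l2inner ((B ^^ k) u) u"
    using hausdorff_moment[of "\<lambda>a b. l2inner ((B ^^ a) ((D ^^ b) u)) u", OF product_nonneg[OF u] product_rec[OF u]]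
    by auto
  interpret M: finite_measure M by fact
  have AE1: "AE t in M. t \<in> {-1..1}" using M(3) by eventually_elim auto
  have int: "integrable M f" if "continuous_on UNIV f" for f :: "real \<Rightarrow> real"
    using bounded_borel_on_integrable[OF M(1,2) AE1 bounded_borel_on_continuous[OF that]] .
  \<comment> \<open>The extra factor t^a makes the induction close: splitting one factor lo + L t
    raises the power of t, just as A = lo + L B raises the power of \<open>B\<close>.\<close>
  have mom: "(\<integral>t. (lo + L * t) ^ k * t ^ a \<partial>M) = l2inner ((A ^^ k) ((B ^^ a) u)) u" for k a
  proof (induction k arbitrary: a)
    case 0
    then show ?case by (simp add: M(4))
  next
    case (Suc k)
    have i: "integrable M (\<lambda>t. (lo + L * t) ^ k * t ^ b)" for b
      by (intro int continuous_intros)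
    have "(\<integral>t. (lo + L * t) ^ Suc k * t ^ a \<partial>M) =
       (\<integral>t. lo * ((lo + L * t) ^ k * t ^ a) + L * ((lo + L * t) ^ k * t ^ Suc a) \<partial>M)"
      by (simp add: algebra_simps)
    also have "\<dots> = lo * (\<integral>t. (lo + L * t) ^ k * t ^ a \<partial>M) + L * (\<integral>t. (lo + L * t) ^ k * t ^ Suc a \<partial>M)"
      using i by (subst Bochner_Integration.integral_add) (auto simp del: power_Suc)
    also have "\<dots> = lo * l2inner ((A ^^ k) ((B ^^ a) u)) u + L * l2inner ((A ^^ k) (B ((B ^^ a) u))) u"
      by (simp only: Suc funpow.simps o_apply)
    also have "\<dots> = l2inner ((A ^^ k) (\<lambda>x. lo * (B ^^ a) u x + L * B ((B ^^ a) u) x)) u"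
      using u by (simp add: pow_lin B.pow_sq B.sq l2inner_lin pow_sq)
    also have "\<dots> = l2inner ((A ^^ Suc k) ((B ^^ a) u)) u"
      unfolding AB[symmetric] by (simp add: funpow_swap1)
    finally show ?case .
  qed
  define \<mu> where "\<mu> = distr M borel (\<lambda>t. lo + L * t)"
  have m: "(\<lambda>t. lo + L * t) \<in> measurable M borel"
    using M(2) by (simp add: measurable_cong_sets[OF M(2) refl])
  have "finite_measure \<mu>" unfolding \<mu>_def by (rule M.finite_measure_distr[OF m])
  moreover have "integrable \<mu> (\<lambda>l. l ^ k) \<and> (\<integral>l. l ^ k \<partial>\<mu>) = l2inner ((A ^^ k) u) u" for k
    using mom[of k 0] unfolding \<mu>_def
    by (subst integrable_distr_eq[OF m], simp, subst integral_distr[OF m], simp)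
      (auto intro!: int continuous_intros)
  moreover have "AE l in \<mu>. l \<in> {lo..hi}"
    unfolding \<mu>_def
  proof (subst AE_distr_iff[OF m])
    show "AE t in M. lo + L * t \<in> {lo..hi}"
      using M(3)
    proof eventually_elim
      case (elim t)
      then have "0 \<le> L * t" "L * t \<le> L * 1" using L by (auto intro: mult_left_mono simp del: mult_1_right)
      then show ?case by (simp add: L_def)
    qed
  qed simp
  ultimately show ?thesis by (intro exI[of _ \<mu>]) (simp add: op_spec_def \<mu>_def)
qed

subsection \<open>Bounded symmetric operators and their quadratic functional calculus\<close>

locale l2_bounded = l2_sym +
  fixes R :: real
  assumes R_pos: "0 < R"
    and bound: "\<And>u. sqint u \<Longrightarrow> \<bar>l2inner (A u) u\<bar> \<le> R * l2inner u u"
begin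

lemma op_spec_exists': "sqint u \<Longrightarrow> \<exists>\<mu>. op_spec A u \<mu> \<and> (AE l in \<mu>. l \<in> {-R..R})"
proof (rule op_spec_exists)
  fix v assume "sqint v"
  from bound[OF this] show "- R * l2inner v v \<le> l2inner (A v) v" "l2inner (A v) v \<le> R * l2inner v v"
    by (auto simp: abs_le_iff)
qed (use R_pos in auto)

text \<open>All spectral measures of \<open>u\<close> have the same moments, so the bound may be
  read off from one that is known to live on [-R, R].\<close>

lemma even_moment_le:
  assumes u: "sqint u"
  shows "l2inner ((A ^^ (2 * k)) u) u \<le> R ^ (2 * k) * l2inner u u"
proof -
  obtain \<mu> where \<mu>: "op_spec A u \<mu>" "AE l in \<mu>. l \<in> {-R..R}" using op_spec_exists'[OF u] by blast
  have "l2inner ((A ^^ (2 * k)) u) u = (\<integral>l. l ^ (2 * k) \<partial>\<mu>)" using \<mu>(1) by (simp add: op_spec_def)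
  also have "\<dots> \<le> (\<integral>l. R ^ (2 * k) * l ^ 0 \<partial>\<mu>)"
  proof (rule integral_mono_AE)
    show "AE l in \<mu>. l ^ (2 * k) \<le> R ^ (2 * k) * l ^ 0"
      using \<mu>(2)
    proof eventually_elim
      case (elim l)
      then have "\<bar>l\<bar> ^ (2 * k) \<le> R ^ (2 * k)" by (intro power_mono) auto
      then show ?case by (simp add: power_even_abs)
    qed
  qed (use \<mu>(1) in \<open>auto simp only: op_spec_def intro!: integrable_mult_right\<close>)
  also have "\<dots> = R ^ (2 * k) * (\<integral>l. l ^ 0 \<partial>\<mu>)" by simp
  also have "\<dots> = R ^ (2 * k) * l2inner u u" using \<mu>(1) unfolding op_spec_def by (metis funpow_0)
  finally show ?thesis .
qed

text \<open>Chebyshev's inequality with the powers l^(2k): mass m outside a radius r > R gives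
  r^(2k) m \<le> R^(2k) <u, u> for every k, which forces m = 0.\<close>

lemma op_spec_support:
  assumes u: "sqint u" and \<mu>: "op_spec A u \<mu>"
  shows "AE l in \<mu>. l \<in> {-R..R}"
proof -
  interpret finite_measure \<mu> using \<mu> by (simp add: op_spec_def)
  have sets: "sets \<mu> = sets borel" using \<mu> by (simp add: op_spec_def)
  have "AE l in \<mu>. \<bar>l\<bar> < R + 1 / Suc n" for n
  proof -
    define S where "S = {l::real. R + 1 / Suc n \<le> \<bar>l\<bar>}"
    have S: "S \<in> sets \<mu>" unfolding sets S_def by measurable
    define c where "c = (R + 1 / Suc n) / R"
    have c: "c > 1" using R_pos by (simp add: c_def add_divide_distrib)
    have iS: "integrable \<mu> (indicat_real S)"
      using S by (intro integrable_real_indicator) (auto simp: less_top[symmetric])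
    have le: "c ^ (2 * k) * measure \<mu> S \<le> l2inner u u" for k
    proof -
      have "(R + 1 / Suc n) ^ (2 * k) * measure \<mu> S = (\<integral>l. (R + 1 / Suc n) ^ (2 * k) * indicat_real S l \<partial>\<mu>)"
        using S by simp
      also have "\<dots> \<le> (\<integral>l. l ^ (2 * k) \<partial>\<mu>)"
      proof (rule integral_mono)
        fix l
        show "(R + 1 / Suc n) ^ (2 * k) * indicat_real S l \<le> l ^ (2 * k)"
        proof (cases "l \<in> S")
          case True
          then have "(R + 1 / Suc n) ^ (2 * k) \<le> \<bar>l\<bar> ^ (2 * k)" using R_pos by (intro power_mono) (auto simp: S_def)
          then show ?thesis using True by (simp add: power_even_abs)
        qed simp
      qed (use \<mu> iS in \<open>auto simp: op_spec_def\<close>)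
      also have "\<dots> \<le> R ^ (2 * k) * l2inner u u"
        using \<mu> even_moment_le[OF u] by (simp add: op_spec_def)
      finally show ?thesis
        unfolding c_def power_divide times_divide_eq_left using R_pos by (subst pos_divide_le_eq) (simp_all add: mult.commute)
    qed
    have "measure \<mu> S = 0"
    proof (rule ccontr)
      assume "measure \<mu> S \<noteq> 0"
      then have pos: "measure \<mu> S > 0" using measure_nonneg[of \<mu> S] by linarith
      have "1 < c\<^sup>2" using c by (simp add: one_less_power)
      then obtain k where "l2inner u u / measure \<mu> S < (c\<^sup>2) ^ k" using real_arch_pow by blast
      then show False using le[of k] pos by (simp add: power_mult pos_divide_less_eq)
    qed
    then have "S \<in> null_sets \<mu>" using S by (simp add: emeasure_eq_measure null_sets_def)
    then have "AE l in \<mu>. l \<notin> S" by (rule AE_not_in)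
    then show ?thesis by eventually_elim (auto simp: S_def)
  qed
  then have "AE l in \<mu>. \<forall>n. \<bar>l\<bar> < R + 1 / real (Suc n)" by (simp add: AE_all_countable)
  then show ?thesis
  proof eventually_elim
    case (elim l)
    have "(\<lambda>n. R + 1 / real (Suc n)) \<longlonglongrightarrow> R + 0"
      using LIMSEQ_inverse_real_of_nat by (intro tendsto_add) (simp_all add: inverse_eq_divide)
    then have "\<bar>l\<bar> \<le> R" using elim by (intro LIMSEQ_le_const[where X="\<lambda>n. R + 1 / real (Suc n)"]) (auto intro: less_imp_le)
    then show ?case by auto
  qed
qed

lemma integrable_spec: "sqint u \<Longrightarrow> op_spec A u \<mu> \<Longrightarrow> bounded_borel_on R g \<Longrightarrow> integrable \<mu> g"
  using bounded_borel_on_integrable[OF _ _ op_spec_support] by (auto simp: op_spec_def)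

lemma spec_tendsto:
  assumes u: "sqint u" and \<mu>: "op_spec A u \<mu>" and F: "\<And>n. bounded_borel_on R (F n)" and f: "bounded_borel_on R f"
    and c: "\<And>n x. x \<in> {-R..R} \<Longrightarrow> \<bar>F n x\<bar> \<le> c"
    and lim: "\<And>x. x \<in> {-R..R} \<Longrightarrow> (\<lambda>n. F n x) \<longlonglongrightarrow> f x"
  shows "(\<lambda>n. \<integral>l. F n l \<partial>\<mu>) \<longlonglongrightarrow> (\<integral>l. f l \<partial>\<mu>)"
proof (rule integral_dominated_convergence[where w = "\<lambda>_. c"])
  interpret finite_measure \<mu> using \<mu> by (simp add: op_spec_def)
  show "f \<in> borel_measurable \<mu>" "\<And>i. F i \<in> borel_measurable \<mu>"
    using integrable_spec[OF u \<mu>] F f by (auto intro: borel_measurable_integrable)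
  show "integrable \<mu> (\<lambda>_. c)" by simp
  note s = op_spec_support[OF u \<mu>]
  show "AE x in \<mu>. (\<lambda>n. F n x) \<longlonglongrightarrow> f x" using s by eventually_elim (rule lim)
  show "AE x in \<mu>. norm (F n x) \<le> c" for n using s by eventually_elim (use c in auto)
qed

text \<open>Makes every later quantity independent of the spectral measure chosen, and allows a
  measure with better support to be substituted when the operator is positive.\<close>

lemma spec_unique:
  assumes u: "sqint u" and \<mu>: "op_spec A u \<mu>" and \<mu>': "op_spec A u \<mu>'" and g: "bounded_borel_on R g"
  shows "(\<integral>l. g l \<partial>\<mu>) = (\<integral>l. g l \<partial>\<mu>')"
proof -
  interpret monotone_class_on R "\<lambda>g. (\<integral>l. g l \<partial>\<mu>) = (\<integral>l. g l \<partial>\<mu>')"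
  proof
    show "(\<integral>l. l ^ k \<partial>\<mu>) = (\<integral>l. l ^ k \<partial>\<mu>')" for k using \<mu> \<mu>' by (simp add: op_spec_def)
  next
    fix f g a b assume "bounded_borel_on R f" "bounded_borel_on R g" "(\<integral>l. f l \<partial>\<mu>) = (\<integral>l. f l \<partial>\<mu>')" "(\<integral>l. g l \<partial>\<mu>) = (\<integral>l. g l \<partial>\<mu>')"
    then show "(\<integral>l. a * f l + b * g l \<partial>\<mu>) = (\<integral>l. a * f l + b * g l \<partial>\<mu>')"
      using integrable_spec[OF u \<mu>] integrable_spec[OF u \<mu>'] by simp
  next
    fix F f c
    assume a: "\<And>n. bounded_borel_on R (F n)" "bounded_borel_on R f" "\<And>n x. x \<in> {- R..R} \<Longrightarrow> \<bar>F n x\<bar> \<le> c"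
      "\<And>x. x \<in> {- R..R} \<Longrightarrow> (\<lambda>n. F n x) \<longlonglongrightarrow> f x" "\<And>n. (\<integral>l. F n l \<partial>\<mu>) = (\<integral>l. F n l \<partial>\<mu>')"
    show "(\<integral>l. f l \<partial>\<mu>) = (\<integral>l. f l \<partial>\<mu>')"
      using spec_tendsto[OF u \<mu>, of F f c] spec_tendsto[OF u \<mu>', of F f c] a
      by (intro LIMSEQ_unique[where X = "\<lambda>n. \<integral>l. F n l \<partial>\<mu>"]) auto
  qed
  show ?thesis using g by (rule bounded_borel)
qed

section \<open>The functional calculus as a quadratic form\<close>

definition spm :: "(real \<Rightarrow> real) \<Rightarrow> real measure" where
  "spm u = (SOME \<mu>. op_spec A u \<mu>)"

text \<open>This is <g(A) u, u>; the operator g(A) itself is never constructed.\<close>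

definition Q :: "(real \<Rightarrow> real) \<Rightarrow> (real \<Rightarrow> real) \<Rightarrow> real" where
  "Q g u = (\<integral>l. g l \<partial>spm u)"

lemma spm: "sqint u \<Longrightarrow> op_spec A u (spm u)"
  unfolding spm_def using op_spec_exists' by (metis someI)

lemma Q_power: "sqint u \<Longrightarrow> Q (\<lambda>l. l ^ k) u = l2inner ((A ^^ k) u) u"
  using spm[of u] by (simp add: Q_def op_spec_def)

lemma Q_lin: "sqint u \<Longrightarrow> bounded_borel_on R f \<Longrightarrow> bounded_borel_on R g \<Longrightarrow> Q (\<lambda>l. a * f l + b * g l) u = a * Q f u + b * Q g u"
  unfolding Q_def using integrable_spec[OF _ spm] by simp

lemma Q_tendsto:
  assumes "sqint u" "\<And>n. bounded_borel_on R (F n)" "bounded_borel_on R f" "\<And>n x. x \<in> {-R..R} \<Longrightarrow> \<bar>F n x\<bar> \<le> c"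
    "\<And>x. x \<in> {-R..R} \<Longrightarrow> (\<lambda>n. F n x) \<longlonglongrightarrow> f x"
  shows "(\<lambda>n. Q (F n) u) \<longlonglongrightarrow> Q f u"
  unfolding Q_def by (rule spec_tendsto[OF assms(1) spm[OF assms(1)] assms(2-)])

lemma Q_bound:
  assumes u: "sqint u" and g: "bounded_borel_on R g" and G: "\<And>x. x \<in> {-R..R} \<Longrightarrow> \<bar>g x\<bar> \<le> G"
  shows "\<bar>Q g u\<bar> \<le> G * l2inner u u"
proof -
  note \<mu> = spm[OF u]
  interpret finite_measure "spm u" using \<mu> by (simp add: op_spec_def)
  have "\<bar>Q g u\<bar> \<le> (\<integral>l. \<bar>g l\<bar> \<partial>spm u)" unfolding Q_def by (rule integral_abs_bound)
  also have "\<dots> \<le> (\<integral>l. G * l ^ 0 \<partial>spm u)"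
  proof (rule integral_mono_AE)
    show "AE l in spm u. \<bar>g l\<bar> \<le> G * l ^ 0"
      using op_spec_support[OF u \<mu>] by eventually_elim (use G in auto)
  qed (use integrable_spec[OF u \<mu> g] in auto)
  also have "\<dots> = G * (\<integral>l. l ^ 0 \<partial>spm u)" by simp
  also have "\<dots> = G * l2inner u u" using \<mu> unfolding op_spec_def by (metis funpow_0)
  finally show ?thesis .
qed

text \<open>Each side depends linearly on g and respects bounded limits, so a relation valid for
  powers extends to all g. The shape with four vectors is the one that polarisation
  requires.\<close>

lemma Q_combination:
  assumes u: "sqint u1" "sqint u2" "sqint u3" "sqint u4" and g: "bounded_borel_on R g"
    and pow: "\<And>k. Q (\<lambda>l. l ^ k) u1 - Q (\<lambda>l. l ^ k) u2 = c * (Q (\<lambda>l. l ^ k) u3 - Q (\<lambda>l. l ^ k) u4)"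
  shows "Q g u1 - Q g u2 = c * (Q g u3 - Q g u4)"
proof -
  interpret monotone_class_on R "\<lambda>g. Q g u1 - Q g u2 = c * (Q g u3 - Q g u4)"
  proof
    fix f g a b assume fg: "bounded_borel_on R f" "bounded_borel_on R g"
      and f: "Q f u1 - Q f u2 = c * (Q f u3 - Q f u4)" and g: "Q g u1 - Q g u2 = c * (Q g u3 - Q g u4)"
    have "Q (\<lambda>x. a * f x + b * g x) u1 - Q (\<lambda>x. a * f x + b * g x) u2
       = a * (Q f u1 - Q f u2) + b * (Q g u1 - Q g u2)"
      using fg u by (simp add: Q_lin algebra_simps)
    also have "\<dots> = c * (Q (\<lambda>x. a * f x + b * g x) u3 - Q (\<lambda>x. a * f x + b * g x) u4)"
      unfolding f g using fg u by (simp add: Q_lin algebra_simps)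
    finally show "Q (\<lambda>x. a * f x + b * g x) u1 - Q (\<lambda>x. a * f x + b * g x) u2
      = c * (Q (\<lambda>x. a * f x + b * g x) u3 - Q (\<lambda>x. a * f x + b * g x) u4)" .
  next
    fix F f d
    assume a: "\<And>n. bounded_borel_on R (F n)" "bounded_borel_on R f" "\<And>n x. x \<in> {- R..R} \<Longrightarrow> \<bar>F n x\<bar> \<le> d"
      "\<And>x. x \<in> {- R..R} \<Longrightarrow> (\<lambda>n. F n x) \<longlonglongrightarrow> f x"
      and e: "\<And>n. Q (F n) u1 - Q (F n) u2 = c * (Q (F n) u3 - Q (F n) u4)"
    note t = Q_tendsto[OF _ a]
    have "(\<lambda>n. Q (F n) u1 - Q (F n) u2) \<longlonglongrightarrow> Q f u1 - Q f u2"
      by (intro tendsto_diff t u)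
    moreover have "(\<lambda>n. Q (F n) u1 - Q (F n) u2) \<longlonglongrightarrow> c * (Q f u3 - Q f u4)"
      unfolding e by (intro tendsto_mult_left tendsto_diff t u)
    ultimately show "Q f u1 - Q f u2 = c * (Q f u3 - Q f u4)" by (rule LIMSEQ_unique)
  qed (rule pow)
  show ?thesis using g by (rule bounded_borel)
qed

lemma Q_power_lin:
  assumes "sqint u" "sqint v"
  shows "Q (\<lambda>l. l ^ k) (\<lambda>x. a * u x + b * v x)
    = a\<^sup>2 * l2inner ((A ^^ k) u) u + 2 * a * b * l2inner ((A ^^ k) u) v + b\<^sup>2 * l2inner ((A ^^ k) v) v"
proof -
  have "l2inner ((A ^^ k) v) u = l2inner ((A ^^ k) u) v"
    using pow_sym[OF assms(2,1)] by (simp add: l2inner_commute)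
  then show ?thesis using assms
    by (simp add: Q_power sqint_lin pow_lin l2inner_lin l2inner_lin2 pow_sq power2_eq_square algebra_simps)
qed

text \<open>Polarisation; optimising over the scaling parameter \<open>s\<close> will give a bound of Cauchy--Schwarz type.\<close>
lemma Q_diff_scaled:
  assumes u: "sqint u" and v: "sqint v" and g: "bounded_borel_on R g" and s: "s > 0"
  shows "Q g u - Q g v = 1/4 * (Q g (\<lambda>x. s * (1 * u x + -1 * v x) + 1/s * (1 * u x + 1 * v x))
      - Q g (\<lambda>x. s * (1 * u x + -1 * v x) + (-1/s) * (1 * u x + 1 * v x)))"
proof (rule Q_combination[OF u v _ _ g])
  let ?d = "\<lambda>x. 1 * u x + -1 * v x" and ?e = "\<lambda>x. 1 * u x + 1 * v x"
  have d: "sqint ?d" and e: "sqint ?e" by (intro sqint_lin u v)+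
  show "sqint (\<lambda>x. s * ?d x + 1/s * ?e x)" "sqint (\<lambda>x. s * ?d x + (-1/s) * ?e x)"
    by (intro sqint_lin d e)+
  fix k
  \<comment> \<open>By symmetry the mixed terms cancel in <A^k (u - v), u + v>. Polarising this
    pairing at s (u - v) and (u + v) / s leaves its value unchanged, since the scale factors
    multiply to 1.\<close>
  have "l2inner ((A ^^ k) ?d) ?e = l2inner ((A ^^ k) u) u - l2inner ((A ^^ k) v) v"
  proof -
    have "l2inner ((A ^^ k) ?d) ?e = 1 * l2inner ((A ^^ k) u) ?e + -1 * l2inner ((A ^^ k) v) ?e"
      unfolding pow_lin[OF u v] by (rule l2inner_lin[OF pow_sq[OF u] pow_sq[OF v] e])
    moreover have "l2inner ((A ^^ k) u) ?e = 1 * l2inner ((A ^^ k) u) u + 1 * l2inner ((A ^^ k) u) v"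
      by (rule l2inner_lin2[OF u v pow_sq[OF u]])
    moreover have "l2inner ((A ^^ k) v) ?e = 1 * l2inner ((A ^^ k) v) u + 1 * l2inner ((A ^^ k) v) v"
      by (rule l2inner_lin2[OF u v pow_sq[OF v]])
    moreover have "l2inner ((A ^^ k) v) u = l2inner ((A ^^ k) u) v"
      using pow_sym[OF v u] by (simp add: l2inner_commute)
    ultimately show ?thesis by linarith
  qed
  then show "Q (\<lambda>l. l ^ k) u - Q (\<lambda>l. l ^ k) v = 1/4 * (Q (\<lambda>l. l ^ k) (\<lambda>x. s * ?d x + 1/s * ?e x)
      - Q (\<lambda>l. l ^ k) (\<lambda>x. s * ?d x + (-1/s) * ?e x))"
    unfolding Q_power_lin[OF d e] using s by (simp add: Q_power u v)
qed

end

text \<open>The minimum of t a + b / t is attained at t = sqrt (b / a). Adding \<epsilon> to both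
  coefficients keeps this t meaningful when one of them is 0.\<close>

lemma le_geometric_mean:
  fixes X a b :: real
  assumes a: "a \<ge> 0" and b: "b \<ge> 0" and le: "\<And>t. t > 0 \<Longrightarrow> X \<le> t * a + b / t"
  shows "X \<le> 2 * sqrt (a * b)"
proof -
  have e: "X \<le> 2 * sqrt ((a + \<epsilon>) * (b + \<epsilon>))" if \<epsilon>: "\<epsilon> > 0" for \<epsilon>
  proof -
    define p q where "p = sqrt (a + \<epsilon>)" and "q = sqrt (b + \<epsilon>)"
    have p: "p > 0" "p * p = a + \<epsilon>" and q: "q > 0" "q * q = b + \<epsilon>"
      using a b \<epsilon> by (auto simp: p_def q_def)
    have t: "q / p > 0" using p q by simp
    have "X \<le> q / p * a + b / (q / p)" by (rule le[OF t])
    also have "\<dots> \<le> q / p * (p * p) + (q * q) / (q / p)"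
      unfolding p q using t \<epsilon> by (intro add_mono mult_left_mono divide_right_mono) auto
    also have "\<dots> = 2 * (p * q)" using p(1) q(1) by simp
    finally show ?thesis by (simp add: p_def q_def real_sqrt_mult)
  qed
  have "((\<lambda>\<epsilon>. 2 * sqrt ((a + \<epsilon>) * (b + \<epsilon>))) \<longlongrightarrow> 2 * sqrt ((a + 0) * (b + 0))) (at_right 0)"
    by (intro tendsto_intros)
  then have "X \<le> 2 * sqrt ((a + 0) * (b + 0))"
    by (rule tendsto_lowerbound) (auto simp: eventually_at_filter e)
  then show ?thesis by simp
qed

context l2_bounded
begin

text \<open>This is |<g(A)(u - v), u + v>| \<le> G |u - v| |u + v|, obtained from bounds on the
  quadratic form alone.\<close>

lemma Q_diff_bound:
  assumes u: "sqint u" and v: "sqint v" and g: "bounded_borel_on R g" and G: "\<And>x. x \<in> {-R..R} \<Longrightarrow> \<bar>g x\<bar> \<le> G"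
  shows "\<bar>Q g u - Q g v\<bar> \<le> G * sqrt (l2inner (\<lambda>x. u x - v x) (\<lambda>x. u x - v x) * l2inner (\<lambda>x. u x + v x) (\<lambda>x. u x + v x))"
proof -
  let ?d = "\<lambda>x. 1 * u x + -1 * v x" and ?e = "\<lambda>x. 1 * u x + 1 * v x"
  let ?D = "l2inner ?d ?d" and ?E = "l2inner ?e ?e"
  have d: "sqint ?d" and e: "sqint ?e" by (intro sqint_lin u v)+
  have G0: "G \<ge> 0" using G[of 0] R_pos by auto
  have "\<bar>Q g u - Q g v\<bar> \<le> 2 * sqrt ((G / 2 * ?D) * (G / 2 * ?E))"
  proof (rule le_geometric_mean)
    fix t :: real assume t: "t > 0"
    define s where "s = sqrt t"
    have s: "s > 0" "s\<^sup>2 = t" using t by (auto simp: s_def)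
    let ?p = "\<lambda>x. s * ?d x + 1/s * ?e x" and ?m = "\<lambda>x. s * ?d x + (-1/s) * ?e x"
    have pm: "sqint ?p" "sqint ?m" by (intro sqint_lin d e)+
    have "\<bar>Q g u - Q g v\<bar> = 1/4 * \<bar>Q g ?p - Q g ?m\<bar>"
      unfolding Q_diff_scaled[OF u v g s(1)] by (simp add: abs_mult)
    also have "\<dots> \<le> 1/4 * (\<bar>Q g ?p\<bar> + \<bar>Q g ?m\<bar>)" by simp
    also have "\<dots> \<le> 1/4 * (G * l2inner ?p ?p + G * l2inner ?m ?m)"
      using Q_bound[OF pm(1) g G] Q_bound[OF pm(2) g G] by simp
    \<comment> \<open>Parallelogram law: the cross terms of the two squared norms have opposite
      signs and cancel.\<close>
    also have "\<dots> = G / 2 * (s\<^sup>2 * ?D + (1/s)\<^sup>2 * ?E)"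
      unfolding l2inner_quadratic[OF d e] by (simp add: algebra_simps)
    also have "\<dots> = t * (G / 2 * ?D) + G / 2 * ?E / t"
      by (simp add: s(2) power_divide algebra_simps)
    finally show "\<bar>Q g u - Q g v\<bar> \<le> t * (G / 2 * ?D) + G / 2 * ?E / t" .
  qed (use G0 l2inner_nonneg in auto)
  also have "\<dots> = 2 * sqrt ((G / 2)\<^sup>2 * (?D * ?E))" by (simp add: power2_eq_square algebra_simps)
  also have "\<dots> = G * sqrt (?D * ?E)" using G0 by (simp add: real_sqrt_mult)
  finally show ?thesis by simp
qed

lemma Q_continuous:
  assumes u: "sqint u" and v: "\<And>n. sqint (v n)" and g: "bounded_borel_on R g"
    and lim: "((\<lambda>n. l2inner (\<lambda>x. v n x - u x) (\<lambda>x. v n x - u x)) \<longlongrightarrow> 0) F"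
  shows "((\<lambda>n. Q g (v n)) \<longlongrightarrow> Q g u) F"
proof -
  obtain G where G: "\<And>x. x \<in> {-R..R} \<Longrightarrow> \<bar>g x\<bar> \<le> G" using g unfolding bounded_borel_on_def by blast
  have G0: "G \<ge> 0" using G[of 0] R_pos by auto
  let ?D = "\<lambda>n. l2inner (\<lambda>x. v n x - u x) (\<lambda>x. v n x - u x)"
  have b: "l2inner (\<lambda>x. v n x + u x) (\<lambda>x. v n x + u x) \<le> 2 * ?D n + 8 * l2inner u u" for n
  proof -
    let ?d = "\<lambda>x. 1 * v n x + -1 * u x"
    have d: "sqint ?d" by (intro sqint_lin u v)
    \<comment> \<open>Writing v + u as (v - u) + 2 u bounds this factor in terms of the distance and
      \<open>u\<close> only, so it stays bounded along the limit while the other factor tends to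
      0.\<close>
    have "l2inner (\<lambda>x. v n x + u x) (\<lambda>x. v n x + u x) = l2inner (\<lambda>x. 1 * ?d x + 2 * u x) (\<lambda>x. 1 * ?d x + 2 * u x)"
      by (simp add: add.commute)
    also have "\<dots> = l2inner ?d ?d + 4 * l2inner ?d u + 4 * l2inner u u"
      by (subst l2inner_quadratic[OF d u]) simp
    finally have 1: "l2inner (\<lambda>x. v n x + u x) (\<lambda>x. v n x + u x) = l2inner ?d ?d + 4 * l2inner ?d u + 4 * l2inner u u" .
    have "0 \<le> l2inner (\<lambda>x. 1 * ?d x + -2 * u x) (\<lambda>x. 1 * ?d x + -2 * u x)" by (rule l2inner_nonneg)
    then have "4 * l2inner ?d u \<le> l2inner ?d ?d + 4 * l2inner u u"
      by (subst (asm) l2inner_quadratic[OF d u]) simp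
    then show ?thesis using 1 by simp
  qed
  have "((\<lambda>n. Q g (v n) - Q g u) \<longlongrightarrow> 0) F"
  proof (rule Lim_null_comparison)
    show "\<forall>\<^sub>F n in F. norm (Q g (v n) - Q g u) \<le> G * sqrt (?D n * (2 * ?D n + 8 * l2inner u u))"
    proof (rule always_eventually, rule allI)
      fix n
      have "\<bar>Q g (v n) - Q g u\<bar> \<le> G * sqrt (?D n * l2inner (\<lambda>x. v n x + u x) (\<lambda>x. v n x + u x))"
        by (rule Q_diff_bound[OF v u g G])
      also have "\<dots> \<le> G * sqrt (?D n * (2 * ?D n + 8 * l2inner u u))"
        by (intro mult_left_mono real_sqrt_le_mono b G0 l2inner_nonneg)
      finally show "norm (Q g (v n) - Q g u) \<le> G * sqrt (?D n * (2 * ?D n + 8 * l2inner u u))" by simp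
    qed
    have "((\<lambda>n. G * sqrt (?D n * (2 * ?D n + 8 * l2inner u u))) \<longlongrightarrow> G * sqrt (0 * (2 * 0 + 8 * l2inner u u))) F"
      by (intro tendsto_intros lim)
    then show "((\<lambda>n. G * sqrt (?D n * (2 * ?D n + 8 * l2inner u u))) \<longlongrightarrow> 0) F" by simp
  qed
  then show ?thesis by (simp add: LIM_zero_iff)
qed

end

subsection \<open>The exponential majorant and Schur's test\<close>

definition expw :: "real \<Rightarrow> real" where
  "expw s = exp (- \<bar>s\<bar> / 2)"

lemma expw_pos: "0 < expw s" and expw_le_1: "expw s \<le> 1"
  by (auto simp: expw_def)

lemma expw_commute: "expw (x - y) = expw (y - x)"
  by (simp add: expw_def abs_minus_commute)

lemma expw_measurable [measurable]: "expw \<in> borel_measurable borel"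
  unfolding expw_def by measurable

lemma has_bochner_integral_expw: "has_bochner_integral lborel expw 4"
proof -
  let ?e = "\<lambda>s::real. exp (- s / 2) * indicator {0..} s"
  have n: "(\<integral>\<^sup>+ s. ennreal (?e s) \<partial>lborel) = ennreal 2"
  proof -
    have "(\<integral>\<^sup>+ s. ennreal (exp (- s / 2)) * indicator {0..} s \<partial>lborel) = ennreal (0 - (- 2 * exp (- 0 / 2)))"
    proof (rule nn_integral_FTC_atLeast)
      show "((\<lambda>x::real. - 2 * exp (- x / 2)) \<longlongrightarrow> 0) at_top"
        by real_asymp
    qed (auto intro!: derivative_eq_intros)
    then show ?thesis by (simp add: ennreal_mult' ennreal_indicator)
  qed
  have h: "has_bochner_integral lborel ?e 2"
    by (rule has_bochner_integral_nn_integral) (use n in auto)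
  then have i: "integrable lborel ?e" "(\<integral>s. ?e s \<partial>lborel) = 2"
    by (auto simp: has_bochner_integral_iff)
  have h': "has_bochner_integral lborel (\<lambda>s. ?e (0 + (-1) * s)) 2"
    using lborel_integrable_real_affine[OF i(1), of "-1" 0] lborel_integral_real_affine[of "-1" ?e 0] i(2)
    by (simp add: has_bochner_integral_iff)
  have "has_bochner_integral lborel (\<lambda>s. ?e s + ?e (0 + (-1) * s)) (2 + 2)"
    by (rule has_bochner_integral_add[OF h h'])
  \<comment> \<open>Both half-line pieces contain the origin, where their sum is 2 instead of 1;
    hence equality only almost everywhere.\<close>
  moreover have "AE s in lborel. ?e s + ?e (0 + (-1) * s) = expw s"
    using AE_lborel_singleton[of 0] by eventually_elim (auto simp: expw_def indicator_def)
  ultimately show ?thesis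
    by (subst (asm) has_bochner_integral_cong_AE) auto
qed

lemma expw_translate:
  "integrable lborel (\<lambda>y. expw (x - y))" "(\<integral>y. expw (x - y) \<partial>lborel) = 4"
  using lborel_integrable_real_affine[of expw "-1" x] lborel_integral_real_affine[of "-1" expw x] has_bochner_integral_expw
  by (auto simp: has_bochner_integral_iff)

lemma expw_translate2:
  "integrable lborel (\<lambda>y. expw (y - x))" "(\<integral>y. expw (y - x) \<partial>lborel) = 4"
  using expw_translate[of x] by (simp_all add: expw_commute[of x])

lemma schur_integrable1:
  assumes f: "integrable lborel f"
  shows "integrable (lborel \<Otimes>\<^sub>M lborel) (\<lambda>(x, y). expw (x - y) * f x)"
proof (rule lborel_pair.Fubini_integrable)
  have [measurable]: "f \<in> borel_measurable borel" using f by auto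
  show "(\<lambda>(x, y). expw (x - y) * f x) \<in> borel_measurable (lborel \<Otimes>\<^sub>M lborel)" by measurable
  have "(\<integral>y. norm (case (x, y) of (x, y) \<Rightarrow> expw (x - y) * f x) \<partial>lborel) = 4 * \<bar>f x\<bar>" for x
    using expw_translate(2)[of x] by (simp add: abs_mult expw_pos abs_of_pos)
  then show "integrable lborel (\<lambda>x. \<integral>y. norm (case (x, y) of (x, y) \<Rightarrow> expw (x - y) * f x) \<partial>lborel)"
    using f by simp
  show "AE x in lborel. integrable lborel (\<lambda>y. case (x, y) of (x, y) \<Rightarrow> expw (x - y) * f x)"
    using expw_translate(1) by simp
qed

lemma schur_integrable2:
  assumes f: "integrable lborel f"
  shows "integrable (lborel \<Otimes>\<^sub>M lborel) (\<lambda>(x, y). expw (x - y) * f y)"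
  using lborel_pair.integrable_product_swap[OF schur_integrable1[OF f]]
  by (simp add: expw_commute)

lemma schur_integral:
  assumes f: "integrable lborel f"
  shows "integrable lborel (\<lambda>x. \<integral>y. expw (x - y) * f y \<partial>lborel)"
    and "(\<integral>x. \<integral>y. expw (x - y) * f y \<partial>lborel \<partial>lborel) = 4 * (\<integral>y. f y \<partial>lborel)"
proof -
  note i = schur_integrable2[OF f]
  show "integrable lborel (\<lambda>x. \<integral>y. expw (x - y) * f y \<partial>lborel)"
    using lborel_pair.integrable_fst'[OF i] by simp
  have "(\<integral>x. \<integral>y. expw (x - y) * f y \<partial>lborel \<partial>lborel) = (\<integral>y. \<integral>x. expw (x - y) * f y \<partial>lborel \<partial>lborel)"
    using lborel_pair.Fubini_integral[OF i] by simp
  also have "\<dots> = 4 * (\<integral>y. f y \<partial>lborel)"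
    by (simp add: expw_translate2)
  finally show "(\<integral>x. \<integral>y. expw (x - y) * f y \<partial>lborel \<partial>lborel) = 4 * (\<integral>y. f y \<partial>lborel)" .
qed

subsection \<open>Hankel operators with kernels of order \<open>1 / t\<close>\<close>

locale hankel_kernel =
  fixes h :: "real \<Rightarrow> real" and C :: real
  assumes h_meas: "h \<in> borel_measurable borel"
    and C_nonneg: "0 \<le> C"
    and h_bound: "\<And>t. t > 0 \<Longrightarrow> \<bar>h t\<bar> \<le> C / t"
begin

abbreviation K :: "real \<Rightarrow> real \<Rightarrow> real" where
  "K \<equiv> hkern h"

lemma K_commute: "K x y = K y x"
  by (simp add: hkern_def add.commute)

lemma K_measurable [measurable]: "(\<lambda>(x, y). K x y) \<in> borel_measurable (lborel \<Otimes>\<^sub>M lborel)"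
proof -
  note h_meas [measurable]
  show ?thesis unfolding hkern_def by measurable
qed

lemma K_measurable1 [measurable]: "K x \<in> borel_measurable borel"
proof -
  note h_meas [measurable]
  show ?thesis unfolding hkern_def by measurable
qed

text \<open>The sum exp x + exp y is at least exp (max x y), and (x + y) / 2 - max x y = - |x - y| /
  2.\<close>

lemma K_le: "\<bar>K x y\<bar> \<le> C * expw (x - y)"
proof -
  have pos: "exp x + exp y > 0" by (simp add: add_pos_pos)
  have "\<bar>K x y\<bar> \<le> exp ((x + y) / 2) * (C / (exp x + exp y))"
    unfolding hkern_def abs_mult abs_exp_cancel by (rule mult_left_mono[OF h_bound[OF pos]]) simp
  also have "\<dots> \<le> exp ((x + y) / 2) * (C / exp (max x y))"
    using C_nonneg pos by (intro mult_left_mono divide_left_mono) (auto simp: max_def)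
  also have "\<dots> = C * exp ((x + y) / 2 - max x y)" by (simp add: exp_diff)
  also have "(x + y) / 2 - max x y = - \<bar>x - y\<bar> / 2" by (auto simp: max_def abs_if field_simps)
  finally show ?thesis by (simp add: expw_def)
qed

lemma K_le_const: "\<bar>K x y\<bar> \<le> C"
  using K_le[of x y] mult_left_mono[OF expw_le_1[of "x - y"] C_nonneg] by simp

text \<open>One of the two factors \<open>expw\<close> is dropped, being at most 1, so that the only
  integral ever needed is that of \<open>expw\<close>.\<close>

lemma K_sq_le: "(K x y)\<^sup>2 \<le> C\<^sup>2 * expw (x - y)"
proof -
  have "(K x y)\<^sup>2 \<le> (C * expw (x - y))\<^sup>2"
    using K_le[of x y] by (metis abs_ge_zero power2_abs power_mono)
  also have "\<dots> = C\<^sup>2 * (expw (x - y))\<^sup>2" by (rule power_mult_distrib)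
  also have "\<dots> \<le> C\<^sup>2 * (expw (x - y) * 1)"
    unfolding power2_eq_square[of "expw (x - y)"]
    by (intro mult_left_mono expw_le_1 less_imp_le[OF expw_pos]) simp
  also have "\<dots> = C\<^sup>2 * expw (x - y)" by simp
  finally show ?thesis .
qed

lemma sqint_K: "sqint (K x)"
  unfolding sqint_def
proof
  show "integrable lborel (\<lambda>y. (K x y)\<^sup>2)"
  proof (rule Bochner_Integration.integrable_bound)
    show "integrable lborel (\<lambda>y. C\<^sup>2 * expw (x - y))" using expw_translate(1)[of x] by simp
    show "AE y in lborel. norm ((K x y)\<^sup>2) \<le> norm (C\<^sup>2 * expw (x - y))"
      using K_sq_le expw_pos by (auto simp: abs_mult abs_of_pos)
  qed simp
qed simp

lemma norm_K: "l2inner (K x) (K x) \<le> 4 * C\<^sup>2"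
proof -
  have "l2inner (K x) (K x) \<le> (\<integral>y. C\<^sup>2 * expw (x - y) \<partial>lborel)"
    unfolding l2inner_def
    by (rule integral_mono)
      (use sqint_integrable_mult[OF sqint_K sqint_K] expw_translate(1)[of x] K_sq_le[of x] in \<open>auto simp: power2_eq_square\<close>)
  also have "\<dots> = 4 * C\<^sup>2" using expw_translate(2)[of x] by simp
  finally show ?thesis .
qed

lemma hop_eq: "hop h u x = l2inner (K x) u"
  by (simp add: hop_def l2inner_def)

lemma hop_measurable:
  assumes [measurable]: "u \<in> borel_measurable borel"
  shows "hop h u \<in> borel_measurable borel"
proof -
  have "(\<lambda>x. \<integral>y. (case (x, y) of (x, y) \<Rightarrow> K x y * u y) \<partial>lborel) \<in> borel_measurable lborel"
    by (rule lborel.borel_measurable_lebesgue_integral) measurable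
  then show ?thesis by (simp add: hop_def)
qed

lemma hop_sq_le:
  assumes u: "sqint u"
  shows "(hop h u x)\<^sup>2 \<le> 4 * C\<^sup>2 * (\<integral>y. expw (x - y) * (u y)\<^sup>2 \<partial>lborel)"
proof -
  have [measurable]: "u \<in> borel_measurable borel" using u by (rule sqint_measurable)
  let ?I = "\<integral>y. expw (x - y) * (u y)\<^sup>2 \<partial>lborel" and ?J = "\<integral>y. expw (x - y) * \<bar>u y\<bar> \<partial>lborel"
  have i2: "integrable lborel (\<lambda>y. expw (x - y) * (u y)\<^sup>2)"
  proof (rule Bochner_Integration.integrable_bound)
    show "integrable lborel (\<lambda>y. (u y)\<^sup>2)" using u by (simp add: sqint_def)
    show "AE y in lborel. norm (expw (x - y) * (u y)\<^sup>2) \<le> norm ((u y)\<^sup>2)"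
    proof (rule AE_I2)
      fix y show "norm (expw (x - y) * (u y)\<^sup>2) \<le> norm ((u y)\<^sup>2)"
        using mult_right_mono[OF expw_le_1[of "x - y"], of "(u y)\<^sup>2"] expw_pos[of "x - y"]
        by (simp add: abs_mult abs_of_pos)
    qed
  qed simp
  have i1: "integrable lborel (\<lambda>y. expw (x - y) * \<bar>u y\<bar>)"
  proof (rule Bochner_Integration.integrable_bound)
    show "integrable lborel (\<lambda>y. expw (x - y) + expw (x - y) * (u y)\<^sup>2)" using i2 expw_translate(1) by simp
    show "AE y in lborel. norm (expw (x - y) * \<bar>u y\<bar>) \<le> norm (expw (x - y) + expw (x - y) * (u y)\<^sup>2)"
    proof (rule AE_I2)
      fix y
      have "\<bar>u y\<bar> \<le> 1 + (u y)\<^sup>2"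
      proof -
        have "0 \<le> (\<bar>u y\<bar> - 1)\<^sup>2" by simp
        then show ?thesis by (simp add: power2_eq_square algebra_simps)
      qed
      then have "expw (x - y) * \<bar>u y\<bar> \<le> expw (x - y) * (1 + (u y)\<^sup>2)"
        using expw_pos[of "x - y"] by (intro mult_left_mono) auto
      then show "norm (expw (x - y) * \<bar>u y\<bar>) \<le> norm (expw (x - y) + expw (x - y) * (u y)\<^sup>2)"
        using expw_pos[of "x - y"] by (simp add: abs_mult algebra_simps abs_of_pos)
    qed
  qed simp
  have "\<bar>hop h u x\<bar> \<le> (\<integral>y. \<bar>K x y * u y\<bar> \<partial>lborel)"
    unfolding hop_def by (rule integral_abs_bound)
  also have "\<dots> \<le> (\<integral>y. C * (expw (x - y) * \<bar>u y\<bar>) \<partial>lborel)"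
  proof (rule integral_mono)
    fix y show "\<bar>K x y * u y\<bar> \<le> C * (expw (x - y) * \<bar>u y\<bar>)"
      using mult_right_mono[OF K_le[of x y], of "\<bar>u y\<bar>"] by (simp add: abs_mult mult.assoc)
  qed (use sqint_integrable_mult[OF sqint_K u] i1 in auto)
  also have "\<dots> = C * ?J" by simp
  finally have "\<bar>hop h u x\<bar> \<le> C * ?J" .
  then have h2: "(hop h u x)\<^sup>2 \<le> (C * ?J)\<^sup>2" by (metis abs_ge_zero power2_abs power_mono)
  \<comment> \<open>The number ?J / 4 is the mean of |u| for the weight \<open>expw (x - y)\<close>
    of mass 4. Nonnegativity of the variance is the Cauchy-Schwarz bound J^2 \<le> 4 I.\<close>
  have "0 \<le> (\<integral>y. expw (x - y) * (\<bar>u y\<bar> - ?J / 4)\<^sup>2 \<partial>lborel)"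
    by (rule integral_nonneg_AE, rule AE_I2, rule mult_nonneg_nonneg[OF less_imp_le[OF expw_pos]]) simp
  also have "\<dots> = (\<integral>y. expw (x - y) * (u y)\<^sup>2 - (?J / 2) * (expw (x - y) * \<bar>u y\<bar>) + (?J / 4)\<^sup>2 * expw (x - y) \<partial>lborel)"
    by (simp add: power2_diff algebra_simps)
  also have "\<dots> = ?I - (?J / 2) * ?J + (?J / 4)\<^sup>2 * 4"
    using i1 i2 expw_translate(1)[of x] expw_translate(2)[of x] by simp
  also have "\<dots> = ?I - ?J\<^sup>2 / 4" by (simp add: power2_eq_square field_simps)
  finally have "?J\<^sup>2 \<le> 4 * ?I" by simp
  then have "(C * ?J)\<^sup>2 \<le> 4 * C\<^sup>2 * ?I"
    using mult_left_mono[of "?J\<^sup>2" "4 * ?I" "C\<^sup>2"] by (simp add: power_mult_distrib algebra_simps)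
  with h2 show ?thesis by simp
qed

text \<open>Schur's test: the pointwise estimate contributes 4 C^2, and integrating the weight over
  the other variable contributes another 4.\<close>

lemma hop_bounded:
  assumes u: "sqint u"
  shows "sqint (hop h u)" and "l2inner (hop h u) (hop h u) \<le> 16 * C\<^sup>2 * l2inner u u"
proof -
  have u2: "integrable lborel (\<lambda>y. (u y)\<^sup>2)" using u by (simp add: sqint_def)
  have [measurable]: "hop h u \<in> borel_measurable borel" using sqint_measurable[OF u] by (rule hop_measurable)
  let ?I = "\<lambda>x. \<integral>y. expw (x - y) * (u y)\<^sup>2 \<partial>lborel"
  have i: "integrable lborel (\<lambda>x. (hop h u x)\<^sup>2)"
  proof (rule Bochner_Integration.integrable_bound)
    show "integrable lborel (\<lambda>x. 4 * C\<^sup>2 * ?I x)" using schur_integral(1)[OF u2] by simp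
    show "AE x in lborel. norm ((hop h u x)\<^sup>2) \<le> norm (4 * C\<^sup>2 * ?I x)"
    proof (rule AE_I2)
      fix x show "norm ((hop h u x)\<^sup>2) \<le> norm (4 * C\<^sup>2 * ?I x)"
        using hop_sq_le[OF u, of x] by simp
    qed
  qed simp
  then show sq: "sqint (hop h u)" by (simp add: sqint_def)
  have "l2inner (hop h u) (hop h u) \<le> (\<integral>x. 4 * C\<^sup>2 * ?I x \<partial>lborel)"
    unfolding l2inner_def
    by (rule integral_mono) (use i schur_integral(1)[OF u2] hop_sq_le[OF u] in \<open>auto simp: power2_eq_square\<close>)
  also have "\<dots> = 16 * C\<^sup>2 * l2inner u u"
    using schur_integral(2)[OF u2] by (simp add: l2inner_def power2_eq_square)
  finally show "l2inner (hop h u) (hop h u) \<le> 16 * C\<^sup>2 * l2inner u u" .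
qed

lemma hop_sym:
  assumes u: "sqint u" and v: "sqint v"
  shows "l2inner (hop h u) v = l2inner u (hop h v)"
proof -
  have [measurable]: "u \<in> borel_measurable borel" "v \<in> borel_measurable borel"
    using u v by (auto intro: sqint_measurable)
  have u2: "integrable lborel (\<lambda>y. (u y)\<^sup>2)" and v2: "integrable lborel (\<lambda>y. (v y)\<^sup>2)"
    using u v by (auto simp: sqint_def)
  have i: "integrable (lborel \<Otimes>\<^sub>M lborel) (\<lambda>(x, y). K x y * u y * v x)"
  proof (rule Bochner_Integration.integrable_bound)
    show "integrable (lborel \<Otimes>\<^sub>M lborel) (\<lambda>p. C * ((case p of (x, y) \<Rightarrow> expw (x - y) * (u y)\<^sup>2)
        + (case p of (x, y) \<Rightarrow> expw (x - y) * (v x)\<^sup>2)))"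
      using schur_integrable2[OF u2] schur_integrable1[OF v2] by auto
    show "AE p in lborel \<Otimes>\<^sub>M lborel. norm (case p of (x, y) \<Rightarrow> K x y * u y * v x)
       \<le> norm (C * ((case p of (x, y) \<Rightarrow> expw (x - y) * (u y)\<^sup>2) + (case p of (x, y) \<Rightarrow> expw (x - y) * (v x)\<^sup>2)))"
    proof (rule AE_I2, clarify)
      fix x y
      have "\<bar>u y * v x\<bar> \<le> (u y)\<^sup>2 + (v x)\<^sup>2"
      proof -
        have "2 * (\<bar>u y\<bar> * \<bar>v x\<bar>) \<le> \<bar>u y\<bar>\<^sup>2 + \<bar>v x\<bar>\<^sup>2"
          using sum_squares_bound[of "\<bar>u y\<bar>" "\<bar>v x\<bar>"] by (simp add: mult.assoc)
        moreover have "0 \<le> \<bar>u y\<bar> * \<bar>v x\<bar>" by simp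
        ultimately show ?thesis unfolding abs_mult power2_abs by linarith
      qed
      then have "\<bar>K x y\<bar> * \<bar>u y * v x\<bar> \<le> (C * expw (x - y)) * ((u y)\<^sup>2 + (v x)\<^sup>2)"
        using K_le[of x y] by (intro mult_mono) auto
      then show "norm (K x y * u y * v x) \<le> norm (C * (expw (x - y) * (u y)\<^sup>2 + expw (x - y) * (v x)\<^sup>2))"
        by (simp add: abs_mult algebra_simps)
    qed
  qed measurable
  have "l2inner (hop h u) v = (\<integral>x. (\<integral>y. K x y * u y * v x \<partial>lborel) \<partial>lborel)"
    by (simp add: l2inner_def hop_def)
  also have "\<dots> = (\<integral>y. (\<integral>x. K x y * u y * v x \<partial>lborel) \<partial>lborel)"
    using lborel_pair.Fubini_integral[OF i] by simp
  also have "\<dots> = (\<integral>y. u y * (\<integral>x. K y x * v x \<partial>lborel) \<partial>lborel)"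
  proof (rule Bochner_Integration.integral_cong[OF refl])
    fix y
    have "(\<integral>x. K x y * u y * v x \<partial>lborel) = (\<integral>x. u y * (K y x * v x) \<partial>lborel)"
      by (simp add: K_commute[of _ y] mult_ac)
    then show "(\<integral>x. K x y * u y * v x \<partial>lborel) = u y * (\<integral>x. K y x * v x \<partial>lborel)" by simp
  qed
  also have "\<dots> = l2inner u (hop h v)" by (simp add: l2inner_def hop_def)
  finally show ?thesis .
qed

text \<open>The operator norm is at most 4 C; the added 1 keeps the radius positive when C =
  0.\<close>

sublocale l2_bounded "hop h" "4 * C + 1"
proof
  fix u assume u: "sqint u"
  show "sqint (hop h u)" by (rule hop_bounded(1)[OF u])
  let ?R = "4 * C + 1" and ?n = "l2inner u u" and ?a = "l2inner (hop h u) u"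
  have R: "?R > 0" using C_nonneg by simp
  have hn: "l2inner (hop h u) (hop h u) \<le> ?R\<^sup>2 * ?n"
  proof -
    have "16 * C\<^sup>2 \<le> ?R\<^sup>2" using C_nonneg by (simp add: power2_eq_square algebra_simps)
    then show ?thesis using hop_bounded(2)[OF u] mult_right_mono[OF _ l2inner_nonneg[of u]] by (meson order_trans)
  qed
  \<comment> \<open>Expanding |H u + \<sigma> R u|^2 \<ge> 0 at \<sigma> = 1 and \<sigma> = -1
    converts the norm bound |H u| \<le> R |u| into the two-sided form bound.\<close>
  have "0 \<le> l2inner (\<lambda>x. 1 * hop h u x + \<sigma> * ?R * u x) (\<lambda>x. 1 * hop h u x + \<sigma> * ?R * u x)" for \<sigma>
    by (rule l2inner_nonneg)
  then have q: "0 \<le> l2inner (hop h u) (hop h u) + 2 * \<sigma> * ?R * ?a + \<sigma>\<^sup>2 * ?R\<^sup>2 * ?n" for \<sigma>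
    by (subst (asm) l2inner_quadratic[OF hop_bounded(1)[OF u] u]) (simp add: power_mult_distrib mult.assoc)
  have "- ?a * ?R \<le> (?R * ?n) * ?R" using q[of 1] hn unfolding power2_eq_square by argo
  then have 1: "- ?a \<le> ?R * ?n" using R by (simp only: mult_le_cancel_right_pos)
  have "?a * ?R \<le> (?R * ?n) * ?R" using q[of "-1"] hn unfolding power2_eq_square by argo
  then have 2: "?a \<le> ?R * ?n" using R by (simp only: mult_le_cancel_right_pos)
  show "\<bar>?a\<bar> \<le> ?R * ?n" using 1 2 by (simp add: abs_le_iff)
next
  fix u v :: "real \<Rightarrow> real" and a b :: real
  assume u: "sqint u" and v: "sqint v"
  show "hop h (\<lambda>x. a * u x + b * v x) = (\<lambda>x. a * hop h u x + b * hop h v x)"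
    unfolding hop_eq[abs_def] using u v sqint_K by (simp add: l2inner_lin2)
  show "l2inner (hop h u) v = l2inner u (hop h v)" by (rule hop_sym[OF u v])
qed (use C_nonneg in simp)

lemma is_spec_meas_iff: "is_spec_meas h u \<mu> \<longleftrightarrow> op_spec (hop h) u \<mu>"
  by (simp add: is_spec_meas_def op_spec_def)

end

subsection \<open>Continuity of the kernel sections in the mean\<close>

text \<open>The substitution t = e^x + e^y for fixed x, with Jacobian e^y and range (e^x,
  \<infinity>).\<close>

lemma exp_shift_substitution:
  fixes F :: "real \<Rightarrow> real"
  assumes [measurable]: "F \<in> borel_measurable borel" and F: "set_integrable lborel {exp x<..} F"
  shows "(\<integral>y. exp y * F (exp x + exp y) \<partial>lborel) = (LINT t:{exp x<..}|lborel. F t)"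
proof -
  let ?g = "\<lambda>y. exp x + exp y"
  have img: "range ?g = {exp x<..}"
  proof (intro equalityI subsetI)
    fix t assume "t \<in> {exp x<..}"
    then have "t = ?g (ln (t - exp x))" by simp
    then show "t \<in> range ?g" by blast
  qed auto
  have "F absolutely_integrable_on {exp x<..}"
    using F unfolding set_integrable_def by (subst integrable_completion) auto
  then have "F absolutely_integrable_on range ?g \<and> integral (range ?g) F = integral {exp x<..} F"
    unfolding img by simp
  moreover have "(?g has_field_derivative exp y) (at y within UNIV)" for y
    by (auto intro!: derivative_eq_intros)
  moreover have "inj ?g" by (auto simp: inj_on_def)
  ultimately have *: "(\<lambda>y. \<bar>exp y\<bar> * F (?g y)) absolutely_integrable_on UNIV \<and>
      integral UNIV (\<lambda>y. \<bar>exp y\<bar> * F (?g y)) = integral {exp x<..} F"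
    by (subst has_absolute_integral_change_of_variables_1') auto
  then have "set_integrable lborel UNIV (\<lambda>y. exp y * F (?g y))"
    unfolding set_integrable_def by (subst (asm) integrable_completion) auto
  then have "(LINT y:UNIV|lborel. exp y * F (?g y)) = integral UNIV (\<lambda>y. exp y * F (?g y))"
    by (rule set_borel_integral_eq_integral)
  also have "\<dots> = integral {exp x<..} F" using * by simp
  also have "\<dots> = (LINT t:{exp x<..}|lborel. F t)"
    using set_borel_integral_eq_integral(2)[OF F] by simp
  finally show ?thesis by (simp add: set_lebesgue_integral_def)
qed

lemma set_integrable_inverse_square:
  fixes a c :: real
  assumes "a > 0"
  shows "set_integrable lborel {a<..} (\<lambda>t. c / t\<^sup>2)"
proof -
  have "((\<lambda>t::real. 1 / t ^ 2) has_integral 1 / (real (2 - 1) * a ^ (2 - 1))) {a..}"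
    by (rule has_integral_inverse_power_to_inf) (use assms in auto)
  then have "(\<lambda>t::real. 1 / t ^ 2) absolutely_integrable_on {a..}"
    by (intro nonnegative_absolutely_integrable_1) (auto simp: integrable_on_def)
  then have "set_integrable lborel {a..} (\<lambda>t. 1 / t\<^sup>2)"
    unfolding set_integrable_def by (subst (asm) integrable_completion) auto
  then have "set_integrable lborel {a<..} (\<lambda>t. c * (1 / t\<^sup>2))"
    by (intro set_integrable_mult_right) (auto intro: set_integrable_subset)
  then show ?thesis by simp
qed

lemma expw_near:
  assumes "\<bar>x - x0\<bar> \<le> B"
  shows "expw (x - y) \<le> exp (B / 2) * expw (x0 - y)"
proof -
  have "\<bar>x0 - y\<bar> \<le> \<bar>x0 - x\<bar> + \<bar>x - y\<bar>" using abs_triangle_ineq[of "x0 - x" "x - y"] by simp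
  then have "- \<bar>x - y\<bar> / 2 \<le> B / 2 + - \<bar>x0 - y\<bar> / 2"
    using assms unfolding abs_minus_commute[of x x0] by argo
  then show ?thesis unfolding expw_def exp_add[symmetric] exp_le_cancel_iff .
qed

lemma borel_continuous_approximation:
  fixes h :: "real \<Rightarrow> real"
  assumes "h \<in> borel_measurable borel"
  obtains g where "\<And>n. continuous_on UNIV (g n)" "AE x in lborel. (\<lambda>n. g n x) \<longlonglongrightarrow> h x"
proof -
  have "h \<in> borel_measurable lebesgue" by (rule measurable_completion) (use assms in simp)
  then have "h measurable_on UNIV" by (rule lebesgue_measurable_imp_measurable_on) simp
  then obtain N g where N: "negligible N" and g: "\<forall>n. continuous_on UNIV (g n)"
    and "\<forall>x. x \<notin> N \<longrightarrow> (\<lambda>n. g n x) \<longlonglongrightarrow> (if x \<in> UNIV then h x else 0)"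
    unfolding measurable_on_def by blast
  then have lim: "(\<lambda>n. g n x) \<longlonglongrightarrow> h x" if "x \<notin> N" for x using that by simp
  have "AE x in lebesgue. x \<notin> N" using N by (simp add: negligible_iff_null_sets AE_not_in)
  then have "AE x in lborel. x \<notin> N" by (simp add: AE_completion_iff)
  then have "AE x in lborel. (\<lambda>n. g n x) \<longlonglongrightarrow> h x" by eventually_elim (rule lim)
  then show ?thesis using g that by blast
qed

context hankel_kernel
begin

abbreviation secdist :: "real \<Rightarrow> real \<Rightarrow> real" where
  "secdist x x' \<equiv> l2inner (\<lambda>y. K x y - K x' y) (\<lambda>y. K x y - K x' y)"

text \<open>Dominated convergence in y: the base points stay within a bounded distance of the limit,
  so one multiple of \<open>expw (x0 - y)\<close> dominates all terms. Continuity on the open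
  half-line suffices because \<open>h\<close> is only sampled at e^x + e^y > 0.\<close>

lemma section_tendsto_of_continuous:
  assumes cont: "continuous_on {0<..} h" and X: "X \<longlonglongrightarrow> x0"
  shows "(\<lambda>m. secdist (X m) x0) \<longlonglongrightarrow> 0"
proof -
  obtain B where B: "\<And>m. \<bar>X m - x0\<bar> \<le> B"
  proof -
    have "Bseq (\<lambda>m. X m - x0)" using X by (intro convergent_imp_Bseq convergentI[of _ "x0 - x0"] tendsto_intros)
    then show ?thesis using that by (auto simp: Bseq_def)
  qed
  have B0: "B \<ge> 0" using B[of 0] by linarith
  let ?c = "2 * C * exp (B / 2)"
  have le: "(K (X m) y - K x0 y)\<^sup>2 \<le> ?c\<^sup>2 * expw (x0 - y)" for m y
  proof -
    have e1: "\<bar>K (X m) y\<bar> \<le> C * (exp (B / 2) * expw (x0 - y))"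
      using K_le[of "X m" y] mult_left_mono[OF expw_near[OF B] C_nonneg] by (rule order_trans)
    have e2: "\<bar>K x0 y\<bar> \<le> C * (exp (B / 2) * expw (x0 - y))"
      using K_le[of x0 y] mult_left_mono[OF expw_near[of x0 x0 B y] C_nonneg] B0 by (rule_tac order_trans) auto
    have "\<bar>K (X m) y - K x0 y\<bar> \<le> \<bar>?c * expw (x0 - y)\<bar>" using e1 e2 C_nonneg expw_pos[of "x0 - y"]
      by (simp add: abs_mult abs_of_pos)
    then have "(K (X m) y - K x0 y)\<^sup>2 \<le> (?c * expw (x0 - y))\<^sup>2" by (rule abs_le_square_iff[THEN iffD1])
    also have "\<dots> = ?c\<^sup>2 * (expw (x0 - y) * expw (x0 - y))" by (simp add: power2_eq_square)
    also have "\<dots> \<le> ?c\<^sup>2 * (expw (x0 - y) * 1)"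
      by (intro mult_left_mono expw_le_1 less_imp_le[OF expw_pos]) simp
    finally show ?thesis by simp
  qed
  have "(\<lambda>m. \<integral>y. (K (X m) y - K x0 y)\<^sup>2 \<partial>lborel) \<longlonglongrightarrow> (\<integral>y. 0 \<partial>(lborel :: real measure))"
  proof (rule integral_dominated_convergence[where w = "\<lambda>y. ?c\<^sup>2 * expw (x0 - y)"])
    show "integrable lborel (\<lambda>y. ?c\<^sup>2 * expw (x0 - y))" using expw_translate(1) by simp
    show "AE y in lborel. norm ((K (X m) y - K x0 y)\<^sup>2) \<le> ?c\<^sup>2 * expw (x0 - y)" for m using le by simp
    show "AE y in lborel. (\<lambda>m. (K (X m) y - K x0 y)\<^sup>2) \<longlonglongrightarrow> 0"
    proof (rule AE_I2)
      fix y
      have p: "0 < exp x0 + exp y" by (simp add: add_pos_pos)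
      then have "isCont h (exp x0 + exp y)"
        using cont continuous_on_interior[of "{0<..}" h] by (simp add: interior_open)
      then have "(\<lambda>m. h (exp (X m) + exp y)) \<longlonglongrightarrow> h (exp x0 + exp y)"
        by (rule isCont_tendsto_compose) (intro tendsto_intros X)
      then have "(\<lambda>m. K (X m) y) \<longlonglongrightarrow> K x0 y" unfolding hkern_def by (intro tendsto_intros X) auto
      then have "(\<lambda>m. (K (X m) y - K x0 y)\<^sup>2) \<longlonglongrightarrow> (K x0 y - K x0 y)\<^sup>2" by (intro tendsto_intros)
      then show "(\<lambda>m. (K (X m) y - K x0 y)\<^sup>2) \<longlonglongrightarrow> 0" by simp
    qed
  qed simp_all
  then show ?thesis by (simp add: l2inner_def power2_eq_square)
qed

text \<open>Squaring the factor exp ((x + y) / 2) yields e^x e^y, and e^y is exactly the Jacobian of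
  t = e^x + e^y. Since t stays above e^x > 0, the majorant (2 C / t)^2 is integrable.\<close>

lemma section_diff:
  assumes "hankel_kernel h' C"
  shows "set_integrable lborel {exp x<..} (\<lambda>t. (h t - h' t)\<^sup>2)"
    and "l2inner (\<lambda>y. K x y - hkern h' x y) (\<lambda>y. K x y - hkern h' x y)
      = exp x * (LINT t:{exp x<..}|lborel. (h t - h' t)\<^sup>2)"
proof -
  interpret h': hankel_kernel h' C by fact
  note [measurable] = h_meas h'.h_meas
  show *: "set_integrable lborel {exp x<..} (\<lambda>t. (h t - h' t)\<^sup>2)"
  proof (rule set_integrable_bound[OF set_integrable_inverse_square[of "exp x" "(2 * C)\<^sup>2"]])
    show "AE t in lborel. t \<in> {exp x<..} \<longrightarrow> norm ((h t - h' t)\<^sup>2) \<le> norm ((2 * C)\<^sup>2 / t\<^sup>2)"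
    proof (intro AE_I2 impI)
      fix t assume "t \<in> {exp x<..}"
      then have t: "t > 0" using order_less_trans[OF exp_gt_zero, of x t] by simp
      have "\<bar>h t - h' t\<bar> \<le> C / t + C / t" using h_bound[OF t] h'.h_bound[OF t] by linarith
      also have "\<dots> = \<bar>2 * C / t\<bar>" using C_nonneg t by simp
      finally have "(h t - h' t)\<^sup>2 \<le> (2 * C / t)\<^sup>2" by (rule abs_le_square_iff[THEN iffD1])
      then show "norm ((h t - h' t)\<^sup>2) \<le> norm ((2 * C)\<^sup>2 / t\<^sup>2)" by (simp add: power_divide)
    qed
  qed (auto simp: set_borel_measurable_def)
  have "(hkern h x y - hkern h' x y)\<^sup>2 = exp x * (exp y * (h (exp x + exp y) - h' (exp x + exp y))\<^sup>2)" for y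
  proof -
    have "exp ((x + y) / 2) ^ 2 = exp x * exp y"
      by (simp add: power2_eq_square flip: exp_add)
    then show ?thesis by (simp add: hkern_def power_mult_distrib flip: right_diff_distrib)
  qed
  then have "l2inner (\<lambda>y. K x y - hkern h' x y) (\<lambda>y. K x y - hkern h' x y)
     = exp x * (\<integral>y. exp y * (h (exp x + exp y) - h' (exp x + exp y))\<^sup>2 \<partial>lborel)"
    by (simp add: l2inner_def flip: power2_eq_square)
  also have "\<dots> = exp x * (LINT t:{exp x<..}|lborel. (h t - h' t)\<^sup>2)"
    using exp_shift_substitution[OF _ *] by simp
  finally show "l2inner (\<lambda>y. K x y - hkern h' x y) (\<lambda>y. K x y - hkern h' x y)
      = exp x * (LINT t:{exp x<..}|lborel. (h t - h' t)\<^sup>2)" .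
qed

text \<open>By a change of variables, approximating \<open>h\<close> by continuous functions almost everywhere approximates the
  sections of the kernel in the mean, uniformly on bounded sets of parameters.\<close>
lemma section_tendsto:
  assumes X: "X \<longlonglongrightarrow> x0"
  shows "(\<lambda>m. secdist (X m) x0) \<longlonglongrightarrow> 0"
proof -
  note [measurable] = h_meas
  obtain g where g: "\<And>n. continuous_on UNIV (g n)" and lim: "AE t in lborel. (\<lambda>n. g n t) \<longlonglongrightarrow> h t"
    using borel_continuous_approximation[OF h_meas] by blast
  \<comment> \<open>Truncation between - C / t and C / t puts the approximants in the same class
    with the same constant, and does not disturb the limit because \<open>h\<close> obeys these
    bounds.\<close>
  define f where "f n t = max (- (C / t)) (min (C / t) (g n t))" for n t
  have [measurable]: "g n \<in> borel_measurable borel" for n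
    using g by (rule borel_measurable_continuous_onI)
  have fk: "hankel_kernel (f n) C" for n
  proof
    show "f n \<in> borel_measurable borel" unfolding f_def by measurable
    show "\<bar>f n t\<bar> \<le> C / t" if "t > 0" for t
    proof -
      have "0 \<le> C / t" using that C_nonneg by simp
      then show ?thesis unfolding f_def by (auto simp: abs_le_iff max_def min_def)
    qed
  qed (rule C_nonneg)
  have fc: "continuous_on {0<..} (f n)" for n
    unfolding f_def by (intro continuous_intros continuous_on_subset[OF g]) auto
  have flim: "AE t in lborel. t > 0 \<longrightarrow> (\<lambda>n. (h t - f n t)\<^sup>2) \<longlonglongrightarrow> 0"
    using lim
  proof eventually_elim
    case (elim t)
    show ?case
    proof
      assume t: "t > 0"
      have "(\<lambda>n. f n t) \<longlonglongrightarrow> max (- (C / t)) (min (C / t) (h t))"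
        unfolding f_def by (intro tendsto_intros elim)
      also have "max (- (C / t)) (min (C / t) (h t)) = h t" using h_bound[OF t] by (auto simp: abs_le_iff)
      finally have "(\<lambda>n. (h t - f n t)\<^sup>2) \<longlonglongrightarrow> (h t - h t)\<^sup>2" by (intro tendsto_intros)
      then show "(\<lambda>n. (h t - f n t)\<^sup>2) \<longlonglongrightarrow> 0" by simp
    qed
  qed
  obtain B where B: "\<And>m. \<bar>X m\<bar> \<le> B" "\<bar>x0\<bar> \<le> B"
  proof -
    have "Bseq X" using X by (intro convergent_imp_Bseq convergentI)
    then obtain b where "\<And>m. \<bar>X m\<bar> \<le> b" by (auto simp: Bseq_def)
    then show ?thesis using that[of "max b \<bar>x0\<bar>"] by (auto simp: le_max_iff_disj)
  qed
  \<comment> \<open>For |x| \<le> B the factor e^x is at most e^B and the half-line (e^x,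
    \<infinity>) lies in (e^(-B), \<infinity>), so one error serves all sections in this
    range.\<close>
  define \<epsilon> where "\<epsilon> n = exp B * (LINT t:{exp (-B)<..}|lborel. (h t - f n t)\<^sup>2)" for n
  have eps: "l2inner (\<lambda>y. K x y - hkern (f n) x y) (\<lambda>y. K x y - hkern (f n) x y) \<le> \<epsilon> n" if "\<bar>x\<bar> \<le> B" for x n
  proof -
    have "(LINT t:{exp x<..}|lborel. (h t - f n t)\<^sup>2) \<le> (LINT t:{exp (-B)<..}|lborel. (h t - f n t)\<^sup>2)"
      unfolding set_lebesgue_integral_def
    proof (rule integral_mono)
      fix t
      have "exp (- B) \<le> exp x" using that by simp
      then have "indicat_real {exp x<..} t \<le> indicat_real {exp (-B)<..} t"
        by (auto simp: indicator_def simp del: exp_le_cancel_iff)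
      then show "indicat_real {exp x<..} t *\<^sub>R (h t - f n t)\<^sup>2 \<le> indicat_real {exp (-B)<..} t *\<^sub>R (h t - f n t)\<^sup>2"
        by (intro scaleR_right_mono) auto
    qed (use section_diff(1)[OF fk] in \<open>auto simp: set_integrable_def\<close>)
    moreover have "0 \<le> (LINT t:{exp x<..}|lborel. (h t - f n t)\<^sup>2)"
      unfolding set_lebesgue_integral_def by (rule integral_nonneg_AE) auto
    ultimately show ?thesis unfolding section_diff(2)[OF fk] \<epsilon>_def using that
      by (intro mult_mono) (auto simp: abs_le_iff)
  qed
  have "\<epsilon> \<longlonglongrightarrow> exp B * 0"
    unfolding \<epsilon>_def
  proof (rule tendsto_mult_left)
    have "(\<lambda>n. LINT t|lborel. indicator {exp (-B)<..} t *\<^sub>R (h t - f n t)\<^sup>2) \<longlonglongrightarrow> (LINT t|(lborel :: real measure). 0)"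
    proof (rule integral_dominated_convergence)
      show "integrable lborel (\<lambda>t. indicator {exp (-B)<..} t *\<^sub>R ((2 * C)\<^sup>2 / t\<^sup>2))"
        using set_integrable_inverse_square[of "exp (-B)" "(2 * C)\<^sup>2"] by (simp add: set_integrable_def)
      show "AE t in lborel. norm (indicator {exp (-B)<..} t *\<^sub>R (h t - f n t)\<^sup>2)
          \<le> indicator {exp (-B)<..} t *\<^sub>R ((2 * C)\<^sup>2 / t\<^sup>2)" for n
      proof (rule AE_I2)
        fix t
        show "norm (indicator {exp (-B)<..} t *\<^sub>R (h t - f n t)\<^sup>2) \<le> indicator {exp (-B)<..} t *\<^sub>R ((2 * C)\<^sup>2 / t\<^sup>2)"
        proof (cases "t > exp (-B)")
          case True
          then have t: "t > 0" by (rule order_less_trans[OF exp_gt_zero])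
          interpret f: hankel_kernel "f n" C by (rule fk)
          have "\<bar>h t - f n t\<bar> \<le> C / t + C / t" using h_bound[OF t] f.h_bound[OF t] by linarith
          also have "\<dots> = \<bar>2 * C / t\<bar>" using C_nonneg t by simp
          finally have "(h t - f n t)\<^sup>2 \<le> (2 * C / t)\<^sup>2" by (rule abs_le_square_iff[THEN iffD1])
          then show ?thesis using True by (simp add: power_divide)
        qed simp
      qed
      show "AE t in lborel. (\<lambda>n. indicator {exp (-B)<..} t *\<^sub>R (h t - f n t)\<^sup>2) \<longlonglongrightarrow> 0"
        using flim
      proof eventually_elim
        case (elim t)
        show ?case
        proof (cases "t > exp (-B)")
          case True
          then have "t > 0" by (rule order_less_trans[OF exp_gt_zero])
          then show ?thesis using elim True by simp
        qed simp
      qed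
      show "(\<lambda>t. indicator {exp (-B)<..} t *\<^sub>R (h t - f n t)\<^sup>2) \<in> borel_measurable lborel" for n
        unfolding f_def by measurable
    qed simp
    then show "(\<lambda>n. LINT t:{exp (-B)<..}|lborel. (h t - f n t)\<^sup>2) \<longlonglongrightarrow> 0"
      by (simp add: set_lebesgue_integral_def)
  qed
  then have eps0: "\<epsilon> \<longlonglongrightarrow> 0" by simp
  show ?thesis
  proof (rule LIMSEQ_I)
    fix r :: real assume r: "r > 0"
    \<comment> \<open>The share r / 9 comes from (a + b - c)^2 \<le> 3 (a^2 + b^2 + c^2) with three
      terms to control.\<close>
    have "eventually (\<lambda>n. \<epsilon> n < r / 9) sequentially"
      by (rule order_tendstoD(2)[OF eps0]) (use r in simp)
    then obtain n where n: "\<epsilon> n < r / 9" by (auto simp: eventually_sequentially)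
    interpret f: hankel_kernel "f n" C by (rule fk)
    have "eventually (\<lambda>m. f.secdist (X m) x0 < r / 9) sequentially"
      by (rule order_tendstoD(2)[OF f.section_tendsto_of_continuous[OF fc X]]) (use r in simp)
    then obtain M where M: "\<And>m. m \<ge> M \<Longrightarrow> f.secdist (X m) x0 < r / 9" by (auto simp: eventually_sequentially)
    have "secdist (X m) x0 < r" if "m \<ge> M" for m
    proof -
      let ?a = "\<lambda>y. K (X m) y - f.K (X m) y" and ?b = "\<lambda>y. f.K (X m) y - f.K x0 y" and ?c = "\<lambda>y. K x0 y - f.K x0 y"
      have sqs: "sqint ?a" "sqint ?b" "sqint ?c" "sqint (\<lambda>y. K (X m) y - K x0 y)"
        using sqint_lin[OF sqint_K f.sqint_K, of 1 _ "-1"] sqint_lin[OF f.sqint_K f.sqint_K, of 1 _ "-1"]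
          sqint_lin[OF sqint_K sqint_K, of 1 _ "-1"] by simp_all
      have p: "(K (X m) y - K x0 y)\<^sup>2 \<le> 3 * ((?a y)\<^sup>2 + (?b y)\<^sup>2 + (?c y)\<^sup>2)" for y
      proof -
        have "3 * (a\<^sup>2 + b\<^sup>2 + c\<^sup>2) - (a + b - c)\<^sup>2 = (a - b)\<^sup>2 + (b + c)\<^sup>2 + (a + c)\<^sup>2" for a b c :: real
          by (simp add: power2_eq_square algebra_simps)
        from this[of "?a y" "?b y" "?c y"] have "(?a y + ?b y - ?c y)\<^sup>2 \<le> 3 * ((?a y)\<^sup>2 + (?b y)\<^sup>2 + (?c y)\<^sup>2)"
          using zero_le_power2[of "?a y - ?b y"] zero_le_power2[of "?b y + ?c y"] zero_le_power2[of "?a y + ?c y"]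
          by linarith
        then show ?thesis by simp
      qed
      have "secdist (X m) x0 \<le> (\<integral>y. 3 * ((?a y)\<^sup>2 + (?b y)\<^sup>2 + (?c y)\<^sup>2) \<partial>lborel)"
        unfolding l2inner_def power2_eq_square[symmetric]
        by (rule integral_mono) (use sqs p in \<open>auto simp: sqint_def\<close>)
      also have "\<dots> = 3 * (l2inner ?a ?a + l2inner ?b ?b + l2inner ?c ?c)"
        using sqs by (simp add: sqint_def l2inner_def flip: power2_eq_square)
      also have "\<dots> < r"
      proof -
        have "3 * (p + q + s) < r" if "p < r / 9" "q < r / 9" "s < r / 9" for p q s
        proof -
          have "p + q + s < r / 9 + r / 9 + r / 9" using that by linarith
          then show ?thesis by (simp add: field_simps)
        qed
        then show ?thesis
          using le_less_trans[OF eps[OF B(1)] n] le_less_trans[OF eps[OF B(2)] n] M[OF that] by blast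
      qed
      finally show ?thesis .
    qed
    then show "\<exists>no. \<forall>m\<ge>no. norm (secdist (X m) x0 - 0) < r"
      using l2inner_nonneg by (auto intro!: exI[of _ M])
  qed
qed

end

subsection \<open>Continuous test functions\<close>

lemma compact_supp_cont_interval:
  assumes "compact_supp_cont u"
  obtains r where "r > 0" "\<And>x. u x \<noteq> 0 \<Longrightarrow> -r \<le> x \<and> x \<le> r"
proof -
  obtain r where "r > 0" "\<And>x. u x \<noteq> 0 \<Longrightarrow> norm x \<le> r"
    using assms unfolding compact_supp_cont_def bounded_pos by blast
  then show ?thesis using that[of r] by (simp add: abs_le_iff minus_le_iff)
qed

lemma integrable_kernel_test:
  assumes S: "continuous_on UNIV (\<lambda>(x, y). S x y :: real)" and u: "compact_supp_cont u"
  shows "integrable (lborel \<Otimes>\<^sub>M lborel) (\<lambda>(x, y). S x y * u x * u y)"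
proof -
  obtain r where r: "r > 0" "\<And>x. u x \<noteq> 0 \<Longrightarrow> -r \<le> x \<and> x \<le> r" using compact_supp_cont_interval[OF u] by blast
  have uc: "continuous_on UNIV u" using u by (simp add: compact_supp_cont_def)
  have c: "continuous_on UNIV (\<lambda>p. (case p of (x, y) \<Rightarrow> S x y) * u (fst p) * u (snd p))"
    by (intro continuous_on_mult S continuous_on_compose2[OF uc] continuous_on_fst continuous_on_snd continuous_on_id) auto
  have "integrable lborel (\<lambda>p. indicator ({-r..r} \<times> {-r..r}) p *\<^sub>R ((case p of (x, y) \<Rightarrow> S x y) * u (fst p) * u (snd p)))"
    by (intro borel_integrable_compact compact_Times continuous_on_subset[OF c]) auto
  moreover have "(\<lambda>p. indicator ({-r..r} \<times> {-r..r}) p *\<^sub>R ((case p of (x, y) \<Rightarrow> S x y) * u (fst p) * u (snd p)))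
     = (\<lambda>(x, y). S x y * u x * u y)"
    by (intro ext) (auto simp: indicator_def dest: r(2))
  ultimately show ?thesis by (simp add: lborel_prod)
qed

lemma compact_supp_cont_sqint: assumes u: "compact_supp_cont u" shows "sqint u"
proof -
  obtain r where r: "r > 0" "\<And>x. u x \<noteq> 0 \<Longrightarrow> -r \<le> x \<and> x \<le> r" using compact_supp_cont_interval[OF u] by blast
  have uc: "continuous_on UNIV u" using u by (simp add: compact_supp_cont_def)
  have "integrable lborel (\<lambda>x. indicator {-r..r} x *\<^sub>R (u x)\<^sup>2)"
    by (intro borel_integrable_compact compact_Icc continuous_on_subset[OF continuous_on_power[OF uc]]) auto
  moreover have "(\<lambda>x. indicator {-r..r} x *\<^sub>R (u x)\<^sup>2) = (\<lambda>x. (u x)\<^sup>2)"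
    by (intro ext) (auto simp: indicator_def dest: r(2))
  moreover have "u \<in> borel_measurable borel" using uc by (rule borel_measurable_continuous_onI)
  ultimately show ?thesis by (simp add: sqint_def)
qed

lemma compact_supp_cont_integrable: assumes u: "compact_supp_cont u" shows "integrable lborel u"
proof -
  obtain r where r: "r > 0" "\<And>x. u x \<noteq> 0 \<Longrightarrow> -r \<le> x \<and> x \<le> r" using compact_supp_cont_interval[OF u] by blast
  have uc: "continuous_on UNIV u" using u by (simp add: compact_supp_cont_def)
  have "integrable lborel (\<lambda>x. indicator {-r..r} x *\<^sub>R u x)"
    by (intro borel_integrable_compact compact_Icc continuous_on_subset[OF uc]) auto
  moreover have "(\<lambda>x. indicator {-r..r} x *\<^sub>R u x) = u"
    by (intro ext) (auto simp: indicator_def dest: r(2))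
  ultimately show ?thesis by simp
qed

text \<open>The test functions are hats shrinking to the point \<open>a\<close>.\<close>
lemma diagonal_le:
  assumes S: "continuous_on UNIV (\<lambda>(x, y). S x y :: real)"
    and le: "\<And>u. compact_supp_cont u \<Longrightarrow> (\<And>x. 0 \<le> u x) \<Longrightarrow>
      (\<integral>x. (\<integral>y. S x y * u x * u y \<partial>lborel) \<partial>lborel) \<le> D * (\<integral>x. u x \<partial>lborel)\<^sup>2"
  shows "S a a \<le> D"
proof (rule ccontr)
  assume "\<not> S a a \<le> D"
  \<comment> \<open>Half the gap: D + e = S a a - e, so a deviation of less than e keeps S above D +
    e.\<close>
  define e where "e = (S a a - D) / 2"
  have e: "e > 0" using \<open>\<not> S a a \<le> D\<close> by (simp add: e_def)
  have "isCont (\<lambda>(x, y). S x y) (a, a)" using S by (simp add: continuous_on_eq_continuous_at)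
  then obtain d where d: "d > 0" "\<And>p. dist p (a, a) < d \<Longrightarrow> dist ((\<lambda>(x, y). S x y) p) (S a a) < e"
    using e unfolding continuous_at_eps_delta by (auto simp: dist_commute)
  \<comment> \<open>With half-width d / 2 in each variable, every pair of points of the support is
    within d of (a, a).\<close>
  define u where "u x = max 0 (d / 2 - \<bar>x - a\<bar>)" for x
  have u0: "0 \<le> u x" for x by (simp add: u_def)
  have uc: "compact_supp_cont u" unfolding compact_supp_cont_def
  proof
    show "continuous_on UNIV u" unfolding u_def by (intro continuous_intros)
    show "bounded {x. u x \<noteq> 0}"
    proof (rule bounded_subset[of "{a - d / 2..a + d / 2}"])
      show "{x. u x \<noteq> 0} \<subseteq> {a - d / 2..a + d / 2}"
      proof
        fix x assume "x \<in> {x. u x \<noteq> 0}"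
        then have "\<bar>x - a\<bar> < d / 2" by (auto simp: u_def max_def split: if_splits)
        then show "x \<in> {a - d / 2..a + d / 2}" unfolding abs_less_iff atLeastAtMost_iff by linarith
      qed
    qed simp
  qed
  note ui = compact_supp_cont_integrable[OF uc]
  let ?I = "\<integral>x. u x \<partial>lborel"
  \<comment> \<open>The hat is at least d / 4 on the middle half of its support, so its integral is
    positive; this strictness yields the contradiction at the end.\<close>
  have "(\<integral>x. d / 4 * indicat_real {a - d / 4..a + d / 4} x \<partial>lborel) \<le> ?I"
  proof (rule integral_mono[OF _ ui])
    show "integrable lborel (\<lambda>x. d / 4 * indicat_real {a - d / 4..a + d / 4} x)"
      by (intro integrable_mult_right integrable_real_indicator) (auto simp: emeasure_lborel_Icc_eq)
    show "d / 4 * indicat_real {a - d / 4..a + d / 4} x \<le> u x" for x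
      using d(1) by (auto simp: u_def indicator_def abs_if max_def)
  qed
  then have "d / 4 * (d / 2) \<le> ?I" using d(1) by simp
  then have Ipos: "?I > 0" using d(1) by (smt (verit) divide_pos_pos mult_pos_pos)
  have pt: "(D + e) * u x * u y \<le> S x y * u x * u y" for x y
  proof (cases "u x = 0 \<or> u y = 0")
    case False
    then have xy: "\<bar>x - a\<bar> < d / 2" "\<bar>y - a\<bar> < d / 2" by (auto simp: u_def max_def split: if_splits)
    have "dist (x, y) (a, a) \<le> \<bar>x - a\<bar> + \<bar>y - a\<bar>"
      by (simp add: dist_prod_def dist_real_def sqrt_sum_squares_le_sum_abs[THEN order_trans])
    also have "\<dots> < d" using xy by simp
    finally have "dist (S x y) (S a a) < e" using d(2)[of "(x, y)"] by simp
    then have "S a a - e < S x y" unfolding dist_real_def by linarith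
    moreover have "D + e = S a a - e" by (simp add: e_def field_simps)
    ultimately have "D + e \<le> S x y" by simp
    then show ?thesis using u0 by (intro mult_right_mono) auto
  qed auto
  have i1: "integrable (lborel \<Otimes>\<^sub>M lborel) (\<lambda>(x, y). (D + e) * u x * u y)"
    by (rule integrable_kernel_test[OF _ uc]) (simp add: case_prod_unfold)
  have i2: "integrable (lborel \<Otimes>\<^sub>M lborel) (\<lambda>(x, y). S x y * u x * u y)"
    by (rule integrable_kernel_test[OF S uc])
  have "(D + e) * ?I\<^sup>2 = (\<integral>x. (\<integral>y. (D + e) * u x * u y \<partial>lborel) \<partial>lborel)"
    by (simp add: power2_eq_square mult.assoc)
  also have "\<dots> = (\<integral>p. (case p of (x, y) \<Rightarrow> (D + e) * u x * u y) \<partial>(lborel \<Otimes>\<^sub>M lborel))"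
    using lborel_pair.integral_fst'[OF i1] by simp
  also have "\<dots> \<le> (\<integral>p. (case p of (x, y) \<Rightarrow> S x y * u x * u y) \<partial>(lborel \<Otimes>\<^sub>M lborel))"
    using i1 i2 by (rule integral_mono) (use pt in auto)
  also have "\<dots> = (\<integral>x. (\<integral>y. S x y * u x * u y \<partial>lborel) \<partial>lborel)"
    using lborel_pair.integral_fst'[OF i2] by simp
  also have "\<dots> \<le> D * ?I\<^sup>2" by (rule le[OF uc u0])
  finally show False using Ipos e by simp
qed

subsection \<open>Continuous kernels of spectral projections\<close>

context hankel_kernel
begin

abbreviation (input) "RR \<equiv> 4 * C + 1"

text \<open>By polarisation this is <g(H) (K x), K y>.\<close>

definition F :: "(real \<Rightarrow> real) \<Rightarrow> real \<Rightarrow> real \<Rightarrow> real" where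
  "F g x y = 1/4 * (Q g (\<lambda>z. 1 * K x z + 1 * K y z) - Q g (\<lambda>z. 1 * K x z + -1 * K y z))"

lemma F_continuous:
  assumes g: "bounded_borel_on RR g"
  shows "continuous_on UNIV (\<lambda>(x, y). F g x y)"
proof (rule continuous_on_sequentiallyI)
  fix P :: "nat \<Rightarrow> real \<times> real" and p
  assume P: "P \<longlonglongrightarrow> p"
  have X: "(\<lambda>n. fst (P n)) \<longlonglongrightarrow> fst p" and Y: "(\<lambda>n. snd (P n)) \<longlonglongrightarrow> snd p"
    by (rule tendsto_fst[OF P], rule tendsto_snd[OF P])
  let ?x = "fst p" and ?y = "snd p" and ?X = "\<lambda>n. fst (P n)" and ?Y = "\<lambda>n. snd (P n)"
  have main: "(\<lambda>n. Q g (\<lambda>z. 1 * K (?X n) z + c * K (?Y n) z)) \<longlonglongrightarrow> Q g (\<lambda>z. 1 * K ?x z + c * K ?y z)"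
    if c: "\<bar>c\<bar> = 1" for c
  proof (rule Q_continuous[OF _ _ g])
    show "sqint (\<lambda>z. 1 * K ?x z + c * K ?y z)" "sqint (\<lambda>z. 1 * K (?X n) z + c * K (?Y n) z)" for n
      by (intro sqint_lin sqint_K)+
    let ?v = "\<lambda>n z. (1 * K (?X n) z + c * K (?Y n) z) - (1 * K ?x z + c * K ?y z)"
    show "(\<lambda>n. l2inner (?v n) (?v n)) \<longlonglongrightarrow> 0"
    proof (rule tendsto_sandwich)
      show "\<forall>\<^sub>F n in sequentially. 0 \<le> l2inner (?v n) (?v n)" by (simp add: l2inner_nonneg)
      show "\<forall>\<^sub>F n in sequentially. l2inner (?v n) (?v n) \<le> 2 * (secdist (?X n) ?x + secdist (?Y n) ?y)"
      proof (rule always_eventually, rule allI)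
        fix n
        let ?a = "\<lambda>z. K (?X n) z - K ?x z" and ?b = "\<lambda>z. K (?Y n) z - K ?y z"
        have ab: "sqint ?a" "sqint ?b" using sqint_lin[OF sqint_K sqint_K, of 1 _ "-1"] by simp_all
        have v: "?v n = (\<lambda>z. 1 * ?a z + c * ?b z)" by (simp add: algebra_simps)
        \<comment> \<open>Adding this square to the one with +c gives |a + c b|^2 \<le> 2 (|a|^2 +
          |b|^2) whenever c^2 = 1.\<close>
        have "0 \<le> l2inner (\<lambda>z. 1 * ?a z + (- c) * ?b z) (\<lambda>z. 1 * ?a z + (- c) * ?b z)" by (rule l2inner_nonneg)
        moreover have "c\<^sup>2 = 1" using c by (simp add: abs_square_eq_1)
        ultimately show "l2inner (?v n) (?v n) \<le> 2 * (secdist (?X n) ?x + secdist (?Y n) ?y)"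
          unfolding v l2inner_quadratic[OF ab] by simp
      qed
      have "(\<lambda>n. 2 * (secdist (?X n) ?x + secdist (?Y n) ?y)) \<longlonglongrightarrow> 2 * (0 + 0)"
        by (intro tendsto_intros section_tendsto X Y)
      then show "(\<lambda>n. 2 * (secdist (?X n) ?x + secdist (?Y n) ?y)) \<longlonglongrightarrow> 0" by simp
    qed simp
  qed
  have "(\<lambda>n. F g (?X n) (?Y n)) \<longlonglongrightarrow> F g ?x ?y"
    unfolding F_def by (intro tendsto_mult_left tendsto_diff main) auto
  then show "(\<lambda>n. (case P n of (x, y) \<Rightarrow> F g x y)) \<longlonglongrightarrow> (case p of (x, y) \<Rightarrow> F g x y)"
    by (simp add: case_prod_unfold)
qed

text \<open>Pairing with \<open>K y\<close> is evaluation of \<open>hop h\<close> at y, which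
  accounts for the additional power.\<close>

lemma F_power: "F (\<lambda>l. l ^ k) x y = ((hop h) ^^ Suc k) (K x) y"
proof -
  have "F (\<lambda>l. l ^ k) x y = l2inner ((hop h ^^ k) (K x)) (K y)"
    unfolding F_def Q_power_lin[OF sqint_K sqint_K] by simp
  then show ?thesis by (simp add: hop_eq l2inner_commute)
qed

lemma F_lin:
  assumes "bounded_borel_on RR f" "bounded_borel_on RR g"
  shows "F (\<lambda>l. a * f l + b * g l) x y = a * F f x y + b * F g x y"
  unfolding F_def Q_lin[OF sqint_lin[OF sqint_K sqint_K] assms] by (simp add: algebra_simps)

lemma F_tendsto:
  assumes "\<And>n. bounded_borel_on RR (G n)" "bounded_borel_on RR f" "\<And>n l. l \<in> {-RR..RR} \<Longrightarrow> \<bar>G n l\<bar> \<le> c"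
    "\<And>l. l \<in> {-RR..RR} \<Longrightarrow> (\<lambda>n. G n l) \<longlonglongrightarrow> f l"
  shows "(\<lambda>n. F (G n) x y) \<longlonglongrightarrow> F f x y"
  unfolding F_def by (intro tendsto_mult_left tendsto_diff Q_tendsto[OF sqint_lin[OF sqint_K sqint_K] assms])

text \<open>The squared norm of K x + K y or K x - K y is at most 2 (4 C^2 + 4 C^2) = 16 C^2, and a
  quarter of two such terms remains.\<close>

lemma F_bound:
  assumes g: "bounded_borel_on RR g" and G: "\<And>l. l \<in> {-RR..RR} \<Longrightarrow> \<bar>g l\<bar> \<le> G"
  shows "\<bar>F g x y\<bar> \<le> 8 * G * C\<^sup>2"
proof -
  have G0: "G \<ge> 0" using G[of 0] C_nonneg by auto
  let ?p = "\<lambda>c z. 1 * K x z + c * K y z"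
  have b: "\<bar>Q g (?p c)\<bar> \<le> G * (16 * C\<^sup>2)" if c: "c\<^sup>2 = 1" for c
  proof -
    have "0 \<le> l2inner (?p (- c)) (?p (- c))" by (rule l2inner_nonneg)
    then have "l2inner (?p c) (?p c) \<le> 16 * C\<^sup>2"
      unfolding l2inner_quadratic[OF sqint_K sqint_K] using c norm_K[of x] norm_K[of y] by simp
    then have "G * l2inner (?p c) (?p c) \<le> G * (16 * C\<^sup>2)" using G0 by (rule mult_left_mono)
    with Q_bound[OF sqint_lin[OF sqint_K sqint_K] g G] show ?thesis by (rule order_trans) auto
  qed
  have "\<bar>F g x y\<bar> \<le> 1/4 * (\<bar>Q g (?p 1)\<bar> + \<bar>Q g (?p (-1))\<bar>)"
    unfolding F_def by (simp add: abs_mult)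
  also have "\<dots> \<le> 1/4 * (G * (16 * C\<^sup>2) + G * (16 * C\<^sup>2))"
    using b[of 1] b[of "-1"] by (intro mult_left_mono add_mono) auto
  finally show ?thesis by simp
qed

lemma bounded_borel_on_mult_square:
  assumes "bounded_borel_on RR g"
  shows "bounded_borel_on RR (\<lambda>l. g l * l\<^sup>2)"
proof -
  obtain c where c: "\<forall>l\<in>{-RR..RR}. \<bar>g l\<bar> \<le> c" and m: "g \<in> borel_measurable borel"
    using assms unfolding bounded_borel_on_def by blast
  show ?thesis
  proof (rule bounded_borel_onI[where c = "c * RR\<^sup>2"])
    show "(\<lambda>l. g l * l\<^sup>2) \<in> borel_measurable borel" using m by simp
    fix l assume l: "l \<in> {-RR..RR}"
    then have "l\<^sup>2 \<le> RR\<^sup>2" by (intro abs_le_square_iff[THEN iffD1]) auto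
    moreover have "0 \<le> \<bar>g l\<bar>" by simp
    moreover have "\<bar>g l\<bar> \<le> c" using c l by blast
    ultimately have "\<bar>g l\<bar> * l\<^sup>2 \<le> c * RR\<^sup>2" by (intro mult_mono) auto
    then show "\<bar>g l * l\<^sup>2\<bar> \<le> c * RR\<^sup>2" by (simp add: abs_mult)
  qed
qed

text \<open>\<open>F g\<close> is the integral kernel of \<open>H g(H) H\<close>; for powers \<open>g\<close> this is read off from
  \<open>\<langle>v, K y\<rangle> = (H v) y\<close>.\<close>
lemma F_kernel:
  assumes u: "compact_supp_cont u" and g: "bounded_borel_on RR g"
  shows "Q (\<lambda>l. g l * l\<^sup>2) u = (\<integral>x. (\<integral>y. F g x y * u x * u y \<partial>lborel) \<partial>lborel)"
proof -
  have us: "sqint u" using u by (rule compact_supp_cont_sqint)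
  have one: "bounded_borel_on RR (\<lambda>l. l ^ k)" for k by (intro bounded_borel_on_continuous continuous_intros)
  have i: "integrable (lborel \<Otimes>\<^sub>M lborel) (\<lambda>(x, y). F g x y * u x * u y)" if "bounded_borel_on RR g" for g
    by (rule integrable_kernel_test[OF F_continuous[OF that] u])
  have it: "(\<integral>p. (case p of (x, y) \<Rightarrow> F g x y * u x * u y) \<partial>(lborel \<Otimes>\<^sub>M lborel))
      = (\<integral>x. (\<integral>y. F g x y * u x * u y \<partial>lborel) \<partial>lborel)" if "bounded_borel_on RR g" for g
    using lborel_pair.integral_fst'[OF i[OF that]] by simp
  interpret mc: monotone_class_on RR "\<lambda>g. Q (\<lambda>l. g l * l\<^sup>2) u =
     (\<integral>p. (case p of (x, y) \<Rightarrow> F g x y * u x * u y) \<partial>(lborel \<Otimes>\<^sub>M lborel))"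
  proof
    fix k
    \<comment> \<open>Of the exponent k + 2, one unit comes from pairing with \<open>K y\<close> and
      one from pairing with \<open>K x\<close>, after symmetry has moved the powers onto
      \<open>u\<close>.\<close>
    have "(\<integral>y. F (\<lambda>l. l ^ k) x y * u x * u y \<partial>lborel) = (hop h ^^ (k + 2)) u x * u x" for x
    proof -
      have "(\<integral>y. F (\<lambda>l. l ^ k) x y * u x * u y \<partial>lborel) = (\<integral>y. u x * ((hop h ^^ Suc k) (K x) y * u y) \<partial>lborel)"
        unfolding F_power by (simp add: mult_ac)
      also have "\<dots> = u x * l2inner ((hop h ^^ Suc k) (K x)) u" by (simp add: l2inner_def)
      also have "\<dots> = u x * l2inner (K x) ((hop h ^^ Suc k) u)" using pow_sym[OF sqint_K us, of "Suc k"] by simp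
      also have "\<dots> = (hop h ^^ (k + 2)) u x * u x" by (simp add: hop_eq)
      finally show ?thesis .
    qed
    then have "(\<integral>p. (case p of (x, y) \<Rightarrow> F (\<lambda>l. l ^ k) x y * u x * u y) \<partial>(lborel \<Otimes>\<^sub>M lborel))
      = l2inner ((hop h ^^ (k + 2)) u) u"
      unfolding it[OF one] by (simp add: l2inner_def)
    also have "\<dots> = Q (\<lambda>l. l ^ (k + 2)) u" by (rule Q_power[OF us, symmetric])
    finally show "Q (\<lambda>l. l ^ k * l\<^sup>2) u =
        (\<integral>p. (case p of (x, y) \<Rightarrow> F (\<lambda>l. l ^ k) x y * u x * u y) \<partial>(lborel \<Otimes>\<^sub>M lborel))"
      unfolding power_add by simp
  next
    fix f g a b assume fg: "bounded_borel_on RR f" "bounded_borel_on RR g"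
      and e: "Q (\<lambda>l. f l * l\<^sup>2) u = (\<integral>p. (case p of (x, y) \<Rightarrow> F f x y * u x * u y) \<partial>(lborel \<Otimes>\<^sub>M lborel))"
        "Q (\<lambda>l. g l * l\<^sup>2) u = (\<integral>p. (case p of (x, y) \<Rightarrow> F g x y * u x * u y) \<partial>(lborel \<Otimes>\<^sub>M lborel))"
    have "Q (\<lambda>l. (a * f l + b * g l) * l\<^sup>2) u = Q (\<lambda>l. a * (f l * l\<^sup>2) + b * (g l * l\<^sup>2)) u"
      by (simp add: algebra_simps)
    also have "\<dots> = a * Q (\<lambda>l. f l * l\<^sup>2) u + b * Q (\<lambda>l. g l * l\<^sup>2) u"
      by (intro Q_lin us bounded_borel_on_mult_square fg)
    also have "\<dots> = (\<integral>p. a * (case p of (x, y) \<Rightarrow> F f x y * u x * u y) + b * (case p of (x, y) \<Rightarrow> F g x y * u x * u y) \<partial>(lborel \<Otimes>\<^sub>M lborel))"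
      unfolding e using i fg by simp
    also have "\<dots> = (\<integral>p. (case p of (x, y) \<Rightarrow> F (\<lambda>l. a * f l + b * g l) x y * u x * u y) \<partial>(lborel \<Otimes>\<^sub>M lborel))"
      by (rule Bochner_Integration.integral_cong) (auto simp: F_lin[OF fg] algebra_simps)
    finally show "Q (\<lambda>l. (a * f l + b * g l) * l\<^sup>2) u =
      (\<integral>p. (case p of (x, y) \<Rightarrow> F (\<lambda>l. a * f l + b * g l) x y * u x * u y) \<partial>(lborel \<Otimes>\<^sub>M lborel))" .
  next
    fix G f c
    assume a: "\<And>n. bounded_borel_on RR (G n)" "bounded_borel_on RR f" "\<And>n l. l \<in> {-RR..RR} \<Longrightarrow> \<bar>G n l\<bar> \<le> c"
      "\<And>l. l \<in> {-RR..RR} \<Longrightarrow> (\<lambda>n. G n l) \<longlonglongrightarrow> f l"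
      and e: "\<And>n. Q (\<lambda>l. G n l * l\<^sup>2) u = (\<integral>p. (case p of (x, y) \<Rightarrow> F (G n) x y * u x * u y) \<partial>(lborel \<Otimes>\<^sub>M lborel))"
    have "(\<lambda>n. Q (\<lambda>l. G n l * l\<^sup>2) u) \<longlonglongrightarrow> Q (\<lambda>l. f l * l\<^sup>2) u"
    proof (rule Q_tendsto[OF us, where c = "c * RR\<^sup>2"])
      fix n l assume l: "l \<in> {-RR..RR}"
      then have "l\<^sup>2 \<le> RR\<^sup>2" by (intro abs_le_square_iff[THEN iffD1]) auto
      then have "\<bar>G n l\<bar> * l\<^sup>2 \<le> c * RR\<^sup>2" using a(3)[OF l, of n] abs_ge_zero[of "G n l"]
        by (intro mult_mono) (auto simp del: abs_ge_zero)
      then show "\<bar>G n l * l\<^sup>2\<bar> \<le> c * RR\<^sup>2" by (simp add: abs_mult)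
    next
      fix l assume "l \<in> {-RR..RR}"
      then show "(\<lambda>n. G n l * l\<^sup>2) \<longlonglongrightarrow> f l * l\<^sup>2" by (intro tendsto_mult_right a(4))
    qed (intro bounded_borel_on_mult_square a)+
    moreover have "(\<lambda>n. \<integral>p. (case p of (x, y) \<Rightarrow> F (G n) x y * u x * u y) \<partial>(lborel \<Otimes>\<^sub>M lborel))
        \<longlonglongrightarrow> (\<integral>p. (case p of (x, y) \<Rightarrow> F f x y * u x * u y) \<partial>(lborel \<Otimes>\<^sub>M lborel))"
    \<comment> \<open>The kernels obey a bound uniform in n, x and y, and the integrable function |u
      x u y| supplies the decay.\<close>
    proof (rule integral_dominated_convergence[where w = "\<lambda>p. 8 * c * C\<^sup>2 * \<bar>case p of (x, y) \<Rightarrow> 1 * u x * u y\<bar>"])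
      show "(\<lambda>p. case p of (x, y) \<Rightarrow> F f x y * u x * u y) \<in> borel_measurable (lborel \<Otimes>\<^sub>M lborel)"
        "(\<lambda>p. case p of (x, y) \<Rightarrow> F (G n) x y * u x * u y) \<in> borel_measurable (lborel \<Otimes>\<^sub>M lborel)" for n
        using i[OF a(1)] i[OF a(2)] by (blast intro: borel_measurable_integrable)+
      have "integrable (lborel \<Otimes>\<^sub>M lborel) (\<lambda>(x, y). 1 * u x * u y)"
        by (rule integrable_kernel_test[OF _ u]) (simp add: case_prod_unfold)
      then show "integrable (lborel \<Otimes>\<^sub>M lborel) (\<lambda>p. 8 * c * C\<^sup>2 * \<bar>case p of (x, y) \<Rightarrow> 1 * u x * u y\<bar>)"
        by (intro integrable_mult_right integrable_abs)
      show "AE p in lborel \<Otimes>\<^sub>M lborel. (\<lambda>n. case p of (x, y) \<Rightarrow> F (G n) x y * u x * u y)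
          \<longlonglongrightarrow> (case p of (x, y) \<Rightarrow> F f x y * u x * u y)"
        by (rule AE_I2) (auto intro!: tendsto_mult_right F_tendsto[OF a])
      show "AE p in lborel \<Otimes>\<^sub>M lborel. norm (case p of (x, y) \<Rightarrow> F (G n) x y * u x * u y)
          \<le> 8 * c * C\<^sup>2 * \<bar>case p of (x, y) \<Rightarrow> 1 * u x * u y\<bar>" for n
      proof (rule AE_I2, clarify)
        fix x y
        have "\<bar>F (G n) x y\<bar> * \<bar>u x * u y\<bar> \<le> 8 * c * C\<^sup>2 * \<bar>u x * u y\<bar>"
          by (intro mult_right_mono F_bound[OF a(1,3)]) auto
        then show "norm (F (G n) x y * u x * u y) \<le> 8 * c * C\<^sup>2 * \<bar>1 * u x * u y\<bar>"
          by (simp add: abs_mult mult.assoc)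
      qed
    qed
    ultimately show "Q (\<lambda>l. f l * l\<^sup>2) u = (\<integral>p. (case p of (x, y) \<Rightarrow> F f x y * u x * u y) \<partial>(lborel \<Otimes>\<^sub>M lborel))"
      unfolding e by (rule LIMSEQ_unique)
  qed
  show ?thesis using mc.bounded_borel[OF g] unfolding it[OF g] .
qed

end

section \<open>The density of states as a functional of the diagonal of a kernel\<close>

definition diag_mean :: "bool \<Rightarrow> real \<Rightarrow> (real \<Rightarrow> real) \<Rightarrow> real" where
  "diag_mean disc \<tau> f = (if disc then (1 / \<tau>) * integral {0..\<tau>} f else f 0)"

lemma diag_mean_sum:
  assumes "finite V" "\<And>i. i \<in> V \<Longrightarrow> continuous_on UNIV (f i)"
  shows "diag_mean disc \<tau> (\<lambda>x. \<Sum>i\<in>V. c i * f i x) = (\<Sum>i\<in>V. c i * diag_mean disc \<tau> (f i))"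
proof -
  have "integral {0..\<tau>} (\<lambda>x. \<Sum>i\<in>V. c i * f i x) = (\<Sum>i\<in>V. c i * integral {0..\<tau>} (f i))"
  proof (subst integral_sum)
    fix i assume "i \<in> V"
    then have "continuous_on {0..\<tau>} (f i)" using assms(2) continuous_on_subset by blast
    then show "(\<lambda>x. c i * f i x) integrable_on {0..\<tau>}"
      by (intro integrable_continuous_real continuous_intros)
  qed (use assms(1) in auto)
  then show ?thesis by (simp add: diag_mean_def sum_divide_distrib mult_ac)
qed

lemma diag_mean_le:
  assumes "continuous_on UNIV f" "\<And>x. f x \<le> D" "\<tau> > 0"
  shows "diag_mean disc \<tau> f \<le> D"
proof (cases disc)
  case True
  have "integral {0..\<tau>} f \<le> integral {0..\<tau>} (\<lambda>x. D)"
    by (rule integral_le) (use assms in \<open>auto intro!: integrable_continuous_real intro: continuous_on_subset\<close>)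
  then show ?thesis using assms(3) True by (simp add: diag_mean_def field_simps)
qed (use assms in \<open>simp add: diag_mean_def\<close>)

context hankel_kernel
begin

lemma F_diag_continuous: "bounded_borel_on RR g \<Longrightarrow> continuous_on UNIV (\<lambda>x. F g x x)"
  using continuous_on_compose2[OF F_continuous[of g] continuous_on_Pair[OF continuous_on_id continuous_on_id]]
  by simp

lemma F_sum:
  assumes "finite V" "\<And>i. i \<in> V \<Longrightarrow> bounded_borel_on RR (g i)"
  shows "bounded_borel_on RR (\<lambda>l. \<Sum>i\<in>V. c i * g i l) \<and> F (\<lambda>l. \<Sum>i\<in>V. c i * g i l) x y = (\<Sum>i\<in>V. c i * F (g i) x y)"
  using assms
proof (induction V)
  case empty
  have z: "bounded_borel_on RR (\<lambda>l. 0)" by (rule bounded_borel_onI[where c = 0]) auto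
  show ?case using z F_lin[OF z z, of 0 0 x y] by simp
next
  case (insert i V)
  have 1: "bounded_borel_on RR (g i)" and 2: "bounded_borel_on RR (\<lambda>l. \<Sum>i\<in>V. c i * g i l)" using insert by auto
  have 3: "(\<lambda>l. \<Sum>i\<in>insert i V. c i * g i l) = (\<lambda>l. c i * g i l + 1 * (\<Sum>i\<in>V. c i * g i l))"
    using insert by simp
  have "bounded_borel_on RR (\<lambda>l. \<Sum>i\<in>insert i V. c i * g i l)" unfolding 3 by (rule bounded_borel_on_lin[OF 1 2])
  moreover have "F (\<lambda>l. \<Sum>i\<in>insert i V. c i * g i l) x y = (\<Sum>i\<in>insert i V. c i * F (g i) x y)"
    unfolding 3 F_lin[OF 1 2] using insert by simp
  ultimately show ?case ..
qed

lemma F_diag_le: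
  assumes g: "bounded_borel_on RR g"
    and le: "\<And>u. compact_supp_cont u \<Longrightarrow> (\<And>x. 0 \<le> u x) \<Longrightarrow> Q (\<lambda>l. g l * l\<^sup>2) u \<le> D * (\<integral>x. u x \<partial>lborel)\<^sup>2"
  shows "F g a a \<le> D"
proof (rule diagonal_le[OF F_continuous[OF g]])
  fix u assume u: "compact_supp_cont u" "\<And>x. 0 \<le> u x"
  show "(\<integral>x. (\<integral>y. F g x y * u x * u y \<partial>lborel) \<partial>lborel) \<le> D * (\<integral>x. u x \<partial>lborel)\<^sup>2"
    using le[OF u] unfolding F_kernel[OF u(1) g] .
qed

text \<open>The function g with H g(H) H equal to the spectral projection. At 0 its value is 0, by
  the convention on division.\<close>

abbreviation cut :: "real set \<Rightarrow> real \<Rightarrow> real" where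
  "cut \<Delta> \<equiv> \<lambda>l. indicat_real \<Delta> l / l\<^sup>2"

lemma bounded_borel_on_indicator: "\<Delta> \<in> sets borel \<Longrightarrow> bounded_borel_on RR (indicat_real \<Delta>)"
  by (rule bounded_borel_onI[where c = 1]) (auto simp: indicator_def)

lemma bounded_borel_on_cut:
  assumes [measurable]: "\<Delta> \<in> sets borel" and sep: "separated_from_0 \<Delta>"
  shows "bounded_borel_on RR (cut \<Delta>)"
proof -
  obtain e where e: "e > 0" "\<And>l. l \<in> \<Delta> \<Longrightarrow> e \<le> \<bar>l\<bar>" using sep unfolding separated_from_0_def by blast
  show ?thesis
  proof (rule bounded_borel_onI[where c = "1 / e\<^sup>2"])
    fix l
    show "\<bar>cut \<Delta> l\<bar> \<le> 1 / e\<^sup>2"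
    proof (cases "l \<in> \<Delta>")
      case True
      then have "e\<^sup>2 \<le> l\<^sup>2" using e by (intro abs_le_square_iff[THEN iffD1]) auto
      moreover have "l \<noteq> 0" using e(1) e(2)[OF True] by auto
      ultimately show ?thesis using True e(1) by (auto intro!: divide_left_mono mult_pos_pos)
    qed simp
  qed measurable
qed

lemma cut_mult: "separated_from_0 \<Delta> \<Longrightarrow> cut \<Delta> l * l\<^sup>2 = indicat_real \<Delta> l"
  by (auto simp: separated_from_0_def indicator_def)

lemma spec_kernel_cut:
  assumes \<Delta>: "\<Delta> \<in> sets borel" and sep: "separated_from_0 \<Delta>"
  shows "spec_kernel h \<Delta> (F (cut \<Delta>))"
  unfolding spec_kernel_def
proof (intro conjI allI impI)
  note g = bounded_borel_on_cut[OF \<Delta> sep]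
  show "continuous_on UNIV (\<lambda>(x, y). F (cut \<Delta>) x y)" by (rule F_continuous[OF g])
  fix u assume u: "compact_supp_cont u"
  have sp: "op_spec (hop h) u (spm u)" by (rule spm[OF compact_supp_cont_sqint[OF u]])
  then have "\<Delta> \<in> sets (spm u)" "space (spm u) = UNIV"
    using \<Delta> sets_eq_imp_space_eq[of "spm u" borel] by (auto simp: op_spec_def)
  then have "measure (spm u) \<Delta> = Q (indicat_real \<Delta>) u" by (simp add: Q_def)
  also have "\<dots> = Q (\<lambda>l. cut \<Delta> l * l\<^sup>2) u" unfolding cut_mult[OF sep] ..
  also have "\<dots> = (\<integral>x. (\<integral>y. F (cut \<Delta>) x y * u x * u y \<partial>lborel) \<partial>lborel)" by (rule F_kernel[OF u g])
  finally show "\<exists>\<mu>. is_spec_meas h u \<mu> \<and>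
      measure \<mu> \<Delta> = (\<integral>x. (\<integral>y. F (cut \<Delta>) x y * u x * u y \<partial>lborel) \<partial>lborel)"
    using sp by (auto simp: is_spec_meas_iff)
qed

text \<open>\<open>spec_kernel\<close> refers to some spectral measure for each test function;
  uniqueness of the spectral integrals makes the form the same for every admissible kernel.\<close>

lemma spec_kernel_quadratic_form:
  assumes k: "spec_kernel h \<Delta> k" and \<Delta>: "\<Delta> \<in> sets borel" and u: "compact_supp_cont u"
  shows "(\<integral>x. (\<integral>y. k x y * u x * u y \<partial>lborel) \<partial>lborel) = Q (indicat_real \<Delta>) u"
proof -
  have us: "sqint u" by (rule compact_supp_cont_sqint[OF u])
  obtain \<mu> where \<mu>: "op_spec (hop h) u \<mu>"
    and m: "measure \<mu> \<Delta> = (\<integral>x. (\<integral>y. k x y * u x * u y \<partial>lborel) \<partial>lborel)"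
    using k u unfolding spec_kernel_def is_spec_meas_iff by blast
  have "\<Delta> \<in> sets \<mu>" "space \<mu> = UNIV"
    using \<mu> \<Delta> sets_eq_imp_space_eq[of \<mu> borel] by (auto simp: op_spec_def)
  then have "measure \<mu> \<Delta> = (\<integral>l. indicat_real \<Delta> l \<partial>\<mu>)" by simp
  also have "\<dots> = Q (indicat_real \<Delta>) u"
    unfolding Q_def by (rule spec_unique[OF us \<mu> spm[OF us] bounded_borel_on_indicator[OF \<Delta>]])
  finally show ?thesis using m by simp
qed

text \<open>The difference of two admissible kernels has vanishing quadratic form, so its diagonal
  is at most 0. Exchanging the kernels gives equality. Off the diagonal they may differ, since an
  antisymmetric part is invisible to the form.\<close>

lemma spec_kernel_diag_le:
  assumes k: "spec_kernel h \<Delta> k" and k': "spec_kernel h \<Delta> k'" and \<Delta>: "\<Delta> \<in> sets borel"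
  shows "k a a \<le> k' a a"
proof -
  have c: "continuous_on UNIV (\<lambda>(x, y). k x y)" "continuous_on UNIV (\<lambda>(x, y). k' x y)"
    using k k' by (auto simp: spec_kernel_def)
  have "k a a - k' a a \<le> 0"
  proof (rule diagonal_le[where S = "\<lambda>x y. k x y - k' x y" and D = 0])
    show "continuous_on UNIV (\<lambda>(x, y). k x y - k' x y)"
      using continuous_on_diff[OF c] by (simp add: case_prod_unfold)
    fix u assume u: "compact_supp_cont u"
    note i = integrable_kernel_test[OF c(1) u] integrable_kernel_test[OF c(2) u]
      integrable_kernel_test[OF \<open>continuous_on UNIV (\<lambda>(x, y). k x y - k' x y)\<close> u]
    note it = i[THEN lborel_pair.integral_fst', symmetric, simplified]
    have "(\<integral>x. (\<integral>y. (k x y - k' x y) * u x * u y \<partial>lborel) \<partial>lborel)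
      = (\<integral>p. (case p of (x, y) \<Rightarrow> k x y * u x * u y) - (case p of (x, y) \<Rightarrow> k' x y * u x * u y) \<partial>(lborel \<Otimes>\<^sub>M lborel))"
      unfolding it(3)[symmetric] by (rule Bochner_Integration.integral_cong) (auto simp: algebra_simps)
    also have "\<dots> = (\<integral>x. (\<integral>y. k x y * u x * u y \<partial>lborel) \<partial>lborel) - (\<integral>x. (\<integral>y. k' x y * u x * u y \<partial>lborel) \<partial>lborel)"
      unfolding Bochner_Integration.integral_diff[OF i(1,2)]
      using lborel_pair.integral_fst'[OF i(1)] lborel_pair.integral_fst'[OF i(2)] by simp
    also have "\<dots> = 0" by (simp add: spec_kernel_quadratic_form[OF k \<Delta> u] spec_kernel_quadratic_form[OF k' \<Delta> u])
    finally show "(\<integral>x. (\<integral>y. (k x y - k' x y) * u x * u y \<partial>lborel) \<partial>lborel) \<le> 0 * (\<integral>x. u x \<partial>lborel)\<^sup>2" by simp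
  qed
  then show ?thesis by simp
qed

text \<open>The definite description is legitimate because the kernel built from \<open>cut\<close>
  is admissible and every other admissible one has the same diagonal.\<close>

lemma ids_density_eq:
  assumes \<Delta>: "\<Delta> \<in> sets borel" and sep: "separated_from_0 \<Delta>"
  shows "ids_density disc \<tau> h \<Delta> = diag_mean disc \<tau> (\<lambda>x. F (cut \<Delta>) x x)"
proof -
  note k0 = spec_kernel_cut[OF \<Delta> sep]
  have "(\<lambda>x. k x x) = (\<lambda>x. F (cut \<Delta>) x x)" if "spec_kernel h \<Delta> k" for k
    using spec_kernel_diag_le[OF that k0 \<Delta>] spec_kernel_diag_le[OF k0 that \<Delta>] by (auto intro: antisym)
  then have *: "(\<exists>k. spec_kernel h \<Delta> k \<and> c = diag_mean disc \<tau> (\<lambda>x. k x x)) \<longleftrightarrow> c = diag_mean disc \<tau> (\<lambda>x. F (cut \<Delta>) x x)" for c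
    using k0 by metis
  have "ids_density disc \<tau> h \<Delta> = (THE c. \<exists>k. spec_kernel h \<Delta> k \<and> c = diag_mean disc \<tau> (\<lambda>x. k x x))"
    by (simp add: ids_density_def diag_mean_def)
  then show ?thesis unfolding * by simp
qed

lemma ids_density_nonneg:
  assumes \<Delta>: "\<Delta> \<in> sets borel" and sep: "separated_from_0 \<Delta>" and \<tau>: "\<tau> > 0"
  shows "0 \<le> ids_density disc \<tau> h \<Delta>"
proof -
  note g = bounded_borel_on_cut[OF \<Delta> sep]
  \<comment> \<open>The comparison with test functions bounds diagonals from above only, so it is
    applied to the negative kernel, written as a combination that \<open>F_lin\<close>
    accepts.\<close>
  have F: "F (\<lambda>l. -1 * cut \<Delta> l + 0 * cut \<Delta> l) x x = - F (cut \<Delta>) x x" for x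
    unfolding F_lin[OF g g] by simp
  have "F (\<lambda>l. -1 * cut \<Delta> l + 0 * cut \<Delta> l) x x \<le> 0" for x
  proof (rule F_diag_le[OF bounded_borel_on_lin[OF g g]])
    fix u assume u: "compact_supp_cont u"
    have us: "sqint u" by (rule compact_supp_cont_sqint[OF u])
    have "Q (\<lambda>l. (-1 * cut \<Delta> l + 0 * cut \<Delta> l) * l\<^sup>2) u = (\<integral>l. - (cut \<Delta> l * l\<^sup>2) \<partial>spm u)"
      unfolding Q_def by (simp add: algebra_simps)
    also have "\<dots> = - (\<integral>l. cut \<Delta> l * l\<^sup>2 \<partial>spm u)" by (rule Bochner_Integration.integral_minus)
    also have "\<dots> \<le> 0" by (simp add: cut_mult[OF sep] integral_nonneg_AE)
    finally show "Q (\<lambda>l. (-1 * cut \<Delta> l + 0 * cut \<Delta> l) * l\<^sup>2) u \<le> 0 * (\<integral>x. u x \<partial>lborel)\<^sup>2" by simp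
  qed
  then have p: "0 \<le> F (cut \<Delta>) x x" for x unfolding F by simp
  have "diag_mean disc \<tau> (\<lambda>x. F (cut \<Delta>) x x) \<ge> 0"
  proof (cases disc)
    case True
    have "0 \<le> integral {0..\<tau>} (\<lambda>x. F (cut \<Delta>) x x)"
      by (intro integral_nonneg integrable_continuous_real continuous_on_subset[OF F_diag_continuous[OF g]] p) auto
    then show ?thesis using True \<tau> by (simp add: diag_mean_def)
  qed (simp add: diag_mean_def p)
  then show ?thesis unfolding ids_density_eq[OF \<Delta> sep] .
qed

text \<open>Linearity on the diagonal reduces the density of a simple function to a pointwise
  estimate of a single kernel.\<close>

lemma ids_density_sum_le:
  fixes c :: "'i \<Rightarrow> real"
  assumes V: "finite V" and \<Delta>: "\<And>i. i \<in> V \<Longrightarrow> \<Delta> i \<in> sets borel \<and> separated_from_0 (\<Delta> i)" and \<tau>: "\<tau> > 0"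
    and le: "\<And>x. F (\<lambda>l. \<Sum>i\<in>V. c i * cut (\<Delta> i) l) x x \<le> D"
  shows "(\<Sum>i\<in>V. c i * ids_density disc \<tau> h (\<Delta> i)) \<le> D"
proof -
  have g: "bounded_borel_on RR (cut (\<Delta> i))" if "i \<in> V" for i using bounded_borel_on_cut \<Delta>[OF that] by blast
  have "(\<Sum>i\<in>V. c i * ids_density disc \<tau> h (\<Delta> i)) = (\<Sum>i\<in>V. c i * diag_mean disc \<tau> (\<lambda>x. F (cut (\<Delta> i)) x x))"
    by (intro sum.cong refl) (use \<Delta> ids_density_eq in auto)
  also have "\<dots> = diag_mean disc \<tau> (\<lambda>x. \<Sum>i\<in>V. c i * F (cut (\<Delta> i)) x x)"
    by (rule diag_mean_sum[symmetric]) (use V g F_diag_continuous in auto)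
  also have "\<dots> \<le> D"
  proof (rule diag_mean_le[OF _ _ \<tau>])
    show "continuous_on UNIV (\<lambda>x. \<Sum>i\<in>V. c i * F (cut (\<Delta> i)) x x)"
      by (intro continuous_intros F_diag_continuous g)
    show "(\<Sum>i\<in>V. c i * F (cut (\<Delta> i)) x x) \<le> D" for x
      using le[of x] F_sum[of V "\<lambda>i. cut (\<Delta> i)" c x x, OF V g] by simp
  qed
  finally show ?thesis .
qed

text \<open>Division by l^2 turns the hypothesis into 0 \<le> g \<le> 1, so the uniform kernel bound
  applies with G = 1, whatever the sets are.\<close>

lemma ids_density_square_le:
  fixes c :: "'i \<Rightarrow> real"
  assumes V: "finite V" and \<Delta>: "\<And>i. i \<in> V \<Longrightarrow> \<Delta> i \<in> sets borel \<and> separated_from_0 (\<Delta> i)" and \<tau>: "\<tau> > 0"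
    and c: "\<And>i. i \<in> V \<Longrightarrow> 0 \<le> c i" and le: "\<And>l. (\<Sum>i\<in>V. c i * indicat_real (\<Delta> i) l) \<le> l\<^sup>2"
  shows "(\<Sum>i\<in>V. c i * ids_density disc \<tau> h (\<Delta> i)) \<le> 8 * C\<^sup>2"
proof (rule ids_density_sum_le[OF V \<Delta> \<tau>])
  fix x
  let ?g = "\<lambda>l. \<Sum>i\<in>V. c i * cut (\<Delta> i) l"
  have g: "bounded_borel_on RR (cut (\<Delta> i))" if "i \<in> V" for i using bounded_borel_on_cut \<Delta>[OF that] by blast
  have "\<bar>?g l\<bar> \<le> 1" for l
  proof -
    have "?g l = (\<Sum>i\<in>V. c i * indicat_real (\<Delta> i) l) / l\<^sup>2" by (simp add: sum_divide_distrib)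
    moreover have "0 \<le> (\<Sum>i\<in>V. c i * indicat_real (\<Delta> i) l)" using c by (intro sum_nonneg mult_nonneg_nonneg) auto
    ultimately show ?thesis using le[of l] by (cases "l = 0") (simp_all add: divide_le_eq)
  qed
  then have "\<bar>F ?g x x\<bar> \<le> 8 * 1 * C\<^sup>2" using F_sum[of V "\<lambda>i. cut (\<Delta> i)" c x x, OF V g] by (intro F_bound) auto
  then show "F ?g x x \<le> 8 * C\<^sup>2" by simp
qed auto

lemma ids_density_abs_le:
  fixes c :: "'i \<Rightarrow> real"
  assumes V: "finite V" and \<Delta>: "\<And>i. i \<in> V \<Longrightarrow> \<Delta> i \<in> sets borel \<and> separated_from_0 (\<Delta> i)" and \<tau>: "\<tau> > 0"
    and le: "\<And>l. (\<Sum>i\<in>V. c i * indicat_real (\<Delta> i) l) \<le> \<bar>l\<bar>" and psd: "psd_hankel h"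
  shows "(\<Sum>i\<in>V. c i * ids_density disc \<tau> h (\<Delta> i)) \<le> C"
proof (rule ids_density_sum_le[OF V \<Delta> \<tau>])
  fix x
  let ?g = "\<lambda>l. \<Sum>i\<in>V. c i * cut (\<Delta> i) l" and ?s = "\<lambda>l. \<Sum>i\<in>V. c i * indicat_real (\<Delta> i) l"
  have g: "bounded_borel_on RR (cut (\<Delta> i))" if "i \<in> V" for i using bounded_borel_on_cut \<Delta>[OF that] by blast
  have gs: "(\<lambda>l. ?g l * l\<^sup>2) = ?s"
    using cut_mult \<Delta> unfolding sum_distrib_right mult.assoc by (intro ext sum.cong refl) auto
  have bg: "bounded_borel_on RR ?g" using F_sum[of V "\<lambda>i. cut (\<Delta> i)" c x x, OF V g] by blast
  have bs: "bounded_borel_on RR ?s" using bounded_borel_on_mult_square[OF bg] unfolding gs .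
  show "F ?g x x \<le> C"
  proof (rule F_diag_le[OF bg])
    fix u assume u: "compact_supp_cont u" and u0: "\<And>x. 0 \<le> u x"
    have us: "sqint u" by (rule compact_supp_cont_sqint[OF u])
    note ui = compact_supp_cont_integrable[OF u]
    \<comment> \<open>Positivity permits the lower spectral bound 0. On the support of this measure
      |l| = l, so the simple function is dominated by the first moment <H u, u>.\<close>
    obtain \<mu> where \<mu>: "op_spec (hop h) u \<mu>" and pos: "AE l in \<mu>. l \<in> {0..RR}"
      using op_spec_exists[of 0 RR u, OF _ us] psd bound C_nonneg unfolding psd_hankel_def
      by (auto simp: abs_le_iff)
    have "Q ?s u = (\<integral>l. ?s l \<partial>\<mu>)" unfolding Q_def by (rule spec_unique[OF us spm[OF us] \<mu> bs])
    also have "\<dots> \<le> (\<integral>l. l ^ 1 \<partial>\<mu>)"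
    proof (rule integral_mono_AE)
      show "integrable \<mu> ?s" by (rule integrable_spec[OF us \<mu> bs])
      show "integrable \<mu> (\<lambda>l. l ^ 1)" using \<mu> unfolding op_spec_def by blast
      show "AE l in \<mu>. ?s l \<le> l ^ 1" using pos
      proof eventually_elim
        case (elim l)
        then show ?case using le[of l] by simp
      qed
    qed
    also have "\<dots> = l2inner ((hop h ^^ 1) u) u" using \<mu> unfolding op_spec_def by blast
    also have "\<dots> = (\<integral>x. hop h u x * u x \<partial>lborel)" by (simp add: l2inner_def)
    \<comment> \<open>Here the test function must be nonnegative: K \<le> C then bounds the form by
      C times the squared integral of \<open>u\<close>.\<close>
    also have "\<dots> \<le> (\<integral>x. C * (\<integral>y. u y \<partial>lborel) * u x \<partial>lborel)"
    proof (rule integral_mono)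
      show "integrable lborel (\<lambda>x. hop h u x * u x)" by (rule sqint_integrable_mult[OF sq[OF us] us])
      show "integrable lborel (\<lambda>x. C * (\<integral>y. u y \<partial>lborel) * u x)" using ui by simp
      fix x
      have "hop h u x \<le> (\<integral>y. C * u y \<partial>lborel)"
        unfolding hop_def
      proof (rule integral_mono)
        show "integrable lborel (\<lambda>y. K x y * u y)" by (rule sqint_integrable_mult[OF sqint_K us])
        show "K x y * u y \<le> C * u y" for y
          using K_le_const[of x y] u0 by (intro mult_right_mono) auto
      qed (use ui in simp)
      then show "hop h u x * u x \<le> C * (\<integral>y. u y \<partial>lborel) * u x" using u0 by (intro mult_right_mono) auto
    qed
    also have "\<dots> = C * (\<integral>x. u x \<partial>lborel)\<^sup>2" by (simp add: power2_eq_square)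
    finally show "Q (\<lambda>l. ?g l * l\<^sup>2) u \<le> C * (\<integral>x. u x \<partial>lborel)\<^sup>2" unfolding gs .
  qed
qed auto

end

subsection \<open>Integration against the density of states\<close>

text \<open>The Lebesgue integral of nonnegative functions is a lower integral, so it is superadditive without any
  measurability; this is what makes the measurability of the densities irrelevant.\<close>
lemma nn_integral_superadditive:
  "(\<integral>\<^sup>+x. f x \<partial>M) + (\<integral>\<^sup>+x. g x \<partial>M) \<le> (\<integral>\<^sup>+x. f x + g x \<partial>M)"
proof -
  let ?S = "\<lambda>f. {s. simple_function M s \<and> s \<le> f}"
  have ne: "?S f \<noteq> {}" for f :: "'a \<Rightarrow> ennreal"
    by (auto intro!: exI[of _ "\<lambda>x. 0"] simp: le_fun_def)
  have le: "integral\<^sup>S M s + integral\<^sup>S M t \<le> (\<integral>\<^sup>+x. f x + g x \<partial>M)" if "s \<in> ?S f" "t \<in> ?S g" for s t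
  proof -
    have "integral\<^sup>S M s + integral\<^sup>S M t = (\<integral>\<^sup>Sx. s x + t x \<partial>M)"
      using that by (intro simple_integral_add[symmetric]) auto
    also have "\<dots> \<le> (\<integral>\<^sup>+x. f x + g x \<partial>M)"
      unfolding nn_integral_def using that by (intro SUP_upper) (auto simp: le_fun_def intro: add_mono)
    finally show ?thesis .
  qed
  have "(\<integral>\<^sup>+x. f x \<partial>M) + integral\<^sup>S M t \<le> (\<integral>\<^sup>+x. f x + g x \<partial>M)" if "t \<in> ?S g" for t
    unfolding nn_integral_def[of M f] ennreal_SUP_add_left[OF ne, symmetric] by (rule SUP_least) (rule le[OF _ that])
  then have "(SUP t\<in>?S g. (\<integral>\<^sup>+x. f x \<partial>M) + integral\<^sup>S M t) \<le> (\<integral>\<^sup>+x. f x + g x \<partial>M)"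
    by (rule SUP_least)
  then show ?thesis
    unfolding nn_integral_def[of M g] ennreal_SUP_add_right[OF ne] .
qed

lemma nn_integral_cmult_le: "c * (\<integral>\<^sup>+x. f x \<partial>M) \<le> (\<integral>\<^sup>+x. c * f x \<partial>M)"
  unfolding nn_integral_def[of M f] SUP_mult_left_ennreal
proof (rule SUP_least)
  fix s assume s: "s \<in> {s. simple_function M s \<and> s \<le> f}"
  then have "c * integral\<^sup>S M s = (\<integral>\<^sup>Sx. c * s x \<partial>M)" by (intro simple_integral_mult[symmetric]) auto
  also have "\<dots> \<le> (\<integral>\<^sup>+x. c * f x \<partial>M)"
    unfolding nn_integral_def using s by (intro SUP_upper) (auto simp: le_fun_def intro: mult_left_mono)
  finally show "c * integral\<^sup>S M s \<le> (\<integral>\<^sup>+x. c * f x \<partial>M)" .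
qed

lemma nn_integral_sum_superadditive:
  "finite V \<Longrightarrow> (\<Sum>i\<in>V. c i * (\<integral>\<^sup>+x. f i x \<partial>M)) \<le> (\<integral>\<^sup>+x. (\<Sum>i\<in>V. c i * f i x) \<partial>M)"
proof (induction V rule: finite_induct)
  case (insert i V)
  then show ?case
    using order_trans[OF add_mono[OF nn_integral_cmult_le insert(3)] nn_integral_superadditive] by simp
qed simp

text \<open>A simple function below \<open>\<phi>\<close> has its positive level sets separated from \<open>0\<close>.\<close>
lemma IDS_integral_le:
  fixes M :: "'a measure" and \<phi> :: "real \<Rightarrow> real"
  assumes M: "prob_space M" and ids: "is_IDS_measure M disc \<tau> h \<nu>"
    and \<phi>0: "\<And>l. 0 \<le> \<phi> l"
    and sep: "\<And>c. c > 0 \<Longrightarrow> separated_from_0 {l. c \<le> \<phi> l}"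
    and nonneg: "AE \<omega> in M. \<forall>\<Delta>. \<Delta> \<in> sets borel \<longrightarrow> separated_from_0 \<Delta> \<longrightarrow> 0 \<le> ids_density disc \<tau> (h \<omega>) \<Delta>"
    and le: "AE \<omega> in M. \<forall>(V :: ennreal set) \<Delta> c. finite V \<longrightarrow>
        (\<forall>i\<in>V. \<Delta> i \<in> sets borel \<and> separated_from_0 (\<Delta> i)) \<longrightarrow> (\<forall>i\<in>V. 0 \<le> c i) \<longrightarrow>
        (\<forall>l. (\<Sum>i\<in>V. c i * indicat_real (\<Delta> i) l) \<le> \<phi> l) \<longrightarrow>
        (\<Sum>i\<in>V. c i * ids_density disc \<tau> (h \<omega>) (\<Delta> i)) \<le> D"
  shows "(\<integral>\<^sup>+l. ennreal (\<phi> l) \<partial>\<nu>) \<le> ennreal D"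
  \<comment> \<open>The supremum is taken over simple functions with finite values, so that their
    coefficients can be read as real numbers.\<close>
  unfolding nn_integral_def_finite
proof (rule SUP_least)
  interpret prob_space M by (rule M)
  fix s assume "s \<in> {s. simple_function \<nu> s \<and> s \<le> (\<lambda>l. ennreal (\<phi> l)) \<and> (\<forall>x. s x < top)}"
  then have s: "simple_function \<nu> s" and s\<phi>: "\<And>l. s l \<le> ennreal (\<phi> l)" and fin: "\<And>l. s l < top"
    by (auto simp: le_fun_def)
  have sets: "sets \<nu> = sets borel" using ids by (simp add: is_IDS_measure_def)
  then have space: "space \<nu> = UNIV" using sets_eq_imp_space_eq[of \<nu> borel] by simp
  \<comment> \<open>The level sets are indexed by the nonzero values of \<open>s\<close> themselves.
    The value 0 is left out because its level set need not be separated from 0, and it contributes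
    nothing to the integral.\<close>
  define V where "V = range s - {0}"
  define c where "c = (\<lambda>v :: ennreal. enn2real v)"
  define \<Delta> where "\<Delta> v = s -` {v}" for v
  have V: "finite V" using s by (simp add: V_def simple_function_def space)
  have c: "ennreal (c v) = v" "c v > 0" if "v \<in> V" for v
    using that fin by (auto simp: V_def c_def enn2real_positive_iff zero_less_iff_neq_zero)
  have \<Delta>: "\<Delta> v \<in> sets borel \<and> separated_from_0 (\<Delta> v)" if "v \<in> V" for v
  proof
    show "\<Delta> v \<in> sets borel"
      using s by (metis \<Delta>_def Int_UNIV_right borel_measurable_simple_function borel_singleton measurable_sets sets space sets.empty_sets)
    have "\<Delta> v \<subseteq> {l. c v \<le> \<phi> l}"
    proof
      fix l assume "l \<in> \<Delta> v"
      then have "ennreal (c v) \<le> ennreal (\<phi> l)" using s\<phi>[of l] c[OF that] by (simp add: \<Delta>_def)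
      then show "l \<in> {l. c v \<le> \<phi> l}" using \<phi>0 by (simp add: ennreal_le_iff)
    qed
    then show "separated_from_0 (\<Delta> v)" using sep[OF c(2)[OF that]] unfolding separated_from_0_def by blast
  qed
  have bound: "(\<Sum>v\<in>V. c v * indicat_real (\<Delta> v) l) \<le> \<phi> l" for l
  proof -
    have "(\<Sum>v\<in>V. c v * indicat_real (\<Delta> v) l) = (\<Sum>v\<in>V. if v = s l then c v else 0)"
      by (intro sum.cong) (auto simp: \<Delta>_def indicator_def)
    also have "\<dots> = (if s l \<in> V then c (s l) else 0)" using V by simp
    also have "\<dots> \<le> \<phi> l"
    proof (cases "s l \<in> V")
      case True
      then have "ennreal (c (s l)) \<le> ennreal (\<phi> l)" using s\<phi>[of l] c(1) by simp
      then show ?thesis using True \<phi>0 by (simp add: ennreal_le_iff)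
    qed (use \<phi>0 in simp)
    finally show ?thesis .
  qed
  have "integral\<^sup>S \<nu> s = (\<Sum>v\<in>V. v * emeasure \<nu> (\<Delta> v))"
    unfolding simple_integral_def space \<Delta>_def V_def
    using s by (intro sum.mono_neutral_cong_right) (auto simp: simple_function_def space)
  also have "\<dots> = (\<Sum>v\<in>V. v * (\<integral>\<^sup>+\<omega>. ennreal (ids_density disc \<tau> (h \<omega>) (\<Delta> v)) \<partial>M))"
    using ids \<Delta> by (intro sum.cong refl) (simp add: is_IDS_measure_def)
  also have "\<dots> \<le> (\<integral>\<^sup>+\<omega>. (\<Sum>v\<in>V. v * ennreal (ids_density disc \<tau> (h \<omega>) (\<Delta> v))) \<partial>M)"
    by (rule nn_integral_sum_superadditive[OF V])
  also have "\<dots> \<le> (\<integral>\<^sup>+\<omega>. ennreal D \<partial>M)"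
  proof (rule nn_integral_mono_AE)
    show "AE \<omega> in M. (\<Sum>v\<in>V. v * ennreal (ids_density disc \<tau> (h \<omega>) (\<Delta> v))) \<le> ennreal D"
      using le nonneg
    proof eventually_elim
      case (elim \<omega>)
      have n: "0 \<le> ids_density disc \<tau> (h \<omega>) (\<Delta> v)" if "v \<in> V" for v using elim(2) \<Delta>[OF that] by blast
      have "(\<Sum>v\<in>V. v * ennreal (ids_density disc \<tau> (h \<omega>) (\<Delta> v)))
        = (\<Sum>v\<in>V. ennreal (c v * ids_density disc \<tau> (h \<omega>) (\<Delta> v)))"
        by (intro sum.cong refl) (use c n in \<open>simp add: ennreal_mult less_imp_le\<close>)
      also have "\<dots> = ennreal (\<Sum>v\<in>V. c v * ids_density disc \<tau> (h \<omega>) (\<Delta> v))"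
        using c(2) n by (intro sum_ennreal) (simp add: less_imp_le)
      also have "\<dots> \<le> ennreal D"
      proof (rule ennreal_leI)
        have "\<forall>i\<in>V. 0 \<le> c i" using c(2) less_imp_le by blast
        then show "(\<Sum>v\<in>V. c v * ids_density disc \<tau> (h \<omega>) (\<Delta> v)) \<le> D"
          using elim(1)[rule_format, of V \<Delta> c] V \<Delta> bound by blast
      qed
      finally show ?case .
    qed
  qed
  also have "\<dots> = ennreal D" by (simp add: emeasure_space_1)
  finally show "integral\<^sup>S \<nu> s \<le> ennreal D" .
qed

theorem theorem5p5:
  fixes M :: "'a measure" and disc :: bool and T :: "real \<Rightarrow> 'a \<Rightarrow> 'a"
    and \<tau> :: real and h :: "'a \<Rightarrow> real \<Rightarrow> real" and \<nu> :: "real measure"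
  assumes "ergodic_hankel M disc T \<tau> h"
    and "is_IDS_measure M disc \<tau> h \<nu>"
  shows "(\<integral>\<^sup>+l. ennreal (l\<^sup>2) \<partial>\<nu>) < \<infinity> \<and>
         ((AE \<omega> in M. psd_hankel (h \<omega>)) \<longrightarrow> (\<integral>\<^sup>+l. ennreal \<bar>l\<bar> \<partial>\<nu>) < \<infinity>)"
proof -
  have M: "prob_space M" and \<tau>: "\<tau> > 0" and meas: "\<And>\<omega>. \<omega> \<in> space M \<Longrightarrow> h \<omega> \<in> borel_measurable borel"
    using assms(1) by (auto simp: ergodic_hankel_def)
  obtain C0 where C0: "AE \<omega> in M. \<forall>t>0. \<bar>h \<omega> t\<bar> \<le> C0 / t"
    using assms(1) by (auto simp: ergodic_hankel_def)
  \<comment> \<open>The maximum with 0 provides the nonnegative constant that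
    \<open>hankel_kernel\<close> asks for and only weakens the bound.\<close>
  define C where "C = max 0 C0"
  have hk: "AE \<omega> in M. hankel_kernel (h \<omega>) C"
    using C0 AE_space
  proof eventually_elim
    case (elim \<omega>)
    show ?case
    proof
      show "h \<omega> \<in> borel_measurable borel" by (rule meas[OF elim(2)])
      show "0 \<le> C" by (simp add: C_def)
      fix t :: real assume t: "t > 0"
      then have "C0 / t \<le> C / t" by (intro divide_right_mono) (auto simp: C_def)
      then show "\<bar>h \<omega> t\<bar> \<le> C / t" using elim(1) t by force
    qed
  qed
  have nonneg: "AE \<omega> in M. \<forall>\<Delta>. \<Delta> \<in> sets borel \<longrightarrow> separated_from_0 \<Delta> \<longrightarrow> 0 \<le> ids_density disc \<tau> (h \<omega>) \<Delta>"
    using hk by eventually_elim (use hankel_kernel.ids_density_nonneg \<tau> in blast)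
  have "(\<integral>\<^sup>+l. ennreal (l\<^sup>2) \<partial>\<nu>) \<le> ennreal (8 * C\<^sup>2)"
  proof (rule IDS_integral_le[OF M assms(2) _ _ nonneg])
    show "separated_from_0 {l. c \<le> l\<^sup>2}" if "c > 0" for c :: real
      unfolding separated_from_0_def
    proof (intro exI[of _ "sqrt c"] conjI ballI)
      show "0 < sqrt c" using that by simp
      fix l assume "l \<in> {l. c \<le> l\<^sup>2}"
      then have "sqrt c \<le> sqrt (l\<^sup>2)" by (intro real_sqrt_le_mono) simp
      then show "sqrt c \<le> \<bar>l\<bar>" by simp
    qed
    show "AE \<omega> in M. \<forall>(V :: ennreal set) \<Delta> c. finite V \<longrightarrow>
        (\<forall>i\<in>V. \<Delta> i \<in> sets borel \<and> separated_from_0 (\<Delta> i)) \<longrightarrow> (\<forall>i\<in>V. 0 \<le> c i) \<longrightarrow>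
        (\<forall>l. (\<Sum>i\<in>V. c i * indicat_real (\<Delta> i) l) \<le> l\<^sup>2) \<longrightarrow>
        (\<Sum>i\<in>V. c i * ids_density disc \<tau> (h \<omega>) (\<Delta> i)) \<le> 8 * C\<^sup>2"
      using hk
    proof eventually_elim
      case (elim \<omega>)
      show ?case by (intro allI impI hankel_kernel.ids_density_square_le[OF elim _ _ \<tau>]) auto
    qed
  qed simp
  moreover have "(\<integral>\<^sup>+l. ennreal \<bar>l\<bar> \<partial>\<nu>) \<le> ennreal C" if psd: "AE \<omega> in M. psd_hankel (h \<omega>)"
  proof (rule IDS_integral_le[OF M assms(2) _ _ nonneg])
    show "separated_from_0 {l. c \<le> \<bar>l\<bar>}" if "c > 0" for c :: real
      using that unfolding separated_from_0_def by (intro exI[of _ c]) auto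
    show "AE \<omega> in M. \<forall>(V :: ennreal set) \<Delta> c. finite V \<longrightarrow>
        (\<forall>i\<in>V. \<Delta> i \<in> sets borel \<and> separated_from_0 (\<Delta> i)) \<longrightarrow> (\<forall>i\<in>V. 0 \<le> c i) \<longrightarrow>
        (\<forall>l. (\<Sum>i\<in>V. c i * indicat_real (\<Delta> i) l) \<le> \<bar>l\<bar>) \<longrightarrow>
        (\<Sum>i\<in>V. c i * ids_density disc \<tau> (h \<omega>) (\<Delta> i)) \<le> C"
      using hk psd
    proof eventually_elim
      case (elim \<omega>)
      show ?case by (intro allI impI hankel_kernel.ids_density_abs_le[OF elim(1) _ _ \<tau> _ elim(2)]) auto
    qed
  qed simp
  ultimately show ?thesis
    by (auto intro: order_le_less_trans)
qed

end
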